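(* Let $G$ be a group. The 4-category $3\mathsf{Cat}_G^{\mathrm{pt}}$ is isomorphic to the strict 2-category $3\mathsf{Cat}_G^{\mathrm{st}}$ defined as follows. An object is a $\mathsf{Gray}$-monoid $\mathcal C$ whose set of 0-cells is $G$ (elements of $G$ seen as 0-cells of $\mathcal C$ are denoted $g_{\mathcal C}$) and for which composition of 0-cells is given by group multiplication. A 1-morphism $A:\mathcal C\to\mathcal D$ is a 3-functor $A:\mathrm{B}\mathcal C\to\mathrm{B}\mathcal D$ such that $A(g_{\mathcal C})=g_{\mathcal D}$ for all $g\in G$; the adjoint equivalence $\mu^A$ satisfies $\mu^A_{g,h}=\mathrm{id}_{gh_{\mathcal D}}$ for all $g,h\in G$; the adjoint equivalence $\iota^A=(\iota^A_*,\iota^A_1)$ satisfies $\iota^A_*=\mathrm{id}_{e_{\mathcal D}}$ and $\iota^A_1=A^1_e$; and the associators and unitors $\omega^A,\ell^A,r^A$ are identities. A 2-morphism $\eta:A\Rightarrow B$ is a natural transformation such that $\eta_*=e_{\mathcal D}$, $\eta_g=\mathrm{id}_{g_{\mathcal D}}$, $\eta^1=\mathrm{id}_{\mathrm{id}_{e_{\mathcal D}}}$ and $\eta^2_{g,h}=\mathrm{id}_{\mathrm{id}_{gh_{\mathcal D}}}$ for all $g,h\in G$. Composition of 1- and 2-morphisms is the usual composition of 3-functors and natural transformations.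
   Context: Conventions. A 3-category is an algebraic tricategory, and (3-)functor, (natural) transformation, modification, perturbation mean trihomomorphism, tritransformation, trimodification, perturbation, all in the sense of Gurski's "Coherence in Three-Dimensional Category Theory". "Invertible" means that a (coherent) inverse exists. $\mathrm{B}G$ is $G$ viewed as a 1-category with one object and endomorphisms $G$, regarded as a 3-category with only identity higher morphisms. A $\mathsf{Gray}$-monoid is a monoid in the category $\mathsf{Gray}$ of strict 2-categories with the Gray tensor product; its objects, 1- and 2-morphisms are called 0-, 1-, 2-cells; $\mathrm{B}\mathcal C$ is the one-object $\mathsf{Gray}$-category with endomorphisms $\mathcal C$. For 1-cells $x:a\to b$, $y:c\to d$ one sets $x\otimes y:=(x\otimes\mathrm{id}_d)\circ(\mathrm{id}_a\otimes y)$. Data of higher morphisms between $\mathsf{Gray}$-monoids. A 3-functor $A:\mathrm{B}\mathcal C\to\mathrm{B}\mathcal D$ consists of a 2-functor $(A,A^1,A^2):\mathcal C\to\mathcal D$ with $A^1_c:\mathrm{id}_{A(c)}\Rightarrow A(\mathrm{id}_c)$, $A^2_{y,x}:A(y)\circ A(x)\Rightarrow A(y\circ x)$; an adjoint equivalence $\mu^A$ with 1-cells $\mu^A_{a,b}:A(a)\otimes A(b)\to A(a\otimes b)$ and invertible 2-cells $\mu^A_{x,y}:\mu^A_{c,d}\circ(A(x)\otimes A(y))\Rightarrow A(x\otimes y)\circ\mu^A_{a,b}$; an adjoint equivalence $\iota^A$ with 1-cell $\iota^A_*:1_{\mathcal D}\to A(1_{\mathcal C})$ and 2-cell $\iota^A_1:\iota^A_*\Rightarrow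 A(\mathrm{id}_{1_{\mathcal C}})\circ\iota^A_*$; and invertible associator and unitor modifications $\omega^A,\ell^A,r^A$. A transformation $\eta:A\Rightarrow B$ consists of a 0-cell $\eta_*$, adjoint equivalence 1-cells $\eta_c:\eta_*\otimes A(c)\to B(c)\otimes\eta_*$, invertible 2-cells $\eta_x:\eta_b\circ(\eta_*\otimes A(x))\Rightarrow(B(x)\otimes\eta_* )\circ\eta_a$ for $x:a\to b$, a unit coherence $\eta^1:\eta_{1_{\mathcal C}}\circ(\eta_*\otimes\iota^A_* )\Rightarrow\iota^B_*\otimes\eta_*$ and $\eta^2_{a,b}:\eta_{a\otimes b}\circ(\eta_*\otimes\mu^A_{a,b})\Rightarrow(\mu^B_{a,b}\otimes\eta_* )\circ(B(a)\otimes\eta_b)\circ(\eta_a\otimes A(b))$. A modification $m:\eta\Rrightarrow\zeta$ consists of a 1-cell $m_*:\eta_*\to\zeta_*$ and invertible 2-cells $m_c:\zeta_c\circ(m_*\otimes A(c))\Rightarrow(B(c)\otimes m_* )\circ\eta_c$. A perturbation $m\to n$ is a 2-cell $\rho_*:m_*\Rightarrow n_*$ compatible with $m_c,n_c$. All are subject to Gurski's axioms. The 4-category $3\mathsf{Cat}_G^{\mathrm{pt}}$. Objects: pairs $(\mathrm{B}\mathcal C,\pi^{\mathcal C})$ with $\mathcal C$ a $\mathsf{Gray}$-monoid and $\pi^{\mathcal C}:\mathrm{B}G\to\mathrm{B}\mathcal C$ a $\mathsf{Gray}$-functor which is a bijection from $G$ onto the 0-cells of $\mathcal C$; write $g_{\mathcal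 C}=\pi^{\mathcal C}(g)$. 1-morphisms $(A,\alpha)$: a 3-functor $A:\mathrm{B}\mathcal C\to\mathrm{B}\mathcal D$ and an invertible transformation $\alpha:\pi^{\mathcal D}\Rightarrow A\circ\pi^{\mathcal C}$ such that $A(g_{\mathcal C})=g_{\mathcal D}$, $\mu^A_{g,h}=\mathrm{id}$, $\iota^A_*=\mathrm{id}_{e_{\mathcal D}}$, $\iota^A_1=A^1_e$, $\omega^A,\ell^A,r^A$ are identities, $\alpha_*=e_{\mathcal D}$, $\alpha_g=\mathrm{id}_{g_{\mathcal D}}$, $\alpha_{\mathrm{id}_g}=A^1_g$, and $\alpha^1,\alpha^2_{g,h}$ are identities. 2-morphisms $(\eta,m):(A,\alpha)\Rightarrow(B,\beta)$: a transformation $\eta:A\Rightarrow B$ with $\eta_*=e_{\mathcal D}$, $\eta_{g}=\mathrm{id}_{g_{\mathcal D}}$, $\eta^1,\eta^2_{g,h}$ identities, and the modification $m:\beta\Rrightarrow(\eta\circ\pi^{\mathcal C})*\alpha$ with $m_*=\mathrm{id}_{e_{\mathcal D}}$, $m_g=\mathrm{id}$. 3-morphisms $(p,\rho):(\eta,m)\Rrightarrow(\zeta,n)$: modifications $p:\eta\Rrightarrow\zeta$ with $p_*=\mathrm{id}_{e_{\mathcal D}}$, $p_g=\mathrm{id}$, together with a perturbation $\rho$ (from $n$ to $((p\circ\pi^{\mathcal C})*\alpha)\cdot m$) with $\rho_*=\mathrm{id}$; these are only identities. 4-morphisms $\xi$: perturbations with $\xi_*=\mathrm{id}$; these are only ide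ntities.
   Formalization: The usual composite of 3-functors has μ_{g,h}=B(id), not id, so it leaves the stated 1-morphisms; composites and whiskerings are taken with B(id) cancelled along B^1: id⇒B(id). "Set of 0-cells is G" is read as a chosen multiplicative bijection g↦g_C from G onto the 0-cells. *)

theory Defs
  imports "HOL-Algebra.Group"
begin

section \<open>Strict 2-categories\<close>

record ('o, 'm, 't) twocat =
  Obj :: "'o set"
  Arr :: "'m set"
  Cel :: "'t set"
  Dom :: "'m \<Rightarrow> 'o"
  Cod :: "'m \<Rightarrow> 'o"
  Src :: "'t \<Rightarrow> 'm"
  Tgt :: "'t \<Rightarrow> 'm"
  Id1 :: "'o \<Rightarrow> 'm"
  Id2 :: "'m \<Rightarrow> 't" ("\<guillemotleft>_\<guillemotright>\<index>")
  Cmp :: "'m \<Rightarrow> 'm \<Rightarrow> 'm" (infixr "\<cdot>\<index>" 75)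
  VCmp :: "'t \<Rightarrow> 't \<Rightarrow> 't" (infixr "\<bullet>\<index>" 65)
  HCmp :: "'t \<Rightarrow> 't \<Rightarrow> 't" (infixr "\<star>\<index>" 70)

text \<open>All compositions are written in function order: \<open>y \<cdot> x\<close>, \<open>g \<bullet> f\<close> and \<open>g \<star> f\<close> mean
  ``first \<open>x\<close>'', ``first \<open>f\<close>''.  \<open>\<bullet>\<close> is vertical and \<open>\<star>\<close> horizontal composition of 2-cells, and
  \<open>\<guillemotleft>x\<guillemotright>\<close> is the identity 2-cell of a 1-cell.\<close>

definition arr :: "('o,'m,'t,'z) twocat_scheme \<Rightarrow> 'm \<Rightarrow> 'o \<Rightarrow> 'o \<Rightarrow> bool" where
  "arr D x a b \<longleftrightarrow> x \<in> Arr D \<and> Dom D x = a \<and> Cod D x = b"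

definition cell :: "('o,'m,'t,'z) twocat_scheme \<Rightarrow> 't \<Rightarrow> 'm \<Rightarrow> 'm \<Rightarrow> bool" where
  "cell D f x y \<longleftrightarrow> f \<in> Cel D \<and> Src D f = x \<and> Tgt D f = y"

definition inverse2 :: "('o,'m,'t,'z) twocat_scheme \<Rightarrow> 't \<Rightarrow> 't \<Rightarrow> bool" where
  "inverse2 D f g \<longleftrightarrow> cell D g (Tgt D f) (Src D f)
     \<and> g \<bullet>\<^bsub>D\<^esub> f = \<guillemotleft>Src D f\<guillemotright>\<^bsub>D\<^esub> \<and> f \<bullet>\<^bsub>D\<^esub> g = \<guillemotleft>Tgt D f\<guillemotright>\<^bsub>D\<^esub>"

definition icell :: "('o,'m,'t,'z) twocat_scheme \<Rightarrow> 't \<Rightarrow> 'm \<Rightarrow> 'm \<Rightarrow> bool" where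
  "icell D f x y \<longleftrightarrow> cell D f x y \<and> (\<exists>g. inverse2 D f g)"

definition inv2 :: "('o,'m,'t,'z) twocat_scheme \<Rightarrow> 't \<Rightarrow> 't" where
  "inv2 D f = (THE g. inverse2 D f g)"

definition strict_2category :: "('o,'m,'t,'z) twocat_scheme \<Rightarrow> bool" where
  "strict_2category D \<longleftrightarrow>
     (\<forall>x \<in> Arr D. Dom D x \<in> Obj D \<and> Cod D x \<in> Obj D)
   \<and> (\<forall>f \<in> Cel D. Src D f \<in> Arr D \<and> Tgt D f \<in> Arr D
        \<and> Dom D (Src D f) = Dom D (Tgt D f) \<and> Cod D (Src D f) = Cod D (Tgt D f))
   \<and> (\<forall>a \<in> Obj D. arr D (Id1 D a) a a)
   \<and> (\<forall>x \<in> Arr D. cell D \<guillemotleft>x\<guillemotright> x x)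
   \<and> (\<forall>x a b y c. arr D x a b \<longrightarrow> arr D y b c \<longrightarrow> arr D (y \<cdot> x) a c)
   \<and> (\<forall>x a b. arr D x a b \<longrightarrow> x \<cdot> Id1 D a = x \<and> Id1 D b \<cdot> x = x)
   \<and> (\<forall>x a b y c z d. arr D x a b \<longrightarrow> arr D y b c \<longrightarrow> arr D z c d \<longrightarrow> (z \<cdot> y) \<cdot> x = z \<cdot> (y \<cdot> x))
   \<and> (\<forall>f g x y z. cell D f x y \<longrightarrow> cell D g y z \<longrightarrow> cell D (g \<bullet> f) x z)
   \<and> (\<forall>f x y. cell D f x y \<longrightarrow> f \<bullet> \<guillemotleft>x\<guillemotright> = f \<and> \<guillemotleft>y\<guillemotright> \<bullet> f = f)
   \<and> (\<forall>f g h w x y z. cell D f w x \<longrightarrow> cell D g x y \<longrightarrow> cell D h y z \<longrightarrow> (h \<bullet> g) \<bullet> f = h \<bullet> (g \<bullet> f))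
   \<and> (\<forall>f g x x' y y'. cell D f x x' \<longrightarrow> cell D g y y' \<longrightarrow> Cod D x = Dom D y
        \<longrightarrow> cell D (g \<star> f) (y \<cdot> x) (y' \<cdot> x'))
   \<and> (\<forall>x y. x \<in> Arr D \<longrightarrow> y \<in> Arr D \<longrightarrow> Cod D x = Dom D y \<longrightarrow> \<guillemotleft>y\<guillemotright> \<star> \<guillemotleft>x\<guillemotright> = \<guillemotleft>y \<cdot> x\<guillemotright>)
   \<and> (\<forall>f f' g g' x x' x'' y y' y''. cell D f x x' \<longrightarrow> cell D f' x' x'' \<longrightarrow> cell D g y y' \<longrightarrow> cell D g' y' y''
        \<longrightarrow> Cod D x = Dom D y \<longrightarrow> (g' \<bullet> g) \<star> (f' \<bullet> f) = (g' \<star> f') \<bullet> (g \<star> f))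
   \<and> (\<forall>f x y. cell D f x y \<longrightarrow> f \<star> \<guillemotleft>Id1 D (Dom D x)\<guillemotright> = f \<and> \<guillemotleft>Id1 D (Cod D x)\<guillemotright> \<star> f = f)
   \<and> (\<forall>f g h x x' y y' z z'. cell D f x x' \<longrightarrow> cell D g y y' \<longrightarrow> cell D h z z'
        \<longrightarrow> Cod D x = Dom D y \<longrightarrow> Cod D y = Dom D z \<longrightarrow> (h \<star> g) \<star> f = h \<star> (g \<star> f))"
  for D (structure)


section \<open>Gray-monoids\<close>

text \<open>A Gray-monoid is a monoid in the category of strict 2-categories with the Gray tensor product.
  A 2-functor out of a Gray tensor product amounts to two families of partial strict 2-functors,
  here \<open>a \<ltimes> -\<close> and \<open>- \<rtimes> b\<close>, together with invertible interchange 2-cells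
  \<open>Ich x y : (x \<rtimes> d) \<cdot> (a \<ltimes> y) \<Rightarrow> (b \<ltimes> y) \<cdot> (x \<rtimes> c)\<close> for \<open>x : a \<rightarrow> b\<close>, \<open>y : c \<rightarrow> d\<close>.\<close>

record ('o, 'm, 't) gray = "('o, 'm, 't) twocat" +
  Unt :: "'o"
  Ten :: "'o \<Rightarrow> 'o \<Rightarrow> 'o" (infixr "\<odot>\<index>" 90)
  LW1 :: "'o \<Rightarrow> 'm \<Rightarrow> 'm" (infixr "\<ltimes>\<index>" 85)
  LW2 :: "'o \<Rightarrow> 't \<Rightarrow> 't" (infixr "\<ltimes>\<^sub>2\<index>" 85)
  RW1 :: "'m \<Rightarrow> 'o \<Rightarrow> 'm" (infixl "\<rtimes>\<index>" 86)
  RW2 :: "'t \<Rightarrow> 'o \<Rightarrow> 't" (infixl "\<rtimes>\<^sub>2\<index>" 86)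
  Ich :: "'m \<Rightarrow> 'm \<Rightarrow> 't"

definition strict_2endo :: "('o,'m,'t,'z) twocat_scheme \<Rightarrow> ('o \<Rightarrow> 'o) \<Rightarrow> ('m \<Rightarrow> 'm) \<Rightarrow> ('t \<Rightarrow> 't) \<Rightarrow> bool" where
  "strict_2endo D F0 F1 F2 \<longleftrightarrow>
     (\<forall>a \<in> Obj D. F0 a \<in> Obj D \<and> F1 (Id1 D a) = Id1 D (F0 a))
   \<and> (\<forall>x a b. arr D x a b \<longrightarrow> arr D (F1 x) (F0 a) (F0 b) \<and> F2 \<guillemotleft>x\<guillemotright> = \<guillemotleft>F1 x\<guillemotright>)
   \<and> (\<forall>f x y. cell D f x y \<longrightarrow> cell D (F2 f) (F1 x) (F1 y))
   \<and> (\<forall>x a b y c. arr D x a b \<longrightarrow> arr D y b c \<longrightarrow> F1 (y \<cdot> x) = F1 y \<cdot> F1 x)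
   \<and> (\<forall>f g x y z. cell D f x y \<longrightarrow> cell D g y z \<longrightarrow> F2 (g \<bullet> f) = F2 g \<bullet> F2 f)
   \<and> (\<forall>f g x x' y y'. cell D f x x' \<longrightarrow> cell D g y y' \<longrightarrow> Cod D x = Dom D y \<longrightarrow> F2 (g \<star> f) = F2 g \<star> F2 f)"
  for D (structure)

definition gray_monoid :: "('o,'m,'t,'z) gray_scheme \<Rightarrow> bool" where
  "gray_monoid D \<longleftrightarrow> strict_2category D
   \<and> Unt D \<in> Obj D
   \<and> (\<forall>a \<in> Obj D. Unt D \<odot> a = a \<and> a \<odot> Unt D = a)
   \<and> (\<forall>a \<in> Obj D. \<forall>b \<in> Obj D. \<forall>c \<in> Obj D. (a \<odot> b) \<odot> c = a \<odot> (b \<odot> c))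
   \<and> (\<forall>a \<in> Obj D. strict_2endo D (\<lambda>b. a \<odot> b) (\<lambda>x. a \<ltimes> x) (\<lambda>f. a \<ltimes>\<^sub>2 f))
   \<and> (\<forall>b \<in> Obj D. strict_2endo D (\<lambda>a. a \<odot> b) (\<lambda>x. x \<rtimes> b) (\<lambda>f. f \<rtimes>\<^sub>2 b))
   \<and> (\<forall>x \<in> Arr D. Unt D \<ltimes> x = x \<and> x \<rtimes> Unt D = x)
   \<and> (\<forall>f \<in> Cel D. Unt D \<ltimes>\<^sub>2 f = f \<and> f \<rtimes>\<^sub>2 Unt D = f)
   \<and> (\<forall>a \<in> Obj D. \<forall>b \<in> Obj D. \<forall>x \<in> Arr D. (a \<odot> b) \<ltimes> x = a \<ltimes> (b \<ltimes> x)
        \<and> (a \<ltimes> x) \<rtimes> b = a \<ltimes> (x \<rtimes> b) \<and> x \<rtimes> (a \<odot> b) = (x \<rtimes> a) \<rtimes> b)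
   \<and> (\<forall>a \<in> Obj D. \<forall>b \<in> Obj D. \<forall>f \<in> Cel D. (a \<odot> b) \<ltimes>\<^sub>2 f = a \<ltimes>\<^sub>2 (b \<ltimes>\<^sub>2 f)
        \<and> (a \<ltimes>\<^sub>2 f) \<rtimes>\<^sub>2 b = a \<ltimes>\<^sub>2 (f \<rtimes>\<^sub>2 b) \<and> f \<rtimes>\<^sub>2 (a \<odot> b) = (f \<rtimes>\<^sub>2 a) \<rtimes>\<^sub>2 b)
   \<and> (\<forall>x a b y c d. arr D x a b \<longrightarrow> arr D y c d \<longrightarrow>
        icell D (Ich D x y) ((x \<rtimes> d) \<cdot> (a \<ltimes> y)) ((b \<ltimes> y) \<cdot> (x \<rtimes> c)))
   \<and> (\<forall>x a b c. arr D x a b \<longrightarrow> c \<in> Obj D \<longrightarrow>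
        Ich D x (Id1 D c) = \<guillemotleft>x \<rtimes> c\<guillemotright> \<and> Ich D (Id1 D c) x = \<guillemotleft>c \<ltimes> x\<guillemotright>)
   \<and> (\<forall>f x x' a b g y y' c d. cell D f x x' \<longrightarrow> cell D g y y' \<longrightarrow> arr D x a b \<longrightarrow> arr D y c d \<longrightarrow>
        Ich D x' y' \<bullet> ((f \<rtimes>\<^sub>2 d) \<star> (a \<ltimes>\<^sub>2 g)) = ((b \<ltimes>\<^sub>2 g) \<star> (f \<rtimes>\<^sub>2 c)) \<bullet> Ich D x y)
   \<and> (\<forall>x a b x' b' y c d. arr D x a b \<longrightarrow> arr D x' b b' \<longrightarrow> arr D y c d \<longrightarrow>
        Ich D (x' \<cdot> x) y = (Ich D x' y \<star> \<guillemotleft>x \<rtimes> c\<guillemotright>) \<bullet> (\<guillemotleft>x' \<rtimes> d\<guillemotright> \<star> Ich D x y))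
   \<and> (\<forall>x a b y c d y' d'. arr D x a b \<longrightarrow> arr D y c d \<longrightarrow> arr D y' d d' \<longrightarrow>
        Ich D x (y' \<cdot> y) = (\<guillemotleft>b \<ltimes> y'\<guillemotright> \<star> Ich D x y) \<bullet> (Ich D x y' \<star> \<guillemotleft>a \<ltimes> y\<guillemotright>))
   \<and> (\<forall>x \<in> Arr D. \<forall>y \<in> Arr D. \<forall>a \<in> Obj D. Ich D (a \<ltimes> x) y = a \<ltimes>\<^sub>2 Ich D x y
        \<and> Ich D (x \<rtimes> a) y = Ich D x (a \<ltimes> y) \<and> Ich D x (y \<rtimes> a) = Ich D x y \<rtimes>\<^sub>2 a)"
  for D (structure)

definition ten1 :: "('o,'m,'t,'z) gray_scheme \<Rightarrow> 'm \<Rightarrow> 'm \<Rightarrow> 'm" (infixr "\<boxtimes>\<index>" 80) where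
  "x \<boxtimes> y = (x \<rtimes> Cod D y) \<cdot> (Dom D x \<ltimes> y)"
  for D (structure)

definition ten2 :: "('o,'m,'t,'z) gray_scheme \<Rightarrow> 't \<Rightarrow> 't \<Rightarrow> 't" (infixr "\<boxtimes>\<^sub>2\<index>" 80) where
  "f \<boxtimes>\<^sub>2 g = (f \<rtimes>\<^sub>2 Cod D (Src D g)) \<star> (Dom D (Src D f) \<ltimes>\<^sub>2 g)"
  for D (structure)

text \<open>The structure 2-cell \<open>(x' \<boxtimes> y') \<cdot> (x \<boxtimes> y) \<Rightarrow> (x' \<cdot> x) \<boxtimes> (y' \<cdot> y)\<close> of the tensor product,
  regarded as a (cubical) pseudofunctor on the cartesian product.\<close>

definition cub :: "('o,'m,'t,'z) gray_scheme \<Rightarrow> 'm \<Rightarrow> 'm \<Rightarrow> 'm \<Rightarrow> 'm \<Rightarrow> 't" where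
  "cub D x' y' x y = \<guillemotleft>x' \<rtimes> Cod D y'\<guillemotright> \<star> inv2 D (Ich D x y') \<star> \<guillemotleft>Dom D x \<ltimes> y\<guillemotright>"
  for D (structure)

text \<open>The group \<open>G\<close> as a Gray-monoid with only identity 1- and 2-cells; an element \<open>g\<close> also stands
  for the identity 1-cell and the identity 2-cell on \<open>g\<close>.  Its delooping is \<open>BG\<close>.\<close>

definition disc :: "('g,'z) monoid_scheme \<Rightarrow> ('g,'g,'g) gray" where
  "disc G = \<lparr> Obj = carrier G, Arr = carrier G, Cel = carrier G,
     Dom = (\<lambda>g. g), Cod = (\<lambda>g. g), Src = (\<lambda>g. g), Tgt = (\<lambda>g. g), Id1 = (\<lambda>g. g), Id2 = (\<lambda>g. g),
     Cmp = (\<lambda>g h. g), VCmp = (\<lambda>g h. g), HCmp = (\<lambda>g h. g),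
     Unt = one G, Ten = mult G, LW1 = mult G, LW2 = mult G, RW1 = mult G, RW2 = mult G, Ich = mult G \<rparr>"

text \<open>Functions on cells are kept \<^const>\<open>extensional\<close> throughout, so that equality of
  higher morphisms is equality on the relevant cells.\<close>

record ('o,'m,'t,'p,'n,'u) grayfun =
  p0 :: "'o \<Rightarrow> 'p"
  p1 :: "'m \<Rightarrow> 'n"
  p2 :: "'t \<Rightarrow> 'u"

definition gray_functor ::
    "('o,'m,'t,'y) gray_scheme \<Rightarrow> ('p,'n,'u,'z) gray_scheme \<Rightarrow> ('o,'m,'t,'p,'n,'u) grayfun \<Rightarrow> bool" where
  "gray_functor C D P \<longleftrightarrow>
     p0 P \<in> extensional (Obj C) \<and> p1 P \<in> extensional (Arr C) \<and> p2 P \<in> extensional (Cel C)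
   \<and> (\<forall>a \<in> Obj C. p0 P a \<in> Obj D \<and> p1 P (Id1 C a) = Id1 D (p0 P a))
   \<and> (\<forall>x a b. arr C x a b \<longrightarrow> arr D (p1 P x) (p0 P a) (p0 P b) \<and> p2 P \<guillemotleft>x\<guillemotright>\<^bsub>C\<^esub> = \<guillemotleft>p1 P x\<guillemotright>)
   \<and> (\<forall>f x y. cell C f x y \<longrightarrow> cell D (p2 P f) (p1 P x) (p1 P y))
   \<and> (\<forall>x a b y c. arr C x a b \<longrightarrow> arr C y b c \<longrightarrow> p1 P (y \<cdot>\<^bsub>C\<^esub> x) = p1 P y \<cdot> p1 P x)
   \<and> (\<forall>f g x y z. cell C f x y \<longrightarrow> cell C g y z \<longrightarrow> p2 P (g \<bullet>\<^bsub>C\<^esub> f) = p2 P g \<bullet> p2 P f)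
   \<and> (\<forall>f g x x' y y'. cell C f x x' \<longrightarrow> cell C g y y' \<longrightarrow> Cod C x = Dom C y \<longrightarrow>
        p2 P (g \<star>\<^bsub>C\<^esub> f) = p2 P g \<star> p2 P f)
   \<and> p0 P (Unt C) = Unt D
   \<and> (\<forall>a \<in> Obj C. \<forall>b \<in> Obj C. p0 P (a \<odot>\<^bsub>C\<^esub> b) = p0 P a \<odot> p0 P b)
   \<and> (\<forall>a \<in> Obj C. \<forall>x \<in> Arr C.
        p1 P (a \<ltimes>\<^bsub>C\<^esub> x) = p0 P a \<ltimes> p1 P x \<and> p1 P (x \<rtimes>\<^bsub>C\<^esub> a) = p1 P x \<rtimes> p0 P a)
   \<and> (\<forall>a \<in> Obj C. \<forall>f \<in> Cel C.
        p2 P (a \<ltimes>\<^sub>2\<^bsub>C\<^esub> f) = p0 P a \<ltimes>\<^sub>2 p2 P f \<and> p2 P (f \<rtimes>\<^sub>2\<^bsub>C\<^esub> a) = p2 P f \<rtimes>\<^sub>2 p0 P a)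
   \<and> (\<forall>x \<in> Arr C. \<forall>y \<in> Arr C. p2 P (Ich C x y) = Ich D (p1 P x) (p1 P y))"
  for D (structure)


section \<open>Adjoint equivalences\<close>

record ('m, 't) adjeq =
  lf :: "'m"
  rt :: "'m"
  au :: "'t"
  ac :: "'t"

definition adj_equiv :: "('o,'m,'t,'z) twocat_scheme \<Rightarrow> ('m,'t) adjeq \<Rightarrow> 'o \<Rightarrow> 'o \<Rightarrow> bool" where
  "adj_equiv D e a b \<longleftrightarrow> arr D (lf e) a b \<and> arr D (rt e) b a
   \<and> icell D (au e) (Id1 D a) (rt e \<cdot> lf e) \<and> icell D (ac e) (lf e \<cdot> rt e) (Id1 D b)
   \<and> (ac e \<star> \<guillemotleft>lf e\<guillemotright>) \<bullet> (\<guillemotleft>lf e\<guillemotright> \<star> au e) = \<guillemotleft>lf e\<guillemotright>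
   \<and> (\<guillemotleft>rt e\<guillemotright> \<star> ac e) \<bullet> (au e \<star> \<guillemotleft>rt e\<guillemotright>) = \<guillemotleft>rt e\<guillemotright>"
  for D (structure)

definition idadj :: "('o,'m,'t,'z) twocat_scheme \<Rightarrow> 'o \<Rightarrow> ('m,'t) adjeq" where
  "idadj D a = \<lparr> lf = Id1 D a, rt = Id1 D a, au = \<guillemotleft>Id1 D a\<guillemotright>, ac = \<guillemotleft>Id1 D a\<guillemotright> \<rparr>"
  for D (structure)

definition cmpadj :: "('o,'m,'t,'z) twocat_scheme \<Rightarrow> ('m,'t) adjeq \<Rightarrow> ('m,'t) adjeq \<Rightarrow> ('m,'t) adjeq" where
  "cmpadj D e d = \<lparr> lf = lf e \<cdot> lf d, rt = rt d \<cdot> rt e,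
     au = (\<guillemotleft>rt d\<guillemotright> \<star> au e \<star> \<guillemotleft>lf d\<guillemotright>) \<bullet> au d,
     ac = ac e \<bullet> (\<guillemotleft>lf e\<guillemotright> \<star> ac d \<star> \<guillemotleft>rt e\<guillemotright>) \<rparr>"
  for D (structure)

definition lwadj :: "('o,'m,'t,'z) gray_scheme \<Rightarrow> 'o \<Rightarrow> ('m,'t) adjeq \<Rightarrow> ('m,'t) adjeq" where
  "lwadj D a e = \<lparr> lf = a \<ltimes> lf e, rt = a \<ltimes> rt e, au = a \<ltimes>\<^sub>2 au e, ac = a \<ltimes>\<^sub>2 ac e \<rparr>"
  for D (structure)

definition rwadj :: "('o,'m,'t,'z) gray_scheme \<Rightarrow> ('m,'t) adjeq \<Rightarrow> 'o \<Rightarrow> ('m,'t) adjeq" where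
  "rwadj D e a = \<lparr> lf = lf e \<rtimes> a, rt = rt e \<rtimes> a, au = au e \<rtimes>\<^sub>2 a, ac = ac e \<rtimes>\<^sub>2 a \<rparr>"
  for D (structure)


section \<open>3-functors between deloopings of Gray-monoids\<close>

record ('o,'m,'t,'p,'n,'u) threefun =
  fo :: "'o \<Rightarrow> 'p"
  fm :: "'m \<Rightarrow> 'n"
  fc :: "'t \<Rightarrow> 'u"
  fu :: "'o \<Rightarrow> 'u"
  fp :: "'m \<times> 'm \<Rightarrow> 'u"
  mu :: "'o \<times> 'o \<Rightarrow> ('n,'u) adjeq"
  mm :: "'m \<times> 'm \<Rightarrow> 'u"
  io :: "('n,'u) adjeq"
  im :: "'u"
  om :: "'o \<times> 'o \<times> 'o \<Rightarrow> 'u"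
  el :: "'o \<Rightarrow> 'u"
  ar :: "'o \<Rightarrow> 'u"

text \<open>In the usual notation: \<open>fu A c = A\<^sup>1\<^sub>c\<close>, \<open>fp A (y, x)\<close> is \<open>A\<^sup>2\<close> at \<open>(y, x)\<close>, \<open>mu A (a, b)\<close> is the adjoint
  equivalence with left leg the 1-cell \<open>\<mu>\<close> at \<open>(a, b)\<close>, \<open>mm A (x, y)\<close> is the 2-cell \<open>\<mu>\<close> at \<open>(x, y)\<close>,
  \<open>io A\<close> and \<open>im A\<close> are \<open>\<iota>\<^sub>*\<close> and \<open>\<iota>\<^sub>1\<close>, and \<open>om\<close>, \<open>el\<close>, \<open>ar\<close> are \<open>\<omega>\<close>, \<open>\<ell>\<close>, \<open>r\<close>.  An adjoint
  equivalence of pseudonatural transformations is given by its left adjoint together with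
  adjoint equivalence data for each component 1-cell: the 2-cells of the right adjoint are then
  the mates of those of the left adjoint.\<close>

abbreviation mu1 :: "('o,'m,'t,'p,'n,'u) threefun \<Rightarrow> 'o \<Rightarrow> 'o \<Rightarrow> 'n" where
  "mu1 A a b \<equiv> lf (mu A (a, b))"

abbreviation io1 :: "('o,'m,'t,'p,'n,'u) threefun \<Rightarrow> 'n" where
  "io1 A \<equiv> lf (io A)"

definition cpairs :: "('o,'m,'t,'z) twocat_scheme \<Rightarrow> ('m \<times> 'm) set" where
  "cpairs C = {(y, x). x \<in> Arr C \<and> y \<in> Arr C \<and> Cod C x = Dom C y}"

definition pseudofunctor ::
    "('o,'m,'t,'y) gray_scheme \<Rightarrow> ('p,'n,'u,'z) gray_scheme \<Rightarrow> ('o,'m,'t,'p,'n,'u) threefun \<Rightarrow> bool" where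
  "pseudofunctor C D A \<longleftrightarrow>
     fo A \<in> extensional (Obj C) \<and> fm A \<in> extensional (Arr C) \<and> fc A \<in> extensional (Cel C)
   \<and> fu A \<in> extensional (Obj C) \<and> fp A \<in> extensional (cpairs C)
   \<and> (\<forall>a \<in> Obj C. fo A a \<in> Obj D)
   \<and> (\<forall>x a b. arr C x a b \<longrightarrow> arr D (fm A x) (fo A a) (fo A b) \<and> fc A \<guillemotleft>x\<guillemotright>\<^bsub>C\<^esub> = \<guillemotleft>fm A x\<guillemotright>)
   \<and> (\<forall>f x y. cell C f x y \<longrightarrow> cell D (fc A f) (fm A x) (fm A y))
   \<and> (\<forall>f g x y z. cell C f x y \<longrightarrow> cell C g y z \<longrightarrow> fc A (g \<bullet>\<^bsub>C\<^esub> f) = fc A g \<bullet> fc A f)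
   \<and> (\<forall>a \<in> Obj C. icell D (fu A a) (Id1 D (fo A a)) (fm A (Id1 C a)))
   \<and> (\<forall>x a b y c. arr C x a b \<longrightarrow> arr C y b c \<longrightarrow>
        icell D (fp A (y, x)) (fm A y \<cdot> fm A x) (fm A (y \<cdot>\<^bsub>C\<^esub> x)))
   \<and> (\<forall>f x x' g y y'. cell C f x x' \<longrightarrow> cell C g y y' \<longrightarrow> Cod C x = Dom C y \<longrightarrow>
        fc A (g \<star>\<^bsub>C\<^esub> f) \<bullet> fp A (y, x) = fp A (y', x') \<bullet> (fc A g \<star> fc A f))
   \<and> (\<forall>x a b y c z d. arr C x a b \<longrightarrow> arr C y b c \<longrightarrow> arr C z c d \<longrightarrow>
        fp A (z \<cdot>\<^bsub>C\<^esub> y, x) \<bullet> (fp A (z, y) \<star> \<guillemotleft>fm A x\<guillemotright>) = fp A (z, y \<cdot>\<^bsub>C\<^esub> x) \<bullet> (\<guillemotleft>fm A z\<guillemotright> \<star> fp A (y, x)))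
   \<and> (\<forall>x a b. arr C x a b \<longrightarrow>
        fp A (x, Id1 C a) \<bullet> (\<guillemotleft>fm A x\<guillemotright> \<star> fu A a) = \<guillemotleft>fm A x\<guillemotright>
      \<and> fp A (Id1 C b, x) \<bullet> (fu A b \<star> \<guillemotleft>fm A x\<guillemotright>) = \<guillemotleft>fm A x\<guillemotright>)"
  for D (structure)

text \<open>\<open>\<mu>\<close> is pseudonatural from \<open>\<otimes> \<circ> (A \<times> A)\<close> to \<open>A \<circ> \<otimes>\<close>, where \<open>\<otimes>\<close> carries the structure
  2-cells \<^const>\<open>cub\<close>.  \<open>\<iota>\<close> is pseudonatural between functors on the terminal 2-category; its
  compatibility with composition follows from that with units.\<close>

definition mult_iota ::
    "('o,'m,'t,'y) gray_scheme \<Rightarrow> ('p,'n,'u,'z) gray_scheme \<Rightarrow> ('o,'m,'t,'p,'n,'u) threefun \<Rightarrow> bool" where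
  "mult_iota C D A \<longleftrightarrow>
     mu A \<in> extensional (Obj C \<times> Obj C) \<and> mm A \<in> extensional (Arr C \<times> Arr C)
   \<and> (\<forall>a \<in> Obj C. \<forall>b \<in> Obj C. adj_equiv D (mu A (a, b)) (fo A a \<odot> fo A b) (fo A (a \<odot>\<^bsub>C\<^esub> b)))
   \<and> (\<forall>x a c y b d. arr C x a c \<longrightarrow> arr C y b d \<longrightarrow>
        icell D (mm A (x, y)) (mu1 A c d \<cdot> (fm A x \<boxtimes> fm A y)) (fm A (x \<boxtimes>\<^bsub>C\<^esub> y) \<cdot> mu1 A a b))
   \<and> (\<forall>f x x' a c g y y' b d. cell C f x x' \<longrightarrow> cell C g y y' \<longrightarrow> arr C x a c \<longrightarrow> arr C y b d \<longrightarrow>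
        (fc A (f \<boxtimes>\<^sub>2\<^bsub>C\<^esub> g) \<star> \<guillemotleft>mu1 A a b\<guillemotright>) \<bullet> mm A (x, y)
          = mm A (x', y') \<bullet> (\<guillemotleft>mu1 A c d\<guillemotright> \<star> (fc A f \<boxtimes>\<^sub>2 fc A g)))
   \<and> (\<forall>x a c x' e y b d y' h. arr C x a c \<longrightarrow> arr C x' c e \<longrightarrow> arr C y b d \<longrightarrow> arr C y' d h \<longrightarrow>
        ((fc A (cub C x' y' x y) \<bullet> fp A (x' \<boxtimes>\<^bsub>C\<^esub> y', x \<boxtimes>\<^bsub>C\<^esub> y)) \<star> \<guillemotleft>mu1 A a b\<guillemotright>)
          \<bullet> (\<guillemotleft>fm A (x' \<boxtimes>\<^bsub>C\<^esub> y')\<guillemotright> \<star> mm A (x, y))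
          \<bullet> (mm A (x', y') \<star> \<guillemotleft>fm A x \<boxtimes> fm A y\<guillemotright>)
        = mm A (x' \<cdot>\<^bsub>C\<^esub> x, y' \<cdot>\<^bsub>C\<^esub> y)
          \<bullet> (\<guillemotleft>mu1 A e h\<guillemotright> \<star> ((fp A (x', x) \<boxtimes>\<^sub>2 fp A (y', y)) \<bullet> cub D (fm A x') (fm A y') (fm A x) (fm A y))))
   \<and> (\<forall>a \<in> Obj C. \<forall>b \<in> Obj C.
        mm A (Id1 C a, Id1 C b) \<bullet> (\<guillemotleft>mu1 A a b\<guillemotright> \<star> (fu A a \<boxtimes>\<^sub>2 fu A b)) = fu A (a \<odot>\<^bsub>C\<^esub> b) \<star> \<guillemotleft>mu1 A a b\<guillemotright>)
   \<and> adj_equiv D (io A) (Unt D) (fo A (Unt C))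
   \<and> icell D (im A) (io1 A) (fm A (Id1 C (Unt C)) \<cdot> io1 A)
   \<and> im A = fu A (Unt C) \<star> \<guillemotleft>io1 A\<guillemotright>"
  for D (structure)

text \<open>The associator and unitors have components
    \<open>\<omega> : \<mu> \<cdot> (\<mu> \<otimes> 1) \<Rightarrow> \<mu> \<cdot> (1 \<otimes> \<mu>)\<close>, \<open>\<ell> : \<mu> \<cdot> (\<iota> \<otimes> 1) \<Rightarrow> 1\<close>, \<open>r : \<mu> \<cdot> (1 \<otimes> \<iota>) \<Rightarrow> 1\<close>.
  The equations are, in this order, the modification axioms for \<open>\<omega>\<close>, \<open>\<ell>\<close> and \<open>r\<close>, whose left and
  right hand sides paste the naturality 2-cells of the composite pseudonatural transformations.\<close>

definition assoc_unitors ::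
    "('o,'m,'t,'y) gray_scheme \<Rightarrow> ('p,'n,'u,'z) gray_scheme \<Rightarrow> ('o,'m,'t,'p,'n,'u) threefun \<Rightarrow> bool" where
  "assoc_unitors C D A \<longleftrightarrow>
     om A \<in> extensional (Obj C \<times> Obj C \<times> Obj C) \<and> el A \<in> extensional (Obj C) \<and> ar A \<in> extensional (Obj C)
   \<and> (\<forall>a \<in> Obj C. \<forall>b \<in> Obj C. \<forall>c \<in> Obj C.
        icell D (om A (a, b, c)) (mu1 A (a \<odot>\<^bsub>C\<^esub> b) c \<cdot> (mu1 A a b \<rtimes> fo A c))
                                 (mu1 A a (b \<odot>\<^bsub>C\<^esub> c) \<cdot> (fo A a \<ltimes> mu1 A b c)))
   \<and> (\<forall>a \<in> Obj C. icell D (el A a) (mu1 A (Unt C) a \<cdot> (io1 A \<rtimes> fo A a)) (Id1 D (fo A a)))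
   \<and> (\<forall>a \<in> Obj C. icell D (ar A a) (mu1 A a (Unt C) \<cdot> (fo A a \<ltimes> io1 A)) (Id1 D (fo A a)))
   \<and> (\<forall>x a a' y b b' z c c'. arr C x a a' \<longrightarrow> arr C y b b' \<longrightarrow> arr C z c c' \<longrightarrow>
        (\<guillemotleft>fm A (x \<boxtimes>\<^bsub>C\<^esub> y \<boxtimes>\<^bsub>C\<^esub> z)\<guillemotright> \<star> om A (a, b, c))
          \<bullet> (mm A (x \<boxtimes>\<^bsub>C\<^esub> y, z) \<star> \<guillemotleft>mu1 A a b \<rtimes> fo A c\<guillemotright>)
          \<bullet> (\<guillemotleft>mu1 A (a' \<odot>\<^bsub>C\<^esub> b') c' \<cdot> (fm A (x \<boxtimes>\<^bsub>C\<^esub> y) \<rtimes> fo A c')\<guillemotright> \<star> Ich D (mu1 A a b) (fm A z))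
          \<bullet> (\<guillemotleft>mu1 A (a' \<odot>\<^bsub>C\<^esub> b') c'\<guillemotright> \<star> (mm A (x, y) \<rtimes>\<^sub>2 fo A c') \<star> \<guillemotleft>(fo A a \<odot> fo A b) \<ltimes> fm A z\<guillemotright>)
        = (mm A (x, y \<boxtimes>\<^bsub>C\<^esub> z) \<star> \<guillemotleft>fo A a \<ltimes> mu1 A b c\<guillemotright>)
          \<bullet> (\<guillemotleft>mu1 A a' (b' \<odot>\<^bsub>C\<^esub> c') \<cdot> (fm A x \<rtimes> fo A (b' \<odot>\<^bsub>C\<^esub> c'))\<guillemotright> \<star> (fo A a \<ltimes>\<^sub>2 mm A (y, z)))
          \<bullet> (\<guillemotleft>mu1 A a' (b' \<odot>\<^bsub>C\<^esub> c')\<guillemotright> \<star> inv2 D (Ich D (fm A x) (mu1 A b' c'))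
               \<star> \<guillemotleft>fo A a \<ltimes> (fm A y \<boxtimes> fm A z)\<guillemotright>)
          \<bullet> (om A (a', b', c') \<star> \<guillemotleft>fm A x \<boxtimes> fm A y \<boxtimes> fm A z\<guillemotright>))
   \<and> (\<forall>x a b. arr C x a b \<longrightarrow>
        (\<guillemotleft>fm A x\<guillemotright> \<star> el A a)
          \<bullet> (mm A (Id1 C (Unt C), x) \<star> \<guillemotleft>io1 A \<rtimes> fo A a\<guillemotright>)
          \<bullet> (\<guillemotleft>mu1 A (Unt C) b \<cdot> (fm A (Id1 C (Unt C)) \<rtimes> fo A b)\<guillemotright> \<star> Ich D (io1 A) (fm A x))
          \<bullet> (\<guillemotleft>mu1 A (Unt C) b\<guillemotright> \<star> (im A \<rtimes>\<^sub>2 fo A b) \<star> \<guillemotleft>fm A x\<guillemotright>)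
        = el A b \<star> \<guillemotleft>fm A x\<guillemotright>)
   \<and> (\<forall>x a b. arr C x a b \<longrightarrow>
        (\<guillemotleft>fm A x\<guillemotright> \<star> ar A a)
          \<bullet> (mm A (x, Id1 C (Unt C)) \<star> \<guillemotleft>fo A a \<ltimes> io1 A\<guillemotright>)
          \<bullet> (\<guillemotleft>mu1 A b (Unt C) \<cdot> (fm A x \<rtimes> fo A (Unt C))\<guillemotright> \<star> (fo A a \<ltimes>\<^sub>2 im A))
          \<bullet> (\<guillemotleft>mu1 A b (Unt C)\<guillemotright> \<star> inv2 D (Ich D (fm A x) (io1 A)))
        = ar A b \<star> \<guillemotleft>fm A x\<guillemotright>)"
  for D (structure)

text \<open>The two trihomomorphism axioms, for associativity and for units.\<close>

definition threefun_axioms ::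
    "('o,'m,'t,'y) gray_scheme \<Rightarrow> ('p,'n,'u,'z) gray_scheme \<Rightarrow> ('o,'m,'t,'p,'n,'u) threefun \<Rightarrow> bool" where
  "threefun_axioms C D A \<longleftrightarrow>
     (\<forall>a \<in> Obj C. \<forall>b \<in> Obj C. \<forall>c \<in> Obj C. \<forall>d \<in> Obj C.
        (\<guillemotleft>mu1 A a (b \<odot>\<^bsub>C\<^esub> c \<odot>\<^bsub>C\<^esub> d)\<guillemotright> \<star> (fo A a \<ltimes>\<^sub>2 om A (b, c, d)))
          \<bullet> (om A (a, b \<odot>\<^bsub>C\<^esub> c, d) \<star> \<guillemotleft>(fo A a \<ltimes> mu1 A b c) \<rtimes> fo A d\<guillemotright>)
          \<bullet> (\<guillemotleft>mu1 A (a \<odot>\<^bsub>C\<^esub> b \<odot>\<^bsub>C\<^esub> c) d\<guillemotright> \<star> (om A (a, b, c) \<rtimes>\<^sub>2 fo A d))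
        = (om A (a, b, c \<odot>\<^bsub>C\<^esub> d) \<star> \<guillemotleft>(fo A a \<odot> fo A b) \<ltimes> mu1 A c d\<guillemotright>)
          \<bullet> (\<guillemotleft>mu1 A (a \<odot>\<^bsub>C\<^esub> b) (c \<odot>\<^bsub>C\<^esub> d)\<guillemotright> \<star> inv2 D (Ich D (mu1 A a b) (mu1 A c d)))
          \<bullet> (om A (a \<odot>\<^bsub>C\<^esub> b, c, d) \<star> \<guillemotleft>mu1 A a b \<rtimes> (fo A c \<odot> fo A d)\<guillemotright>))
   \<and> (\<forall>a \<in> Obj C. \<forall>b \<in> Obj C.
        (\<guillemotleft>mu1 A a b\<guillemotright> \<star> (fo A a \<ltimes>\<^sub>2 el A b)) \<bullet> (om A (a, Unt C, b) \<star> \<guillemotleft>(fo A a \<ltimes> io1 A) \<rtimes> fo A b\<guillemotright>)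
        = \<guillemotleft>mu1 A a b\<guillemotright> \<star> (ar A a \<rtimes>\<^sub>2 fo A b))"
  for D (structure)

definition three_functor ::
    "('o,'m,'t,'y) gray_scheme \<Rightarrow> ('p,'n,'u,'z) gray_scheme \<Rightarrow> ('o,'m,'t,'p,'n,'u) threefun \<Rightarrow> bool" where
  "three_functor C D A \<longleftrightarrow>
     pseudofunctor C D A \<and> mult_iota C D A \<and> assoc_unitors C D A \<and> threefun_axioms C D A"

definition strict3 ::
    "('o,'m,'t,'y) gray_scheme \<Rightarrow> ('p,'n,'u,'z) gray_scheme \<Rightarrow> ('o,'m,'t,'p,'n,'u) grayfun
      \<Rightarrow> ('o,'m,'t,'p,'n,'u) threefun" where
  "strict3 C D P = \<lparr>
     fo = p0 P, fm = p1 P, fc = p2 P,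
     fu = (\<lambda>a \<in> Obj C. \<guillemotleft>Id1 D (p0 P a)\<guillemotright>),
     fp = (\<lambda>(y, x) \<in> cpairs C. \<guillemotleft>p1 P y \<cdot> p1 P x\<guillemotright>),
     mu = (\<lambda>(a, b) \<in> Obj C \<times> Obj C. idadj D (p0 P a \<odot> p0 P b)),
     mm = (\<lambda>(x, y) \<in> Arr C \<times> Arr C. \<guillemotleft>p1 P x \<boxtimes> p1 P y\<guillemotright>),
     io = idadj D (Unt D),
     im = \<guillemotleft>Id1 D (Unt D)\<guillemotright>,
     om = (\<lambda>(a, b, c) \<in> Obj C \<times> Obj C \<times> Obj C. \<guillemotleft>Id1 D (p0 P a \<odot> p0 P b \<odot> p0 P c)\<guillemotright>),
     el = (\<lambda>a \<in> Obj C. \<guillemotleft>Id1 D (p0 P a)\<guillemotright>),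
     ar = (\<lambda>a \<in> Obj C. \<guillemotleft>Id1 D (p0 P a)\<guillemotright>) \<rparr>"
  for D (structure)

definition idfun3 :: "('o,'m,'t,'y) gray_scheme \<Rightarrow> ('o,'m,'t,'o,'m,'t) threefun" where
  "idfun3 C = strict3 C C \<lparr> p0 = (\<lambda>a \<in> Obj C. a), p1 = (\<lambda>x \<in> Arr C. x), p2 = (\<lambda>f \<in> Cel C. f) \<rparr>"

text \<open>Composition \<open>B \<circ> A\<close>, in the case where the 1-cells \<open>\<mu>\<close> and \<open>\<iota>\<close> of \<open>A\<close> are identities (there is
  no condition on \<open>B\<close>).  The pasting formulas for the composite contain the 1-cells \<open>B(id)\<close>, for
  instance \<open>\<mu>\<close> of \<open>B \<circ> A\<close> at \<open>(a, b)\<close> would be \<open>B(id) \<cdot> \<mu>\<^sup>B\<close>, and \<open>B(id)\<close> differs from the identity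
  unless \<open>B\<close> is strictly unital.  So \<open>B(id)\<close> is cancelled along the unit constraint \<open>B\<^sup>1 : id \<Rightarrow> B(id)\<close>;
  for a 2-cell \<open>f : id\<^sub>c \<Rightarrow> id\<^sub>c\<close> this replaces \<open>B(f)\<close> by the 2-cell \<open>unloop B c f : id \<Rightarrow> id\<close>.\<close>

definition unloop ::
    "('q,'k,'v,'z) gray_scheme \<Rightarrow> ('p,'n,'u,'q,'k,'v) threefun \<Rightarrow> 'p \<Rightarrow> 'u \<Rightarrow> 'v" where
  "unloop E B c f = inv2 E (fu B c) \<bullet> fc B f \<bullet> fu B c"
  for E (structure)

definition cmp3 ::
    "('o,'m,'t,'x) gray_scheme \<Rightarrow> ('p,'n,'u,'y) gray_scheme \<Rightarrow> ('q,'k,'v,'z) gray_scheme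
      \<Rightarrow> ('p,'n,'u,'q,'k,'v) threefun \<Rightarrow> ('o,'m,'t,'p,'n,'u) threefun \<Rightarrow> ('o,'m,'t,'q,'k,'v) threefun" where
  "cmp3 C D E B A = \<lparr>
     fo = (\<lambda>a \<in> Obj C. fo B (fo A a)),
     fm = (\<lambda>x \<in> Arr C. fm B (fm A x)),
     fc = (\<lambda>f \<in> Cel C. fc B (fc A f)),
     fu = (\<lambda>a \<in> Obj C. fc B (fu A a) \<bullet> fu B (fo A a)),
     fp = (\<lambda>(y, x) \<in> cpairs C. fc B (fp A (y, x)) \<bullet> fp B (fm A y, fm A x)),
     mu = (\<lambda>(a, b) \<in> Obj C \<times> Obj C. mu B (fo A a, fo A b)),
     mm = (\<lambda>(x, y) \<in> Arr C \<times> Arr C.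
             (fc B (mm A (x, y)) \<star> \<guillemotleft>mu1 B (fo A (Dom C x)) (fo A (Dom C y))\<guillemotright>) \<bullet> mm B (fm A x, fm A y)),
     io = io B,
     im = (fc B (im A) \<star> \<guillemotleft>io1 B\<guillemotright>) \<bullet> im B,
     om = (\<lambda>(a, b, c) \<in> Obj C \<times> Obj C \<times> Obj C.
             unloop E B (fo A (a \<odot>\<^bsub>C\<^esub> b \<odot>\<^bsub>C\<^esub> c)) (om A (a, b, c)) \<star> om B (fo A a, fo A b, fo A c)),
     el = (\<lambda>a \<in> Obj C. unloop E B (fo A a) (el A a) \<star> el B (fo A a)),
     ar = (\<lambda>a \<in> Obj C. unloop E B (fo A a) (ar A a) \<star> ar B (fo A a)) \<rparr>"
  for E (structure)


section \<open>Transformations\<close>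

record ('o,'m,'p,'n,'u) trans =
  ts :: "'p"
  tc :: "'o \<Rightarrow> ('n,'u) adjeq"
  tm :: "'m \<Rightarrow> 'u"
  t1 :: "'u"
  t2 :: "'o \<times> 'o \<Rightarrow> 'u"

text \<open>The components are \<open>\<eta>\<^sub>*\<close>, \<open>\<eta>\<^sub>c\<close>, \<open>\<eta>\<^sub>x\<close>, \<open>\<eta>\<^sup>1\<close> and \<open>\<eta>\<^sup>2\<close>.\<close>

abbreviation tc1 :: "('o,'m,'p,'n,'u) trans \<Rightarrow> 'o \<Rightarrow> 'n" where
  "tc1 H a \<equiv> lf (tc H a)"

definition trans_data ::
    "('o,'m,'t,'y) gray_scheme \<Rightarrow> ('p,'n,'u,'z) gray_scheme \<Rightarrow> ('o,'m,'t,'p,'n,'u) threefun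
      \<Rightarrow> ('o,'m,'t,'p,'n,'u) threefun \<Rightarrow> ('o,'m,'p,'n,'u) trans \<Rightarrow> bool" where
  "trans_data C D A B H \<longleftrightarrow>
     tc H \<in> extensional (Obj C) \<and> tm H \<in> extensional (Arr C) \<and> t2 H \<in> extensional (Obj C \<times> Obj C)
   \<and> ts H \<in> Obj D
   \<and> (\<forall>a \<in> Obj C. adj_equiv D (tc H a) (ts H \<odot> fo A a) (fo B a \<odot> ts H))
   \<and> (\<forall>x a b. arr C x a b \<longrightarrow>
        icell D (tm H x) (tc1 H b \<cdot> (ts H \<ltimes> fm A x)) ((fm B x \<rtimes> ts H) \<cdot> tc1 H a))
   \<and> icell D (t1 H) (tc1 H (Unt C) \<cdot> (ts H \<ltimes> io1 A)) (io1 B \<rtimes> ts H)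
   \<and> (\<forall>a \<in> Obj C. \<forall>b \<in> Obj C.
        icell D (t2 H (a, b)) (tc1 H (a \<odot>\<^bsub>C\<^esub> b) \<cdot> (ts H \<ltimes> mu1 A a b))
          ((mu1 B a b \<rtimes> ts H) \<cdot> (fo B a \<ltimes> tc1 H b) \<cdot> (tc1 H a \<rtimes> fo A b)))"
  for D (structure)

text \<open>Pseudonaturality (2-cells, composition, units), then the modification axioms for \<open>\<eta>\<^sup>1\<close> and \<open>\<eta>\<^sup>2\<close>.\<close>

definition trans_natural ::
    "('o,'m,'t,'y) gray_scheme \<Rightarrow> ('p,'n,'u,'z) gray_scheme \<Rightarrow> ('o,'m,'t,'p,'n,'u) threefun
      \<Rightarrow> ('o,'m,'t,'p,'n,'u) threefun \<Rightarrow> ('o,'m,'p,'n,'u) trans \<Rightarrow> bool" where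
  "trans_natural C D A B H \<longleftrightarrow>
     (\<forall>f x x' a b. cell C f x x' \<longrightarrow> arr C x a b \<longrightarrow>
        ((fc B f \<rtimes>\<^sub>2 ts H) \<star> \<guillemotleft>tc1 H a\<guillemotright>) \<bullet> tm H x = tm H x' \<bullet> (\<guillemotleft>tc1 H b\<guillemotright> \<star> (ts H \<ltimes>\<^sub>2 fc A f)))
   \<and> (\<forall>x a b y c. arr C x a b \<longrightarrow> arr C y b c \<longrightarrow>
        tm H (y \<cdot>\<^bsub>C\<^esub> x) \<bullet> (\<guillemotleft>tc1 H c\<guillemotright> \<star> (ts H \<ltimes>\<^sub>2 fp A (y, x)))
        = ((fp B (y, x) \<rtimes>\<^sub>2 ts H) \<star> \<guillemotleft>tc1 H a\<guillemotright>)
          \<bullet> (\<guillemotleft>fm B y \<rtimes> ts H\<guillemotright> \<star> tm H x)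
          \<bullet> (tm H y \<star> \<guillemotleft>ts H \<ltimes> fm A x\<guillemotright>))
   \<and> (\<forall>a \<in> Obj C. tm H (Id1 C a) \<bullet> (\<guillemotleft>tc1 H a\<guillemotright> \<star> (ts H \<ltimes>\<^sub>2 fu A a)) = (fu B a \<rtimes>\<^sub>2 ts H) \<star> \<guillemotleft>tc1 H a\<guillemotright>)
   \<and> (\<guillemotleft>fm B (Id1 C (Unt C)) \<rtimes> ts H\<guillemotright> \<star> t1 H)
        \<bullet> (tm H (Id1 C (Unt C)) \<star> \<guillemotleft>ts H \<ltimes> io1 A\<guillemotright>)
        \<bullet> (\<guillemotleft>tc1 H (Unt C)\<guillemotright> \<star> (ts H \<ltimes>\<^sub>2 im A))
      = (im B \<rtimes>\<^sub>2 ts H) \<bullet> t1 H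
   \<and> (\<forall>x a a' y b b'. arr C x a a' \<longrightarrow> arr C y b b' \<longrightarrow>
        (\<guillemotleft>fm B (x \<boxtimes>\<^bsub>C\<^esub> y) \<rtimes> ts H\<guillemotright> \<star> t2 H (a, b))
          \<bullet> (tm H (x \<boxtimes>\<^bsub>C\<^esub> y) \<star> \<guillemotleft>ts H \<ltimes> mu1 A a b\<guillemotright>)
          \<bullet> (\<guillemotleft>tc1 H (a' \<odot>\<^bsub>C\<^esub> b')\<guillemotright> \<star> (ts H \<ltimes>\<^sub>2 mm A (x, y)))
        = ((mm B (x, y) \<rtimes>\<^sub>2 ts H) \<star> \<guillemotleft>(fo B a \<ltimes> tc1 H b) \<cdot> (tc1 H a \<rtimes> fo A b)\<guillemotright>)
          \<bullet> (\<guillemotleft>(mu1 B a' b' \<rtimes> ts H) \<cdot> (fm B x \<rtimes> (fo B b' \<odot> ts H))\<guillemotright>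
               \<star> (fo B a \<ltimes>\<^sub>2 tm H y) \<star> \<guillemotleft>tc1 H a \<rtimes> fo A b\<guillemotright>)
          \<bullet> (\<guillemotleft>mu1 B a' b' \<rtimes> ts H\<guillemotright> \<star> inv2 D (Ich D (fm B x) (tc1 H b')) \<star> Ich D (tc1 H a) (fm A y))
          \<bullet> (\<guillemotleft>(mu1 B a' b' \<rtimes> ts H) \<cdot> (fo B a' \<ltimes> tc1 H b')\<guillemotright>
               \<star> (tm H x \<rtimes>\<^sub>2 fo A b') \<star> \<guillemotleft>(ts H \<odot> fo A a) \<ltimes> fm A y\<guillemotright>)
          \<bullet> (t2 H (a', b') \<star> \<guillemotleft>ts H \<ltimes> (fm A x \<boxtimes> fm A y)\<guillemotright>))"
  for D (structure)

text \<open>The tritransformation axioms, for associativity and for the left and right unit.\<close>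

definition trans_axioms ::
    "('o,'m,'t,'y) gray_scheme \<Rightarrow> ('p,'n,'u,'z) gray_scheme \<Rightarrow> ('o,'m,'t,'p,'n,'u) threefun
      \<Rightarrow> ('o,'m,'t,'p,'n,'u) threefun \<Rightarrow> ('o,'m,'p,'n,'u) trans \<Rightarrow> bool" where
  "trans_axioms C D A B H \<longleftrightarrow>
     (\<forall>a \<in> Obj C. \<forall>b \<in> Obj C. \<forall>c \<in> Obj C.
        ((om B (a, b, c) \<rtimes>\<^sub>2 ts H)
            \<star> \<guillemotleft>((fo B a \<odot> fo B b) \<ltimes> tc1 H c) \<cdot> (fo B a \<ltimes> tc1 H b \<rtimes> fo A c) \<cdot> (tc1 H a \<rtimes> (fo A b \<odot> fo A c))\<guillemotright>)
          \<bullet> (\<guillemotleft>mu1 B (a \<odot>\<^bsub>C\<^esub> b) c \<rtimes> ts H\<guillemotright> \<star> inv2 D (Ich D (mu1 B a b) (tc1 H c))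
               \<star> \<guillemotleft>(fo B a \<ltimes> tc1 H b \<rtimes> fo A c) \<cdot> (tc1 H a \<rtimes> (fo A b \<odot> fo A c))\<guillemotright>)
          \<bullet> (\<guillemotleft>(mu1 B (a \<odot>\<^bsub>C\<^esub> b) c \<rtimes> ts H) \<cdot> (fo B (a \<odot>\<^bsub>C\<^esub> b) \<ltimes> tc1 H c)\<guillemotright> \<star> (t2 H (a, b) \<rtimes>\<^sub>2 fo A c))
          \<bullet> (t2 H (a \<odot>\<^bsub>C\<^esub> b, c) \<star> \<guillemotleft>ts H \<ltimes> mu1 A a b \<rtimes> fo A c\<guillemotright>)
        = (\<guillemotleft>mu1 B a (b \<odot>\<^bsub>C\<^esub> c) \<rtimes> ts H\<guillemotright> \<star> (fo B a \<ltimes>\<^sub>2 t2 H (b, c)) \<star> \<guillemotleft>tc1 H a \<rtimes> (fo A b \<odot> fo A c)\<guillemotright>)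
          \<bullet> (\<guillemotleft>(mu1 B a (b \<odot>\<^bsub>C\<^esub> c) \<rtimes> ts H) \<cdot> (fo B a \<ltimes> tc1 H (b \<odot>\<^bsub>C\<^esub> c))\<guillemotright>
               \<star> Ich D (tc1 H a) (mu1 A b c))
          \<bullet> (t2 H (a, b \<odot>\<^bsub>C\<^esub> c) \<star> \<guillemotleft>(ts H \<odot> fo A a) \<ltimes> mu1 A b c\<guillemotright>)
          \<bullet> (\<guillemotleft>tc1 H (a \<odot>\<^bsub>C\<^esub> b \<odot>\<^bsub>C\<^esub> c)\<guillemotright> \<star> (ts H \<ltimes>\<^sub>2 om A (a, b, c))))
   \<and> (\<forall>a \<in> Obj C.
        ((el B a \<rtimes>\<^sub>2 ts H) \<star> \<guillemotleft>tc1 H a\<guillemotright>)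
          \<bullet> (\<guillemotleft>mu1 B (Unt C) a \<rtimes> ts H\<guillemotright> \<star> inv2 D (Ich D (io1 B) (tc1 H a)))
          \<bullet> (\<guillemotleft>(mu1 B (Unt C) a \<rtimes> ts H) \<cdot> (fo B (Unt C) \<ltimes> tc1 H a)\<guillemotright> \<star> (t1 H \<rtimes>\<^sub>2 fo A a))
          \<bullet> (t2 H (Unt C, a) \<star> \<guillemotleft>ts H \<ltimes> io1 A \<rtimes> fo A a\<guillemotright>)
        = \<guillemotleft>tc1 H a\<guillemotright> \<star> (ts H \<ltimes>\<^sub>2 el A a))
   \<and> (\<forall>a \<in> Obj C.
        ((ar B a \<rtimes>\<^sub>2 ts H) \<star> \<guillemotleft>tc1 H a\<guillemotright>)
          \<bullet> (\<guillemotleft>mu1 B a (Unt C) \<rtimes> ts H\<guillemotright> \<star> (fo B a \<ltimes>\<^sub>2 t1 H) \<star> \<guillemotleft>tc1 H a\<guillemotright>)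
          \<bullet> (\<guillemotleft>(mu1 B a (Unt C) \<rtimes> ts H) \<cdot> (fo B a \<ltimes> tc1 H (Unt C))\<guillemotright> \<star> Ich D (tc1 H a) (io1 A))
          \<bullet> (t2 H (a, Unt C) \<star> \<guillemotleft>(ts H \<odot> fo A a) \<ltimes> io1 A\<guillemotright>)
        = \<guillemotleft>tc1 H a\<guillemotright> \<star> (ts H \<ltimes>\<^sub>2 ar A a))"
  for D (structure)

definition transformation ::
    "('o,'m,'t,'y) gray_scheme \<Rightarrow> ('p,'n,'u,'z) gray_scheme \<Rightarrow> ('o,'m,'t,'p,'n,'u) threefun
      \<Rightarrow> ('o,'m,'t,'p,'n,'u) threefun \<Rightarrow> ('o,'m,'p,'n,'u) trans \<Rightarrow> bool" where
  "transformation C D A B H \<longleftrightarrow> trans_data C D A B H \<and> trans_natural C D A B H \<and> trans_axioms C D A B H"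

definition idtrans ::
    "('o,'m,'t,'y) gray_scheme \<Rightarrow> ('p,'n,'u,'z) gray_scheme \<Rightarrow> ('o,'m,'t,'p,'n,'u) threefun
      \<Rightarrow> ('o,'m,'p,'n,'u) trans" where
  "idtrans C D A = \<lparr>
     ts = Unt D,
     tc = (\<lambda>a \<in> Obj C. idadj D (fo A a)),
     tm = (\<lambda>x \<in> Arr C. \<guillemotleft>fm A x\<guillemotright>),
     t1 = \<guillemotleft>io1 A\<guillemotright>,
     t2 = (\<lambda>(a, b) \<in> Obj C \<times> Obj C. \<guillemotleft>mu1 A a b\<guillemotright>) \<rparr>"
  for D (structure)

text \<open>Composite of \<open>H : A \<Rightarrow> B\<close> and \<open>K : B \<Rightarrow> L\<close>.  The 3-functors enter only through \<open>A\<close>, \<open>B\<close>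
  and \<open>L\<close> on 0-cells and the 1-cells \<open>\<mu>\<close> of \<open>L\<close>.\<close>

definition cmptrans ::
    "('o,'m,'t,'y) gray_scheme \<Rightarrow> ('p,'n,'u,'z) gray_scheme \<Rightarrow> ('o,'m,'t,'p,'n,'u) threefun
      \<Rightarrow> ('o,'m,'t,'p,'n,'u) threefun \<Rightarrow> ('o,'m,'t,'p,'n,'u) threefun
      \<Rightarrow> ('o,'m,'p,'n,'u) trans \<Rightarrow> ('o,'m,'p,'n,'u) trans \<Rightarrow> ('o,'m,'p,'n,'u) trans" where
  "cmptrans C D A B L K H = \<lparr>
     ts = ts K \<odot> ts H,
     tc = (\<lambda>a \<in> Obj C. cmpadj D (rwadj D (tc K a) (ts H)) (lwadj D (ts K) (tc H a))),
     tm = (\<lambda>x \<in> Arr C. ((tm K x \<rtimes>\<^sub>2 ts H) \<star> \<guillemotleft>ts K \<ltimes> tc1 H (Dom C x)\<guillemotright>)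
                      \<bullet> (\<guillemotleft>tc1 K (Cod C x) \<rtimes> ts H\<guillemotright> \<star> (ts K \<ltimes>\<^sub>2 tm H x))),
     t1 = (t1 K \<rtimes>\<^sub>2 ts H) \<bullet> (\<guillemotleft>tc1 K (Unt C) \<rtimes> ts H\<guillemotright> \<star> (ts K \<ltimes>\<^sub>2 t1 H)),
     t2 = (\<lambda>(a, b) \<in> Obj C \<times> Obj C.
             (\<guillemotleft>(mu1 L a b \<rtimes> (ts K \<odot> ts H)) \<cdot> (fo L a \<ltimes> tc1 K b \<rtimes> ts H)\<guillemotright>
                \<star> Ich D (tc1 K a) (tc1 H b) \<star> \<guillemotleft>ts K \<ltimes> tc1 H a \<rtimes> fo A b\<guillemotright>)
           \<bullet> ((t2 K (a, b) \<rtimes>\<^sub>2 ts H)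
                \<star> \<guillemotleft>((ts K \<odot> fo B a) \<ltimes> tc1 H b) \<cdot> (ts K \<ltimes> tc1 H a \<rtimes> fo A b)\<guillemotright>)
           \<bullet> (\<guillemotleft>tc1 K (a \<odot>\<^bsub>C\<^esub> b) \<rtimes> ts H\<guillemotright> \<star> (ts K \<ltimes>\<^sub>2 t2 H (a, b)))) \<rparr>"
  for D (structure)

text \<open>The whiskered transformation \<open>K \<circ> A\<close>, with the same proviso on \<open>A\<close> as for \<^const>\<open>cmp3\<close>.\<close>

definition prewhisk ::
    "('o,'m,'t,'x) gray_scheme \<Rightarrow> ('p,'n,'q,'k,'v) trans \<Rightarrow> ('o,'m,'t,'p,'n,'u) threefun
      \<Rightarrow> ('o,'m,'q,'k,'v) trans" where
  "prewhisk C K A = \<lparr>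
     ts = ts K,
     tc = (\<lambda>a \<in> Obj C. tc K (fo A a)),
     tm = (\<lambda>x \<in> Arr C. tm K (fm A x)),
     t1 = t1 K,
     t2 = (\<lambda>(a, b) \<in> Obj C \<times> Obj C. t2 K (fo A a, fo A b)) \<rparr>"

text \<open>The whiskered transformation \<open>L \<circ> H\<close> for \<open>H : A \<Rightarrow> B\<close>, in the case where the 1-cells \<open>\<mu>\<close> and
  \<open>\<iota>\<close> of \<open>A\<close>, \<open>B\<close> and \<open>L\<close> and the components \<open>H\<^sub>c\<close> are identities and \<open>H\<^sub>*\<close> is the unit.  As in
  \<^const>\<open>cmp3\<close>, each occurrence of \<open>L(id)\<close> is cancelled along \<open>L\<^sup>1\<close>.\<close>

definition postwhisk ::
    "('o,'m,'t,'x) gray_scheme \<Rightarrow> ('p,'n,'u,'y) gray_scheme \<Rightarrow> ('q,'k,'v,'z) gray_scheme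
      \<Rightarrow> ('p,'n,'u,'q,'k,'v) threefun \<Rightarrow> ('o,'m,'t,'p,'n,'u) threefun
      \<Rightarrow> ('o,'m,'p,'n,'u) trans \<Rightarrow> ('o,'m,'q,'k,'v) trans" where
  "postwhisk C D E L A H = \<lparr>
     ts = Unt E,
     tc = (\<lambda>a \<in> Obj C. idadj E (fo L (fo A a))),
     tm = (\<lambda>x \<in> Arr C. fc L (tm H x)),
     t1 = unloop E L (Unt D) (t1 H) \<star> \<guillemotleft>io1 L\<guillemotright>,
     t2 = (\<lambda>(a, b) \<in> Obj C \<times> Obj C.
             unloop E L (fo A (a \<odot>\<^bsub>C\<^esub> b)) (t2 H (a, b)) \<star> \<guillemotleft>mu1 L (fo A a) (fo A b)\<guillemotright>) \<rparr>"
  for E (structure)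


section \<open>Modifications and perturbations\<close>

record ('o,'n,'u) modif =
  ms :: "'n"
  mc :: "'o \<Rightarrow> 'u"

text \<open>The equations are, in this order, compatibility with 1-cells, with units and with \<open>\<otimes>\<close>.\<close>

definition modification ::
    "('o,'m,'t,'y) gray_scheme \<Rightarrow> ('p,'n,'u,'z) gray_scheme \<Rightarrow> ('o,'m,'t,'p,'n,'u) threefun
      \<Rightarrow> ('o,'m,'t,'p,'n,'u) threefun \<Rightarrow> ('o,'m,'p,'n,'u) trans \<Rightarrow> ('o,'m,'p,'n,'u) trans
      \<Rightarrow> ('o,'n,'u) modif \<Rightarrow> bool" where
  "modification C D A B H K m \<longleftrightarrow>
     mc m \<in> extensional (Obj C)
   \<and> arr D (ms m) (ts H) (ts K)
   \<and> (\<forall>a \<in> Obj C. icell D (mc m a) (tc1 K a \<cdot> (ms m \<rtimes> fo A a)) ((fo B a \<ltimes> ms m) \<cdot> tc1 H a))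
   \<and> (\<forall>x a b. arr C x a b \<longrightarrow>
        (\<guillemotleft>fm B x \<rtimes> ts K\<guillemotright> \<star> mc m a)
          \<bullet> (tm K x \<star> \<guillemotleft>ms m \<rtimes> fo A a\<guillemotright>)
          \<bullet> (\<guillemotleft>tc1 K b\<guillemotright> \<star> Ich D (ms m) (fm A x))
        = (inv2 D (Ich D (fm B x) (ms m)) \<star> \<guillemotleft>tc1 H a\<guillemotright>)
          \<bullet> (\<guillemotleft>fo B b \<ltimes> ms m\<guillemotright> \<star> tm H x)
          \<bullet> (mc m b \<star> \<guillemotleft>ts H \<ltimes> fm A x\<guillemotright>))
   \<and> (t1 K \<star> \<guillemotleft>ms m\<guillemotright>) \<bullet> (\<guillemotleft>tc1 K (Unt C)\<guillemotright> \<star> Ich D (ms m) (io1 A))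
      = inv2 D (Ich D (io1 B) (ms m))
          \<bullet> (\<guillemotleft>fo B (Unt C) \<ltimes> ms m\<guillemotright> \<star> t1 H)
          \<bullet> (mc m (Unt C) \<star> \<guillemotleft>ts H \<ltimes> io1 A\<guillemotright>)
   \<and> (\<forall>a \<in> Obj C. \<forall>b \<in> Obj C.
        (\<guillemotleft>(mu1 B a b \<rtimes> ts K)\<guillemotright> \<star> (fo B a \<ltimes>\<^sub>2 mc m b) \<star> \<guillemotleft>tc1 H a \<rtimes> fo A b\<guillemotright>)
          \<bullet> (\<guillemotleft>(mu1 B a b \<rtimes> ts K) \<cdot> (fo B a \<ltimes> tc1 K b)\<guillemotright> \<star> (mc m a \<rtimes>\<^sub>2 fo A b))
          \<bullet> (t2 K (a, b) \<star> \<guillemotleft>ms m \<rtimes> (fo A a \<odot> fo A b)\<guillemotright>)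
          \<bullet> (\<guillemotleft>tc1 K (a \<odot>\<^bsub>C\<^esub> b)\<guillemotright> \<star> Ich D (ms m) (mu1 A a b))
        = (inv2 D (Ich D (mu1 B a b) (ms m)) \<star> \<guillemotleft>(fo B a \<ltimes> tc1 H b) \<cdot> (tc1 H a \<rtimes> fo A b)\<guillemotright>)
          \<bullet> (\<guillemotleft>fo B (a \<odot>\<^bsub>C\<^esub> b) \<ltimes> ms m\<guillemotright> \<star> t2 H (a, b))
          \<bullet> (mc m (a \<odot>\<^bsub>C\<^esub> b) \<star> \<guillemotleft>ts H \<ltimes> mu1 A a b\<guillemotright>))"
  for D (structure)

definition idmod ::
    "('o,'m,'t,'y) gray_scheme \<Rightarrow> ('p,'n,'u,'z) gray_scheme \<Rightarrow> ('o,'m,'p,'n,'u) trans \<Rightarrow> ('o,'n,'u) modif" where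
  "idmod C D H = \<lparr> ms = Id1 D (ts H), mc = (\<lambda>a \<in> Obj C. \<guillemotleft>tc1 H a\<guillemotright>) \<rparr>"
  for D (structure)

definition cmpmod ::
    "('o,'m,'t,'y) gray_scheme \<Rightarrow> ('p,'n,'u,'z) gray_scheme \<Rightarrow> ('o,'m,'t,'p,'n,'u) threefun
      \<Rightarrow> ('o,'m,'t,'p,'n,'u) threefun \<Rightarrow> ('o,'n,'u) modif \<Rightarrow> ('o,'n,'u) modif \<Rightarrow> ('o,'n,'u) modif" where
  "cmpmod C D A B n m = \<lparr>
     ms = ms n \<cdot> ms m,
     mc = (\<lambda>a \<in> Obj C. (\<guillemotleft>fo B a \<ltimes> ms n\<guillemotright> \<star> mc m a) \<bullet> (mc n a \<star> \<guillemotleft>ms m \<rtimes> fo A a\<guillemotright>)) \<rparr>"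
  for D (structure)

text \<open>For \<open>H : A \<Rightarrow> B\<close> and a modification \<open>m\<close> from \<open>K\<close> to \<open>K'\<close>, both \<open>B \<Rightarrow> L\<close>: the modification
  \<open>m * H\<close> from \<open>K \<cdot> H\<close> to \<open>K' \<cdot> H\<close>.\<close>

definition modwhisk ::
    "('o,'m,'t,'y) gray_scheme \<Rightarrow> ('p,'n,'u,'z) gray_scheme \<Rightarrow> ('o,'m,'p,'n,'u) trans \<Rightarrow> ('o,'m,'p,'n,'u) trans
      \<Rightarrow> ('o,'n,'u) modif \<Rightarrow> ('o,'m,'p,'n,'u) trans \<Rightarrow> ('o,'n,'u) modif" where
  "modwhisk C D K K' m H = \<lparr>
     ms = ms m \<rtimes> ts H,
     mc = (\<lambda>a \<in> Obj C. ((mc m a \<rtimes>\<^sub>2 ts H) \<star> \<guillemotleft>ts K \<ltimes> tc1 H a\<guillemotright>)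
                      \<bullet> (\<guillemotleft>tc1 K' a \<rtimes> ts H\<guillemotright> \<star> inv2 D (Ich D (ms m) (tc1 H a)))) \<rparr>"
  for D (structure)

definition modpre ::
    "('o,'m,'t,'x) gray_scheme \<Rightarrow> ('p,'k,'v) modif \<Rightarrow> ('o,'m,'t,'p,'n,'u) threefun \<Rightarrow> ('o,'k,'v) modif" where
  "modpre C m A = \<lparr> ms = ms m, mc = (\<lambda>a \<in> Obj C. mc m (fo A a)) \<rparr>"

definition perturbation ::
    "('o,'m,'t,'y) gray_scheme \<Rightarrow> ('p,'n,'u,'z) gray_scheme \<Rightarrow> ('o,'m,'t,'p,'n,'u) threefun
      \<Rightarrow> ('o,'m,'t,'p,'n,'u) threefun \<Rightarrow> ('o,'m,'p,'n,'u) trans \<Rightarrow> ('o,'m,'p,'n,'u) trans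
      \<Rightarrow> ('o,'n,'u) modif \<Rightarrow> ('o,'n,'u) modif \<Rightarrow> 'u \<Rightarrow> bool" where
  "perturbation C D A B H K m n r \<longleftrightarrow> cell D r (ms m) (ms n)
   \<and> (\<forall>a \<in> Obj C. mc n a \<bullet> (\<guillemotleft>tc1 K a\<guillemotright> \<star> (r \<rtimes>\<^sub>2 fo A a)) = ((fo B a \<ltimes>\<^sub>2 r) \<star> \<guillemotleft>tc1 H a\<guillemotright>) \<bullet> mc m a)"
  for D (structure)

text \<open>Invertibility of modifications and transformations is up to invertible cells of the next dimension.\<close>

definition isomorphic_mod ::
    "('o,'m,'t,'y) gray_scheme \<Rightarrow> ('p,'n,'u,'z) gray_scheme \<Rightarrow> ('o,'m,'t,'p,'n,'u) threefun
      \<Rightarrow> ('o,'m,'t,'p,'n,'u) threefun \<Rightarrow> ('o,'m,'p,'n,'u) trans \<Rightarrow> ('o,'m,'p,'n,'u) trans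
      \<Rightarrow> ('o,'n,'u) modif \<Rightarrow> ('o,'n,'u) modif \<Rightarrow> bool" where
  "isomorphic_mod C D A B H K m n \<longleftrightarrow>
     (\<exists>r. perturbation C D A B H K m n r \<and> icell D r (ms m) (ms n))"

definition invertible_modification ::
    "('o,'m,'t,'y) gray_scheme \<Rightarrow> ('p,'n,'u,'z) gray_scheme \<Rightarrow> ('o,'m,'t,'p,'n,'u) threefun
      \<Rightarrow> ('o,'m,'t,'p,'n,'u) threefun \<Rightarrow> ('o,'m,'p,'n,'u) trans \<Rightarrow> ('o,'m,'p,'n,'u) trans
      \<Rightarrow> ('o,'n,'u) modif \<Rightarrow> bool" where
  "invertible_modification C D A B H K m \<longleftrightarrow> modification C D A B H K m
   \<and> (\<exists>n. modification C D A B K H n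
        \<and> isomorphic_mod C D A B H H (cmpmod C D A B n m) (idmod C D H)
        \<and> isomorphic_mod C D A B K K (cmpmod C D A B m n) (idmod C D K))"

definition invertible_transformation ::
    "('o,'m,'t,'y) gray_scheme \<Rightarrow> ('p,'n,'u,'z) gray_scheme \<Rightarrow> ('o,'m,'t,'p,'n,'u) threefun
      \<Rightarrow> ('o,'m,'t,'p,'n,'u) threefun \<Rightarrow> ('o,'m,'p,'n,'u) trans \<Rightarrow> bool" where
  "invertible_transformation C D A B H \<longleftrightarrow> transformation C D A B H
   \<and> (\<exists>K. transformation C D B A K
        \<and> (\<exists>m. invertible_modification C D A A (cmptrans C D A B A K H) (idtrans C D A) m)
        \<and> (\<exists>m. invertible_modification C D B B (cmptrans C D B A B H K) (idtrans C D B) m))"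


section \<open>Normalised 3-functors and transformations\<close>

text \<open>\<open>c\<close> and \<open>d\<close> label the 0-cells of \<open>C\<close> and \<open>D\<close> by \<open>G\<close>, that is \<open>c g = g\<^sub>C\<close>.  An adjoint
  equivalence ``is the identity'' if all of its data are: both 1-cells, the unit and the counit.\<close>

definition normal_functor ::
    "('g,'w) monoid_scheme \<Rightarrow> ('g \<Rightarrow> 'o) \<Rightarrow> ('g \<Rightarrow> 'p) \<Rightarrow> ('o,'m,'t,'y) gray_scheme
      \<Rightarrow> ('p,'n,'u,'z) gray_scheme \<Rightarrow> ('o,'m,'t,'p,'n,'u) threefun \<Rightarrow> bool" where
  "normal_functor G c d C D A \<longleftrightarrow> three_functor C D A
   \<and> (\<forall>g \<in> carrier G. fo A (c g) = d g)
   \<and> (\<forall>g \<in> carrier G. \<forall>h \<in> carrier G. mu A (c g, c h) = idadj D (d (g \<otimes>\<^bsub>G\<^esub> h)))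
   \<and> io A = idadj D (d \<one>\<^bsub>G\<^esub>)
   \<and> im A = fu A (c \<one>\<^bsub>G\<^esub>)
   \<and> (\<forall>g \<in> carrier G. \<forall>h \<in> carrier G. \<forall>k \<in> carrier G.
        om A (c g, c h, c k) = \<guillemotleft>Id1 D (d (g \<otimes>\<^bsub>G\<^esub> h \<otimes>\<^bsub>G\<^esub> k))\<guillemotright>\<^bsub>D\<^esub>)
   \<and> (\<forall>g \<in> carrier G. el A (c g) = \<guillemotleft>Id1 D (d g)\<guillemotright>\<^bsub>D\<^esub> \<and> ar A (c g) = \<guillemotleft>Id1 D (d g)\<guillemotright>\<^bsub>D\<^esub>)"

definition normal_trans ::
    "('g,'w) monoid_scheme \<Rightarrow> ('g \<Rightarrow> 'o) \<Rightarrow> ('g \<Rightarrow> 'p) \<Rightarrow> ('o,'m,'t,'y) gray_scheme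
      \<Rightarrow> ('p,'n,'u,'z) gray_scheme \<Rightarrow> ('o,'m,'t,'p,'n,'u) threefun \<Rightarrow> ('o,'m,'t,'p,'n,'u) threefun
      \<Rightarrow> ('o,'m,'p,'n,'u) trans \<Rightarrow> bool" where
  "normal_trans G c d C D A B H \<longleftrightarrow> transformation C D A B H
   \<and> ts H = d \<one>\<^bsub>G\<^esub>
   \<and> (\<forall>g \<in> carrier G. tc H (c g) = idadj D (d g))
   \<and> t1 H = \<guillemotleft>Id1 D (d \<one>\<^bsub>G\<^esub>)\<guillemotright>\<^bsub>D\<^esub>
   \<and> (\<forall>g \<in> carrier G. \<forall>h \<in> carrier G. t2 H (c g, c h) = \<guillemotleft>Id1 D (d (g \<otimes>\<^bsub>G\<^esub> h))\<guillemotright>\<^bsub>D\<^esub>)"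

text \<open>Horizontal composite of \<open>H : A \<Rightarrow> B\<close>, between 3-functors from \<open>C\<close> to \<open>D\<close>, and \<open>K : A' \<Rightarrow> B'\<close>,
  between 3-functors from \<open>D\<close> to \<open>E\<close>.\<close>

definition htrans ::
    "('o,'m,'t,'x) gray_scheme \<Rightarrow> ('p,'n,'u,'y) gray_scheme \<Rightarrow> ('q,'k,'v,'z) gray_scheme
      \<Rightarrow> ('o,'m,'t,'p,'n,'u) threefun \<Rightarrow> ('o,'m,'t,'p,'n,'u) threefun
      \<Rightarrow> ('p,'n,'u,'q,'k,'v) threefun \<Rightarrow> ('p,'n,'u,'q,'k,'v) threefun
      \<Rightarrow> ('p,'n,'q,'k,'v) trans \<Rightarrow> ('o,'m,'p,'n,'u) trans \<Rightarrow> ('o,'m,'q,'k,'v) trans" where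
  "htrans C D E A B A' B' K H =
     cmptrans C E (cmp3 C D E A' A) (cmp3 C D E A' B) (cmp3 C D E B' B)
       (prewhisk C K B) (postwhisk C D E A' A H)"


section \<open>The strict 2-category of G-labelled Gray-monoids\<close>

text \<open>An object is a Gray-monoid whose set of 0-cells is identified with \<open>G\<close> by means of
  \<open>lab g = g\<^sub>C\<close>.  A 1-morphism is stored with its source and target, a 2-morphism with its bounding
  1-morphisms.\<close>

type_synonym ('g,'o,'m,'t) st0 = "('o,'m,'t) gray \<times> ('g \<Rightarrow> 'o)"
type_synonym ('g,'o,'m,'t) st1 =
  "('g,'o,'m,'t) st0 \<times> ('g,'o,'m,'t) st0 \<times> ('o,'m,'t,'o,'m,'t) threefun"
type_synonym ('g,'o,'m,'t) st2 =
  "('g,'o,'m,'t) st1 \<times> ('g,'o,'m,'t) st1 \<times> ('o,'m,'o,'m,'t) trans"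

definition st_obj :: "('g,'w) monoid_scheme \<Rightarrow> ('g,'o,'m,'t) st0 set" where
  "st_obj G = {(C, lab). gray_monoid C \<and> lab \<in> extensional (carrier G)
     \<and> bij_betw lab (carrier G) (Obj C)
     \<and> (\<forall>g \<in> carrier G. \<forall>h \<in> carrier G. lab (g \<otimes>\<^bsub>G\<^esub> h) = lab g \<odot>\<^bsub>C\<^esub> lab h)}"

definition st_mor :: "('g,'w) monoid_scheme \<Rightarrow> ('g,'o,'m,'t) st1 set" where
  "st_mor G = {((C, c), (D, d), A). (C, c) \<in> st_obj G \<and> (D, d) \<in> st_obj G \<and> normal_functor G c d C D A}"

definition st_cel :: "('g,'w) monoid_scheme \<Rightarrow> ('g,'o,'m,'t) st2 set" where
  "st_cel G = {(((C, c), (D, d), A), (X', Y', B), H).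
     ((C, c), (D, d), A) \<in> st_mor G \<and> (X', Y', B) \<in> st_mor G \<and> X' = (C, c) \<and> Y' = (D, d)
     \<and> normal_trans G c d C D A B H}"

definition Cat3st :: "('g,'w) monoid_scheme
    \<Rightarrow> (('g,'o,'m,'t) st0, ('g,'o,'m,'t) st1, ('g,'o,'m,'t) st2) twocat" where
  "Cat3st G = \<lparr>
     Obj = st_obj G, Arr = st_mor G, Cel = st_cel G,
     Dom = (\<lambda>(X, Y, A). X), Cod = (\<lambda>(X, Y, A). Y),
     Src = (\<lambda>(F, F', H). F), Tgt = (\<lambda>(F, F', H). F'),
     Id1 = (\<lambda>X. (X, X, idfun3 (fst X))),
     Id2 = (\<lambda>(X, Y, A). ((X, Y, A), (X, Y, A), idtrans (fst X) (fst Y) A)),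
     Cmp = (\<lambda>(Y', Z, B) (X, Y, A). (X, Z, cmp3 (fst X) (fst Y) (fst Z) B A)),
     VCmp = (\<lambda>(F', (_, _, L), K) ((X, Y, A), (_, _, B), H).
               ((X, Y, A), (X, Y, L), cmptrans (fst X) (fst Y) A B L K H)),
     HCmp = (\<lambda>((Y', Z, A'), (_, _, B'), K) ((X, Y, A), (_, _, B), H).
               ((X, Z, cmp3 (fst X) (fst Y) (fst Z) A' A), (X, Z, cmp3 (fst X) (fst Y) (fst Z) B' B),
                htrans (fst X) (fst Y) (fst Z) A B A' B' K H)) \<rparr>"


section \<open>The 4-category of pointed 3-categories\<close>

text \<open>Cells and identities in all dimensions, and the compositions of 1- and 2-cells.  No
  compositions of 3- and 4-cells are recorded: here every 3- and 4-cell turns out to be an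
  identity, which leaves only one possible value for each such composite.\<close>

record ('o,'m,'t,'r,'s) fourcat = "('o,'m,'t) twocat" +
  Cel3 :: "'r set"
  Src3 :: "'r \<Rightarrow> 't"
  Tgt3 :: "'r \<Rightarrow> 't"
  Id3 :: "'t \<Rightarrow> 'r"
  Cel4 :: "'s set"
  Src4 :: "'s \<Rightarrow> 'r"
  Tgt4 :: "'s \<Rightarrow> 'r"
  Id4 :: "'r \<Rightarrow> 's"

type_synonym ('g,'o,'m,'t) pt0 = "('o,'m,'t) gray \<times> ('g,'g,'g,'o,'m,'t) grayfun"
type_synonym ('g,'o,'m,'t) pt1 =
  "('g,'o,'m,'t) pt0 \<times> ('g,'o,'m,'t) pt0 \<times> ('o,'m,'t,'o,'m,'t) threefun \<times> ('g,'g,'o,'m,'t) trans"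
type_synonym ('g,'o,'m,'t) pt2 =
  "('g,'o,'m,'t) pt1 \<times> ('g,'o,'m,'t) pt1 \<times> ('o,'m,'o,'m,'t) trans \<times> ('g,'m,'t) modif"
type_synonym ('g,'o,'m,'t) pt3 =
  "('g,'o,'m,'t) pt2 \<times> ('g,'o,'m,'t) pt2 \<times> ('o,'m,'t) modif \<times> 't"
type_synonym ('g,'o,'m,'t) pt4 = "('g,'o,'m,'t) pt3 \<times> ('g,'o,'m,'t) pt3 \<times> 't"

definition pt_obj :: "('g,'w) monoid_scheme \<Rightarrow> ('g,'o,'m,'t) pt0 set" where
  "pt_obj G = {(C, P). gray_monoid C \<and> gray_functor (disc G) C P \<and> bij_betw (p0 P) (carrier G) (Obj C)}"

text \<open>The 3-functor \<open>\<pi> : BG \<rightarrow> BC\<close> and its composite with a 3-functor \<open>A : BC \<rightarrow> BD\<close>.\<close>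

abbreviation pi3 :: "('g,'w) monoid_scheme \<Rightarrow> ('g,'o,'m,'t) pt0 \<Rightarrow> ('g,'g,'g,'o,'m,'t) threefun" where
  "pi3 G X \<equiv> strict3 (disc G) (fst X) (snd X)"

abbreviation api3 :: "('g,'w) monoid_scheme \<Rightarrow> ('g,'o,'m,'t) pt0 \<Rightarrow> ('g,'o,'m,'t) pt0
    \<Rightarrow> ('o,'m,'t,'o,'m,'t) threefun \<Rightarrow> ('g,'g,'g,'o,'m,'t) threefun" where
  "api3 G X Y A \<equiv> cmp3 (disc G) (fst X) (fst Y) A (pi3 G X)"

text \<open>In \<open>BG\<close> the identity 1-cell of \<open>g\<close> is denoted by \<open>g\<close>, so \<open>tm \<alpha> g\<close> is \<open>\<alpha>\<close> at \<open>id\<^sub>g\<close>.\<close>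

definition pt_mor :: "('g,'w) monoid_scheme \<Rightarrow> ('g,'o,'m,'t) pt1 set" where
  "pt_mor G = {(X, Y, A, \<alpha>). X \<in> pt_obj G \<and> Y \<in> pt_obj G
     \<and> normal_functor G (p0 (snd X)) (p0 (snd Y)) (fst X) (fst Y) A
     \<and> invertible_transformation (disc G) (fst Y) (pi3 G Y) (api3 G X Y A) \<alpha>
     \<and> ts \<alpha> = p0 (snd Y) \<one>\<^bsub>G\<^esub>
     \<and> (\<forall>g \<in> carrier G. tc \<alpha> g = idadj (fst Y) (p0 (snd Y) g))
     \<and> (\<forall>g \<in> carrier G. tm \<alpha> g = fu A (p0 (snd X) g))
     \<and> t1 \<alpha> = \<guillemotleft>Id1 (fst Y) (p0 (snd Y) \<one>\<^bsub>G\<^esub>)\<guillemotright>\<^bsub>fst Y\<^esub>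
     \<and> (\<forall>g \<in> carrier G. \<forall>h \<in> carrier G.
          t2 \<alpha> (g, h) = \<guillemotleft>Id1 (fst Y) (p0 (snd Y) (g \<otimes>\<^bsub>G\<^esub> h))\<guillemotright>\<^bsub>fst Y\<^esub>)}"

text \<open>The transformation \<open>(H \<circ> \<pi>) * \<alpha>\<close> from \<open>\<pi>\<close> to \<open>B \<circ> \<pi>\<close>, for \<open>\<alpha> : \<pi> \<Rightarrow> A \<circ> \<pi>\<close> and \<open>H : A \<Rightarrow> B\<close>.\<close>

definition pt_act :: "('g,'w) monoid_scheme \<Rightarrow> ('g,'o,'m,'t) pt0 \<Rightarrow> ('g,'o,'m,'t) pt0
    \<Rightarrow> ('o,'m,'t,'o,'m,'t) threefun \<Rightarrow> ('o,'m,'t,'o,'m,'t) threefun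
    \<Rightarrow> ('o,'m,'o,'m,'t) trans \<Rightarrow> ('g,'g,'o,'m,'t) trans \<Rightarrow> ('g,'g,'o,'m,'t) trans" where
  "pt_act G X Y A B H \<alpha> = cmptrans (disc G) (fst Y) (pi3 G Y) (api3 G X Y A) (api3 G X Y B)
     (prewhisk (disc G) H (pi3 G X)) \<alpha>"

definition pt_cel :: "('g,'w) monoid_scheme \<Rightarrow> ('g,'o,'m,'t) pt2 set" where
  "pt_cel G = {((X, Y, A, \<alpha>), (X', Y', B, \<beta>), H, m).
     (X, Y, A, \<alpha>) \<in> pt_mor G \<and> (X', Y', B, \<beta>) \<in> pt_mor G \<and> X' = X \<and> Y' = Y
     \<and> normal_trans G (p0 (snd X)) (p0 (snd Y)) (fst X) (fst Y) A B H
     \<and> modification (disc G) (fst Y) (pi3 G Y) (api3 G X Y B) \<beta> (pt_act G X Y A B H \<alpha>) m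
     \<and> ms m = Id1 (fst Y) (p0 (snd Y) \<one>\<^bsub>G\<^esub>)
     \<and> (\<forall>g \<in> carrier G. mc m g = \<guillemotleft>Id1 (fst Y) (p0 (snd Y) g)\<guillemotright>\<^bsub>fst Y\<^esub>)}"

definition pt_cel3 :: "('g,'w) monoid_scheme \<Rightarrow> ('g,'o,'m,'t) pt3 set" where
  "pt_cel3 G = {(((X, Y, A, \<alpha>), (X, Y, B, \<beta>), H, m), (F, F', K, n), p, r) | X Y A \<alpha> B \<beta> H m F F' K n p r.
     ((X, Y, A, \<alpha>), (X, Y, B, \<beta>), H, m) \<in> pt_cel G \<and> (F, F', K, n) \<in> pt_cel G
     \<and> F = (X, Y, A, \<alpha>) \<and> F' = (X, Y, B, \<beta>)
     \<and> modification (fst X) (fst Y) A B H K p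
     \<and> ms p = Id1 (fst Y) (p0 (snd Y) \<one>\<^bsub>G\<^esub>)
     \<and> (\<forall>g \<in> carrier G. mc p (p0 (snd X) g) = \<guillemotleft>Id1 (fst Y) (p0 (snd Y) g)\<guillemotright>\<^bsub>fst Y\<^esub>)
     \<and> perturbation (disc G) (fst Y) (pi3 G Y) (api3 G X Y B) \<beta> (pt_act G X Y A B K \<alpha>)
         n
         (cmpmod (disc G) (fst Y) (pi3 G Y) (api3 G X Y B)
           (modwhisk (disc G) (fst Y) (prewhisk (disc G) H (pi3 G X)) (prewhisk (disc G) K (pi3 G X))
             (modpre (disc G) p (pi3 G X)) \<alpha>)
           m)
         r
     \<and> r = \<guillemotleft>Id1 (fst Y) (p0 (snd Y) \<one>\<^bsub>G\<^esub>)\<guillemotright>\<^bsub>fst Y\<^esub>}"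

definition pt_cel4 :: "('g,'w) monoid_scheme \<Rightarrow> ('g,'o,'m,'t) pt4 set" where
  "pt_cel4 G = {((S, T, p, r), (S', T', q, s), \<xi>) | S T p r S' T' q s \<xi>.
     (S, T, p, r) \<in> pt_cel3 G \<and> (S', T', q, s) \<in> pt_cel3 G \<and> S' = S \<and> T' = T
     \<and> (case (S, T) of (((X, Y, A, \<alpha>), (_, _, B, \<beta>), H, m), (_, _, K, n)) \<Rightarrow>
          perturbation (fst X) (fst Y) A B H K p q \<xi>
        \<and> \<xi> = \<guillemotleft>Id1 (fst Y) (p0 (snd Y) \<one>\<^bsub>G\<^esub>)\<guillemotright>\<^bsub>fst Y\<^esub>)}"

text \<open>The composite of \<open>(A, \<alpha>)\<close> and \<open>(B, \<beta>)\<close> is \<open>B \<circ> A\<close> with the transformation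
  \<open>\<pi> \<Rightarrow> B \<circ> \<pi> \<Rightarrow> B \<circ> A \<circ> \<pi>\<close> given by \<open>\<beta>\<close> and \<open>B \<circ> \<alpha>\<close>.\<close>

definition pt_cmp :: "('g,'w) monoid_scheme \<Rightarrow> ('g,'o,'m,'t) pt1 \<Rightarrow> ('g,'o,'m,'t) pt1 \<Rightarrow> ('g,'o,'m,'t) pt1" where
  "pt_cmp G = (\<lambda>(_, Z, B, \<beta>) (X, Y, A, \<alpha>).
     (X, Z, cmp3 (fst X) (fst Y) (fst Z) B A,
      cmptrans (disc G) (fst Z) (pi3 G Z) (api3 G Y Z B) (api3 G X Z (cmp3 (fst X) (fst Y) (fst Z) B A))
        (postwhisk (disc G) (fst Y) (fst Z) B (pi3 G Y) \<alpha>) \<beta>))"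

text \<open>The modification component \<open>m\<close> of a 2-cell consists of identities, so the same is true of
  the modification component of every identity and every composite.\<close>

definition pt_unitmod :: "('g,'w) monoid_scheme \<Rightarrow> ('g,'o,'m,'t) pt0 \<Rightarrow> ('g,'m,'t) modif" where
  "pt_unitmod G Y = \<lparr> ms = Id1 (fst Y) (p0 (snd Y) \<one>\<^bsub>G\<^esub>),
     mc = (\<lambda>g \<in> carrier G. \<guillemotleft>Id1 (fst Y) (p0 (snd Y) g)\<guillemotright>\<^bsub>fst Y\<^esub>) \<rparr>"

definition Cat3pt :: "('g,'w) monoid_scheme
    \<Rightarrow> (('g,'o,'m,'t) pt0, ('g,'o,'m,'t) pt1, ('g,'o,'m,'t) pt2, ('g,'o,'m,'t) pt3, ('g,'o,'m,'t) pt4) fourcat" where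
  "Cat3pt G = \<lparr>
     Obj = pt_obj G, Arr = pt_mor G, Cel = pt_cel G,
     Dom = (\<lambda>(X, Y, A, \<alpha>). X), Cod = (\<lambda>(X, Y, A, \<alpha>). Y),
     Src = (\<lambda>(F, F', H, m). F), Tgt = (\<lambda>(F, F', H, m). F'),
     Id1 = (\<lambda>X. (X, X, idfun3 (fst X), idtrans (disc G) (fst X) (pi3 G X))),
     Id2 = (\<lambda>(X, Y, A, \<alpha>). ((X, Y, A, \<alpha>), (X, Y, A, \<alpha>), idtrans (fst X) (fst Y) A, pt_unitmod G Y)),
     Cmp = pt_cmp G,
     VCmp = (\<lambda>(_, (_, _, L, \<gamma>), K, n) ((X, Y, A, \<alpha>), (_, _, B, \<beta>), H, m).
               ((X, Y, A, \<alpha>), (X, Y, L, \<gamma>), cmptrans (fst X) (fst Y) A B L K H, pt_unitmod G Y)),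
     HCmp = (\<lambda>((Y', Z, A', \<alpha>'), (_, _, B', \<beta>'), K, n) ((X, Y, A, \<alpha>), (_, _, B, \<beta>), H, m).
               (pt_cmp G (Y', Z, A', \<alpha>') (X, Y, A, \<alpha>), pt_cmp G (Y', Z, B', \<beta>') (X, Y, B, \<beta>),
                htrans (fst X) (fst Y) (fst Z) A B A' B' K H, pt_unitmod G Z)),
     Cel3 = pt_cel3 G,
     Src3 = (\<lambda>(S, T, p, r). S), Tgt3 = (\<lambda>(S, T, p, r). T),
     Id3 = (\<lambda>((X, Y, A, \<alpha>), F', H, m).
              (((X, Y, A, \<alpha>), F', H, m), ((X, Y, A, \<alpha>), F', H, m), idmod (fst X) (fst Y) H,
               \<guillemotleft>ms m\<guillemotright>\<^bsub>fst Y\<^esub>)),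
     Cel4 = pt_cel4 G,
     Src4 = (\<lambda>(S, T, \<xi>). S), Tgt4 = (\<lambda>(S, T, \<xi>). T),
     Id4 = (\<lambda>(((X, Y, A, \<alpha>), F', H, m), T, p, r).
              ((((X, Y, A, \<alpha>), F', H, m), T, p, r), (((X, Y, A, \<alpha>), F', H, m), T, p, r), \<guillemotleft>ms p\<guillemotright>\<^bsub>fst Y\<^esub>)) \<rparr>"

text \<open>A strict 2-category is a 4-category with only identity 3- and 4-cells; a 4-category is
  isomorphic to it if the same holds there and the remaining cells correspond bijectively,
  compatibly with all of the structure.\<close>

definition isomorphic_to_2category ::
    "('o,'m,'t,'r,'s,'z) fourcat_scheme \<Rightarrow> ('o2,'m2,'t2,'z2) twocat_scheme \<Rightarrow> bool" where
  "isomorphic_to_2category X Y \<longleftrightarrow> strict_2category Y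
   \<and> (\<exists>F0 F1 F2.
        bij_betw F0 (Obj X) (Obj Y) \<and> bij_betw F1 (Arr X) (Arr Y) \<and> bij_betw F2 (Cel X) (Cel Y)
      \<and> (\<forall>x \<in> Arr X. Dom X x \<in> Obj X \<and> Cod X x \<in> Obj X
            \<and> Dom Y (F1 x) = F0 (Dom X x) \<and> Cod Y (F1 x) = F0 (Cod X x))
      \<and> (\<forall>f \<in> Cel X. Src X f \<in> Arr X \<and> Tgt X f \<in> Arr X
            \<and> Src Y (F2 f) = F1 (Src X f) \<and> Tgt Y (F2 f) = F1 (Tgt X f))
      \<and> (\<forall>a \<in> Obj X. Id1 X a \<in> Arr X \<and> F1 (Id1 X a) = Id1 Y (F0 a))
      \<and> (\<forall>x \<in> Arr X. Id2 X x \<in> Cel X \<and> F2 (Id2 X x) = Id2 Y (F1 x))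
      \<and> (\<forall>x \<in> Arr X. \<forall>y \<in> Arr X. Cod X x = Dom X y \<longrightarrow>
            y \<cdot>\<^bsub>X\<^esub> x \<in> Arr X \<and> F1 (y \<cdot>\<^bsub>X\<^esub> x) = F1 y \<cdot>\<^bsub>Y\<^esub> F1 x)
      \<and> (\<forall>f \<in> Cel X. \<forall>g \<in> Cel X. Tgt X f = Src X g \<longrightarrow>
            g \<bullet>\<^bsub>X\<^esub> f \<in> Cel X \<and> F2 (g \<bullet>\<^bsub>X\<^esub> f) = F2 g \<bullet>\<^bsub>Y\<^esub> F2 f)
      \<and> (\<forall>f \<in> Cel X. \<forall>g \<in> Cel X. Cod X (Src X f) = Dom X (Src X g) \<longrightarrow>
            g \<star>\<^bsub>X\<^esub> f \<in> Cel X \<and> F2 (g \<star>\<^bsub>X\<^esub> f) = F2 g \<star>\<^bsub>Y\<^esub> F2 f))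
   \<and> bij_betw (Id3 X) (Cel X) (Cel3 X) \<and> (\<forall>f \<in> Cel X. Src3 X (Id3 X f) = f \<and> Tgt3 X (Id3 X f) = f)
   \<and> bij_betw (Id4 X) (Cel3 X) (Cel4 X) \<and> (\<forall>p \<in> Cel3 X. Src4 X (Id4 X p) = p \<and> Tgt4 X (Id4 X p) = p)"

end

theory Submission
  imports Defs
begin

text \<open>A 3-functor \<open>A\<close> whose \<open>\<mu>\<close>, \<open>\<iota>\<close>, \<open>\<omega>\<close>, \<open>\<ell>\<close> and \<open>r\<close> are identities has little structure left.
  Whiskerings by these identities and interchangers with them disappear from the axioms, and what
  remains is a pseudofunctor that is strictly multiplicative on 0-cells, with invertible 2-cells
  \<open>A x \<boxtimes> A y \<Rightarrow> A (x \<boxtimes> y)\<close> that are natural, associative and unital: a \<^emph>\<open>monoidal pseudofunctor\<close>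
  (\<open>normal_functor_iff\<close>).  In the same way a normalised transformation has only identity 1-cell
  components, so it is a family of 2-cells \<open>A x \<Rightarrow> B x\<close> compatible with 2-cells, composition, units and
  \<open>\<boxtimes>\<close>: a \<^emph>\<open>monoidal icon\<close> (\<open>normal_trans_iff\<close>).

  In these terms the composite of 3-functors is composition of functions with pasted structure cells,
  and vertical and horizontal composites of transformations are given by \<open>K\<^sub>x \<bullet> H\<^sub>x\<close> and
  \<open>K\<^bsub>B x\<^esub> \<bullet> A'(H\<^sub>x)\<close>.  These formulas are strictly associative and unital, and the interchange law is
  naturality of \<open>K\<close> with respect to the 2-cell \<open>H\<^sub>x\<close>.  Since an icon is determined by its 2-cells,
  all axioms of a strict 2-category follow (\<open>strict_2category_Cat3st\<close>).

  On the pointed side the additional data are redundant.  Because \<open>BG\<close> has only identity higher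
  cells, \<open>\<pi>\<close> amounts to the labelling \<open>g \<mapsto> g\<^sub>C\<close>.  The Gray-monoid \<open>G\<close> is itself labelled by \<open>G\<close>, so
  \<open>\<pi>\<close> and \<open>A \<circ> \<pi>\<close> are monoidal pseudofunctors and the transformation \<open>\<alpha>\<close> is a monoidal icon between
  them.  Its components are prescribed to be \<open>A\<^sup>1\<close>; the icon axioms for this family are the unit
  axioms of \<open>A\<close>, and every icon is invertible, so exactly one \<open>\<alpha>\<close> exists for each \<open>A\<close>
  (\<open>pt_mor_iff\<close>).  A modification with identity components between icons exists precisely when the
  icons are equal (\<open>modification_iff_eq\<close>).  For the modification \<open>m\<close> of a 2-morphism the equation is
  \<open>H \<bullet> A\<^sup>1 = B\<^sup>1\<close>, which is the unit axiom of the icon \<open>H\<close>; hence exactly one \<open>m\<close> exists for each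
  \<open>H\<close> (\<open>pt_cel_iff\<close>).  For the modification \<open>p\<close> of a 3-morphism the equation says that source and
  target agree, so 3-cells, and then 4-cells, are identities (\<open>pt_cel3_iff\<close>, \<open>pt_cel4_iff\<close>).
  Forgetting \<open>\<alpha>\<close> and \<open>m\<close> is therefore the required isomorphism.\<close>

section \<open>Calculus in a Gray-monoid\<close>

definition iso2 :: "('o,'m,'t,'z) twocat_scheme \<Rightarrow> 't \<Rightarrow> bool" where
  "iso2 D f \<longleftrightarrow> f \<in> Cel D \<and> (\<exists>g. inverse2 D f g)"

lemma icell_iff: "icell D f x y \<longleftrightarrow> iso2 D f \<and> Src D f = x \<and> Tgt D f = y"
  by (auto simp: icell_def iso2_def cell_def)

text \<open>The axioms are restated with membership and boundary conditions in place of \<^const>\<open>arr\<close> and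
  \<^const>\<open>cell\<close>, so that the simplifier can compute sources and targets of composites and thereby
  discharge the typing conditions of every rewriting step.  Interchange and functoriality of
  \<open>\<boxtimes>\<close> are used in both directions and stay outside the simpset.\<close>

locale gray_mon =
  fixes D :: "('o,'m,'t,'z) gray_scheme" (structure)
  assumes gm: "gray_monoid D"
begin

lemma underlying_2category: "strict_2category D"
  using gm by (simp add: gray_monoid_def)

(* The conjuncts of a definition are available as cat(i) and gray(i), in the order in which it lists
   them, and likewise as pfun(i) and gfun(i) below. *)
lemmas cat_unfolded = underlying_2category[unfolded strict_2category_def arr_def cell_def]
lemmas cat_tail1 = conjunct2[OF cat_unfolded]
lemmas cat_tail2 = conjunct2[OF cat_tail1]
lemmas cat_tail3 = conjunct2[OF cat_tail2]
lemmas cat_tail4 = conjunct2[OF cat_tail3]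
lemmas cat_tail5 = conjunct2[OF cat_tail4]
lemmas cat_tail6 = conjunct2[OF cat_tail5]
lemmas cat_tail7 = conjunct2[OF cat_tail6]
lemmas cat_tail8 = conjunct2[OF cat_tail7]
lemmas cat_tail9 = conjunct2[OF cat_tail8]
lemmas cat_tail10 = conjunct2[OF cat_tail9]
lemmas cat_tail11 = conjunct2[OF cat_tail10]
lemmas cat_tail12 = conjunct2[OF cat_tail11]
lemmas cat_tail13 = conjunct2[OF cat_tail12]
lemmas cat_tail14 = conjunct2[OF cat_tail13]
lemmas cat = conjunct1[OF cat_unfolded] conjunct1[OF cat_tail1] conjunct1[OF cat_tail2]
  conjunct1[OF cat_tail3] conjunct1[OF cat_tail4] conjunct1[OF cat_tail5] conjunct1[OF cat_tail6]
  conjunct1[OF cat_tail7] conjunct1[OF cat_tail8] conjunct1[OF cat_tail9] conjunct1[OF cat_tail10]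
  conjunct1[OF cat_tail11] conjunct1[OF cat_tail12] conjunct1[OF cat_tail13] cat_tail14

lemmas gray_unfolded = gm[unfolded gray_monoid_def arr_def cell_def]
lemmas gray_tail1 = conjunct2[OF gray_unfolded]
lemmas gray_tail2 = conjunct2[OF gray_tail1]
lemmas gray_tail3 = conjunct2[OF gray_tail2]
lemmas gray_tail4 = conjunct2[OF gray_tail3]
lemmas gray_tail5 = conjunct2[OF gray_tail4]
lemmas gray_tail6 = conjunct2[OF gray_tail5]
lemmas gray_tail7 = conjunct2[OF gray_tail6]
lemmas gray_tail8 = conjunct2[OF gray_tail7]
lemmas gray_tail9 = conjunct2[OF gray_tail8]
lemmas gray_tail10 = conjunct2[OF gray_tail9]
lemmas gray_tail11 = conjunct2[OF gray_tail10]
lemmas gray = conjunct1[OF gray_unfolded] conjunct1[OF gray_tail1] conjunct1[OF gray_tail2]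
  conjunct1[OF gray_tail3] conjunct1[OF gray_tail4] conjunct1[OF gray_tail5]
  conjunct1[OF gray_tail6] conjunct1[OF gray_tail7] conjunct1[OF gray_tail8]
  conjunct1[OF gray_tail9] conjunct1[OF gray_tail10] conjunct1[OF gray_tail11]

lemma dom_cod_obj [simp]: "x \<in> Arr D \<Longrightarrow> Dom D x \<in> Obj D" "x \<in> Arr D \<Longrightarrow> Cod D x \<in> Obj D"
  using cat(1) by simp_all

lemma src_tgt [simp]:
  "f \<in> Cel D \<Longrightarrow> Src D f \<in> Arr D" "f \<in> Cel D \<Longrightarrow> Tgt D f \<in> Arr D"
  "f \<in> Cel D \<Longrightarrow> Dom D (Tgt D f) = Dom D (Src D f)"
  "f \<in> Cel D \<Longrightarrow> Cod D (Tgt D f) = Cod D (Src D f)"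
  using cat(2) by simp_all

lemma id1 [simp]:
  assumes "a \<in> Obj D"
  shows "Id1 D a \<in> Arr D" "Dom D (Id1 D a) = a" "Cod D (Id1 D a) = a"
  using assms cat(3) by simp_all

lemma id2 [simp]:
  assumes "x \<in> Arr D"
  shows "\<guillemotleft>x\<guillemotright> \<in> Cel D" "Src D \<guillemotleft>x\<guillemotright> = x" "Tgt D \<guillemotleft>x\<guillemotright> = x"
  using assms cat(4) by simp_all

lemma cmp [simp]:
  assumes "x \<in> Arr D" "y \<in> Arr D" "Cod D x = Dom D y"
  shows "y \<cdot> x \<in> Arr D" "Dom D (y \<cdot> x) = Dom D x" "Cod D (y \<cdot> x) = Cod D y"
  using assms cat(5) by simp_all

lemma cmp_unit [simp]:
  assumes "x \<in> Arr D"
  shows "Dom D x = a \<Longrightarrow> x \<cdot> Id1 D a = x" "Cod D x = a \<Longrightarrow> Id1 D a \<cdot> x = x"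
  using assms cat(6) by auto

lemma cmp_assoc [simp]:
  assumes "x \<in> Arr D" "y \<in> Arr D" "z \<in> Arr D" "Cod D x = Dom D y" "Cod D y = Dom D z"
  shows "(z \<cdot> y) \<cdot> x = z \<cdot> (y \<cdot> x)"
  using assms cat(7) by simp_all

lemma vcmp [simp]:
  assumes "f \<in> Cel D" "g \<in> Cel D" "Tgt D f = Src D g"
  shows "g \<bullet> f \<in> Cel D" "Src D (g \<bullet> f) = Src D f" "Tgt D (g \<bullet> f) = Tgt D g"
  using assms cat(8) by simp_all

lemma vcmp_unit [simp]:
  assumes "f \<in> Cel D"
  shows "Src D f = x \<Longrightarrow> f \<bullet> \<guillemotleft>x\<guillemotright> = f" "Tgt D f = x \<Longrightarrow> \<guillemotleft>x\<guillemotright> \<bullet> f = f"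
  using assms cat(9) by auto

lemma vcmp_assoc [simp]:
  assumes "f \<in> Cel D" "g \<in> Cel D" "h \<in> Cel D" "Tgt D f = Src D g" "Tgt D g = Src D h"
  shows "(h \<bullet> g) \<bullet> f = h \<bullet> (g \<bullet> f)"
  using assms cat(10) by simp_all

text \<open>Rewriting with an equation between binary vertical composites inside a composite that is nested to
  the right: all pasting diagrams below are transformed by this rule.\<close>

lemma vcmp_extend:
  assumes "q \<bullet> p = s \<bullet> r" "p \<in> Cel D" "q \<in> Cel D" "r \<in> Cel D" "s \<in> Cel D" "t \<in> Cel D"
    "Tgt D p = Src D q" "Tgt D r = Src D s" "Tgt D t = Src D p" "Src D p = Src D r"
  shows "q \<bullet> (p \<bullet> t) = s \<bullet> (r \<bullet> t)"
  using assms vcmp_assoc[of t p q] vcmp_assoc[of t r s] by simp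

lemma hcmp [simp]:
  assumes "f \<in> Cel D" "g \<in> Cel D" "Cod D (Src D f) = Dom D (Src D g)"
  shows "g \<star> f \<in> Cel D" "Src D (g \<star> f) = Src D g \<cdot> Src D f" "Tgt D (g \<star> f) = Tgt D g \<cdot> Tgt D f"
  using assms cat(11) by simp_all

lemma hcmp_id [simp]:
  assumes "x \<in> Arr D" "y \<in> Arr D" "Cod D x = Dom D y"
  shows "\<guillemotleft>y\<guillemotright> \<star> \<guillemotleft>x\<guillemotright> = \<guillemotleft>y \<cdot> x\<guillemotright>"
  using assms cat(12) by simp_all

lemma interchange:
  assumes "f \<in> Cel D" "g \<in> Cel D" "f' \<in> Cel D" "g' \<in> Cel D"
    "Tgt D f = Src D f'" "Tgt D g = Src D g'" "Cod D (Src D f) = Dom D (Src D g)"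
  shows "(g' \<bullet> g) \<star> (f' \<bullet> f) = (g' \<star> f') \<bullet> (g \<star> f)"
  using assms cat(13) by simp_all

text \<open>Merges the pairs of whiskered 2-cells that occur in the axioms of 3-functors and transformations.\<close>

lemma hcmp_split:
  assumes "f \<in> Cel D" "g \<in> Cel D" "Cod D (Src D f) = Dom D (Src D g)"
  shows "(\<guillemotleft>Tgt D g\<guillemotright> \<star> f) \<bullet> (g \<star> \<guillemotleft>Src D f\<guillemotright>) = g \<star> f"
    "(g \<star> \<guillemotleft>Tgt D f\<guillemotright>) \<bullet> (\<guillemotleft>Src D g\<guillemotright> \<star> f) = g \<star> f"
  using interchange[of "\<guillemotleft>Src D f\<guillemotright>" g f "\<guillemotleft>Tgt D g\<guillemotright>"] interchange[of f "\<guillemotleft>Src D g\<guillemotright>" "\<guillemotleft>Tgt D f\<guillemotright>" g] assms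
  by simp_all

lemma whisker_vcmp:
  assumes "f \<in> Cel D" "g \<in> Cel D" "Tgt D f = Src D g" "x \<in> Arr D"
  shows "Cod D x = Dom D (Src D f) \<Longrightarrow> (g \<bullet> f) \<star> \<guillemotleft>x\<guillemotright> = (g \<star> \<guillemotleft>x\<guillemotright>) \<bullet> (f \<star> \<guillemotleft>x\<guillemotright>)"
    "Cod D (Src D f) = Dom D x \<Longrightarrow> \<guillemotleft>x\<guillemotright> \<star> (g \<bullet> f) = (\<guillemotleft>x\<guillemotright> \<star> g) \<bullet> (\<guillemotleft>x\<guillemotright> \<star> f)"
  using interchange[of "\<guillemotleft>x\<guillemotright>" f "\<guillemotleft>x\<guillemotright>" g] interchange[of f "\<guillemotleft>x\<guillemotright>" g "\<guillemotleft>x\<guillemotright>"] assms by simp_all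

lemma hcmp_unit [simp]:
  assumes "f \<in> Cel D"
  shows "Dom D (Src D f) = a \<Longrightarrow> f \<star> \<guillemotleft>Id1 D a\<guillemotright> = f" "Cod D (Src D f) = a \<Longrightarrow> \<guillemotleft>Id1 D a\<guillemotright> \<star> f = f"
  using assms cat(14) by auto

lemma hcmp_assoc [simp]:
  assumes "f \<in> Cel D" "g \<in> Cel D" "h \<in> Cel D"
    "Cod D (Src D f) = Dom D (Src D g)" "Cod D (Src D g) = Dom D (Src D h)"
  shows "(h \<star> g) \<star> f = h \<star> (g \<star> f)"
  using assms cat(15) by simp_all

lemma iso2D [simp]: "iso2 D f \<Longrightarrow> f \<in> Cel D"
  by (simp add: iso2_def)

text \<open>Uniqueness makes \<^const>\<open>inv2\<close> an inverse of every invertible 2-cell.\<close>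

lemma inverse2_unique:
  assumes "f \<in> Cel D" "inverse2 D f g" "inverse2 D f h"
  shows "g = h"
proof -
  have c: "g \<in> Cel D" "h \<in> Cel D" "Src D g = Tgt D f" "Tgt D g = Src D f" "Src D h = Tgt D f" "Tgt D h = Src D f"
    "g \<bullet> f = \<guillemotleft>Src D f\<guillemotright>" "f \<bullet> h = \<guillemotleft>Tgt D f\<guillemotright>"
    using assms by (auto simp: inverse2_def cell_def)
  have "g = g \<bullet> (f \<bullet> h)" using c assms(1) by simp
  also have "\<dots> = (g \<bullet> f) \<bullet> h" using c(1-6) assms(1) by simp
  also have "\<dots> = h" using c assms(1) by simp
  finally show ?thesis .
qed

lemma inv2_eqI:
  assumes "f \<in> Cel D" "inverse2 D f g"
  shows "inv2 D f = g" "iso2 D f"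
  unfolding inv2_def iso2_def using inverse2_unique assms by (auto intro!: the_equality)

lemma inverse2_inv2: "iso2 D f \<Longrightarrow> inverse2 D f (inv2 D f)"
  using inv2_eqI(1) unfolding iso2_def by metis

lemma inv2 [simp]:
  assumes "iso2 D f"
  shows "inv2 D f \<in> Cel D" "Src D (inv2 D f) = Tgt D f" "Tgt D (inv2 D f) = Src D f"
    "inv2 D f \<bullet> f = \<guillemotleft>Src D f\<guillemotright>" "f \<bullet> inv2 D f = \<guillemotleft>Tgt D f\<guillemotright>"
  using inverse2_inv2[OF assms] by (auto simp: inverse2_def cell_def)

lemma iso2_inv2 [simp]: "iso2 D f \<Longrightarrow> iso2 D (inv2 D f)"
  by (rule inv2_eqI(2)[of _ f]) (auto simp: inverse2_def cell_def)

lemma inverse2_id: "x \<in> Arr D \<Longrightarrow> inverse2 D \<guillemotleft>x\<guillemotright> \<guillemotleft>x\<guillemotright>"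
  by (simp add: inverse2_def cell_def)

lemma inv2_id [simp]: "x \<in> Arr D \<Longrightarrow> inv2 D \<guillemotleft>x\<guillemotright> = \<guillemotleft>x\<guillemotright>" "x \<in> Arr D \<Longrightarrow> iso2 D \<guillemotleft>x\<guillemotright>"
  using inv2_eqI[OF id2(1) inverse2_id] by simp_all

lemma iso2_vcmp [simp]:
  assumes "iso2 D f" "iso2 D g" "Tgt D f = Src D g"
  shows "iso2 D (g \<bullet> f)"
proof (rule inv2_eqI(2)[of _ "inv2 D f \<bullet> inv2 D g"])
  have "(inv2 D f \<bullet> inv2 D g) \<bullet> (g \<bullet> f) = inv2 D f \<bullet> ((inv2 D g \<bullet> g) \<bullet> f)"
    using assms by (simp del: inv2(4,5))
  moreover have "(g \<bullet> f) \<bullet> (inv2 D f \<bullet> inv2 D g) = g \<bullet> ((f \<bullet> inv2 D f) \<bullet> inv2 D g)"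
    using assms by (simp del: inv2(4,5))
  ultimately show "inverse2 D (g \<bullet> f) (inv2 D f \<bullet> inv2 D g)"
    using assms by (simp add: inverse2_def cell_def)
qed (use assms in simp)

lemma iso2_hcmp [simp]:
  assumes "iso2 D f" "iso2 D g" "Cod D (Src D f) = Dom D (Src D g)"
  shows "iso2 D (g \<star> f)"
proof (rule inv2_eqI(2)[of _ "inv2 D g \<star> inv2 D f"])
  show "inverse2 D (g \<star> f) (inv2 D g \<star> inv2 D f)"
    using assms by (simp add: inverse2_def cell_def interchange[symmetric])
qed (use assms in simp)

lemma inv2_hcmp:
  assumes "iso2 D f" "iso2 D g" "Cod D (Src D f) = Dom D (Src D g)"
  shows "inv2 D (g \<star> f) = inv2 D g \<star> inv2 D f"
  by (rule inv2_eqI) (use assms in \<open>simp_all add: inverse2_def cell_def interchange[symmetric]\<close>)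

text \<open>Turns a naturality square for invertible 2-cells into the square for their inverses.\<close>

lemma vcmp_inv2_swap:
  assumes "q \<bullet> p = s \<bullet> r" "iso2 D q" "iso2 D r" "p \<in> Cel D" "s \<in> Cel D"
    "Tgt D p = Src D q" "Tgt D r = Src D s" "Src D p = Src D r" "Tgt D s = Tgt D q"
  shows "inv2 D q \<bullet> s = p \<bullet> inv2 D r"
proof -
  have "inv2 D q \<bullet> s = inv2 D q \<bullet> ((s \<bullet> r) \<bullet> inv2 D r)"
    using assms by simp
  also have "\<dots> = inv2 D q \<bullet> ((q \<bullet> p) \<bullet> inv2 D r)"
    by (simp only: assms(1))
  also have "\<dots> = (inv2 D q \<bullet> q) \<bullet> (p \<bullet> inv2 D r)"
    using assms(2-) by (simp del: inv2(4,5))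
  also have "\<dots> = p \<bullet> inv2 D r"
    using assms(2-) by simp
  finally show ?thesis .
qed

lemma ten_obj [simp]: "a \<in> Obj D \<Longrightarrow> b \<in> Obj D \<Longrightarrow> a \<odot> b \<in> Obj D"
  using gray(5) by (auto simp: strict_2endo_def)

lemma unt [simp]: "Unt D \<in> Obj D" "a \<in> Obj D \<Longrightarrow> Unt D \<odot> a = a" "a \<in> Obj D \<Longrightarrow> a \<odot> Unt D = a"
  using gray(2,3) by simp_all

lemma ten_assoc [simp]: "a \<in> Obj D \<Longrightarrow> b \<in> Obj D \<Longrightarrow> c \<in> Obj D \<Longrightarrow> (a \<odot> b) \<odot> c = a \<odot> (b \<odot> c)"
  using gray(4) by simp

lemma lw_endo: "a \<in> Obj D \<Longrightarrow> strict_2endo D (\<lambda>b. a \<odot> b) (\<lambda>x. a \<ltimes> x) (\<lambda>f. a \<ltimes>\<^sub>2 f)"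
  and rw_endo: "a \<in> Obj D \<Longrightarrow> strict_2endo D (\<lambda>b. b \<odot> a) (\<lambda>x. x \<rtimes> a) (\<lambda>f. f \<rtimes>\<^sub>2 a)"
  using gray(5,6) by simp_all

lemma strict_2endo_iso2:
  assumes F: "strict_2endo D F0 F1 F2" and f: "iso2 D f"
  shows "iso2 D (F2 f)"
proof (rule inv2_eqI(2)[of _ "F2 (inv2 D f)"])
  have i: "inverse2 D f (inv2 D f)" by (rule inverse2_inv2[OF f])
  have *: "F2 (inv2 D f) \<bullet> F2 f = F2 (inv2 D f \<bullet> f)" "F2 f \<bullet> F2 (inv2 D f) = F2 (f \<bullet> inv2 D f)"
    using f F iso2D[OF f] inv2(1-3)[OF f] unfolding strict_2endo_def cell_def by metis+
  have c: "cell D (F2 f) (F1 (Src D f)) (F1 (Tgt D f))" "cell D (F2 (inv2 D f)) (F1 (Tgt D f)) (F1 (Src D f))"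
    using f F iso2D[OF f] inv2(1-3)[OF f] unfolding strict_2endo_def cell_def by metis+
  then show "F2 f \<in> Cel D" by (simp add: cell_def)
  have "F2 \<guillemotleft>Src D f\<guillemotright> = \<guillemotleft>F1 (Src D f)\<guillemotright>" "F2 \<guillemotleft>Tgt D f\<guillemotright> = \<guillemotleft>F1 (Tgt D f)\<guillemotright>"
    using F f src_tgt(1,2) iso2D[OF f] unfolding strict_2endo_def arr_def by metis+
  then show "inverse2 D (F2 f) (F2 (inv2 D f))"
    using * c f by (simp add: inverse2_def cell_def)
qed

lemma left_whisker [simp]:
  assumes a: "a \<in> Obj D"
  shows "b \<in> Obj D \<Longrightarrow> a \<ltimes> Id1 D b = Id1 D (a \<odot> b)"
    "x \<in> Arr D \<Longrightarrow> a \<ltimes> x \<in> Arr D"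
    "x \<in> Arr D \<Longrightarrow> Dom D (a \<ltimes> x) = a \<odot> Dom D x"
    "x \<in> Arr D \<Longrightarrow> Cod D (a \<ltimes> x) = a \<odot> Cod D x"
    "x \<in> Arr D \<Longrightarrow> a \<ltimes>\<^sub>2 \<guillemotleft>x\<guillemotright> = \<guillemotleft>a \<ltimes> x\<guillemotright>"
    "f \<in> Cel D \<Longrightarrow> a \<ltimes>\<^sub>2 f \<in> Cel D"
    "f \<in> Cel D \<Longrightarrow> Src D (a \<ltimes>\<^sub>2 f) = a \<ltimes> Src D f"
    "f \<in> Cel D \<Longrightarrow> Tgt D (a \<ltimes>\<^sub>2 f) = a \<ltimes> Tgt D f"
    "x \<in> Arr D \<Longrightarrow> y \<in> Arr D \<Longrightarrow> Cod D x = Dom D y \<Longrightarrow> a \<ltimes> (y \<cdot> x) = (a \<ltimes> y) \<cdot> (a \<ltimes> x)"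
    "f \<in> Cel D \<Longrightarrow> g \<in> Cel D \<Longrightarrow> Tgt D f = Src D g \<Longrightarrow> a \<ltimes>\<^sub>2 (g \<bullet> f) = (a \<ltimes>\<^sub>2 g) \<bullet> (a \<ltimes>\<^sub>2 f)"
    "f \<in> Cel D \<Longrightarrow> g \<in> Cel D \<Longrightarrow> Cod D (Src D f) = Dom D (Src D g) \<Longrightarrow> a \<ltimes>\<^sub>2 (g \<star> f) = (a \<ltimes>\<^sub>2 g) \<star> (a \<ltimes>\<^sub>2 f)"
    "iso2 D f \<Longrightarrow> iso2 D (a \<ltimes>\<^sub>2 f)"
  using lw_endo[OF a] strict_2endo_iso2[OF lw_endo[OF a]] unfolding strict_2endo_def arr_def cell_def
  by (elim conjE, simp)+

lemma right_whisker [simp]: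
  assumes a: "a \<in> Obj D"
  shows "b \<in> Obj D \<Longrightarrow> Id1 D b \<rtimes> a = Id1 D (b \<odot> a)"
    "x \<in> Arr D \<Longrightarrow> x \<rtimes> a \<in> Arr D"
    "x \<in> Arr D \<Longrightarrow> Dom D (x \<rtimes> a) = Dom D x \<odot> a"
    "x \<in> Arr D \<Longrightarrow> Cod D (x \<rtimes> a) = Cod D x \<odot> a"
    "x \<in> Arr D \<Longrightarrow> \<guillemotleft>x\<guillemotright> \<rtimes>\<^sub>2 a = \<guillemotleft>x \<rtimes> a\<guillemotright>"
    "f \<in> Cel D \<Longrightarrow> f \<rtimes>\<^sub>2 a \<in> Cel D"
    "f \<in> Cel D \<Longrightarrow> Src D (f \<rtimes>\<^sub>2 a) = Src D f \<rtimes> a"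
    "f \<in> Cel D \<Longrightarrow> Tgt D (f \<rtimes>\<^sub>2 a) = Tgt D f \<rtimes> a"
    "x \<in> Arr D \<Longrightarrow> y \<in> Arr D \<Longrightarrow> Cod D x = Dom D y \<Longrightarrow> (y \<cdot> x) \<rtimes> a = (y \<rtimes> a) \<cdot> (x \<rtimes> a)"
    "f \<in> Cel D \<Longrightarrow> g \<in> Cel D \<Longrightarrow> Tgt D f = Src D g \<Longrightarrow> (g \<bullet> f) \<rtimes>\<^sub>2 a = (g \<rtimes>\<^sub>2 a) \<bullet> (f \<rtimes>\<^sub>2 a)"
    "f \<in> Cel D \<Longrightarrow> g \<in> Cel D \<Longrightarrow> Cod D (Src D f) = Dom D (Src D g) \<Longrightarrow> (g \<star> f) \<rtimes>\<^sub>2 a = (g \<rtimes>\<^sub>2 a) \<star> (f \<rtimes>\<^sub>2 a)"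
    "iso2 D f \<Longrightarrow> iso2 D (f \<rtimes>\<^sub>2 a)"
  using rw_endo[OF a] strict_2endo_iso2[OF rw_endo[OF a]] unfolding strict_2endo_def arr_def cell_def
  by (elim conjE, simp)+

lemma whisker_unit [simp]:
  "x \<in> Arr D \<Longrightarrow> Unt D \<ltimes> x = x" "x \<in> Arr D \<Longrightarrow> x \<rtimes> Unt D = x"
  "f \<in> Cel D \<Longrightarrow> Unt D \<ltimes>\<^sub>2 f = f" "f \<in> Cel D \<Longrightarrow> f \<rtimes>\<^sub>2 Unt D = f"
  using gray(7,8) by simp_all

lemma whisker_assoc [simp]:
  assumes "a \<in> Obj D" "b \<in> Obj D"
  shows "x \<in> Arr D \<Longrightarrow> (a \<odot> b) \<ltimes> x = a \<ltimes> (b \<ltimes> x)"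
    "x \<in> Arr D \<Longrightarrow> (a \<ltimes> x) \<rtimes> b = a \<ltimes> (x \<rtimes> b)"
    "x \<in> Arr D \<Longrightarrow> (x \<rtimes> a) \<rtimes> b = x \<rtimes> (a \<odot> b)"
    "f \<in> Cel D \<Longrightarrow> (a \<odot> b) \<ltimes>\<^sub>2 f = a \<ltimes>\<^sub>2 (b \<ltimes>\<^sub>2 f)"
    "f \<in> Cel D \<Longrightarrow> (a \<ltimes>\<^sub>2 f) \<rtimes>\<^sub>2 b = a \<ltimes>\<^sub>2 (f \<rtimes>\<^sub>2 b)"
    "f \<in> Cel D \<Longrightarrow> (f \<rtimes>\<^sub>2 a) \<rtimes>\<^sub>2 b = f \<rtimes>\<^sub>2 (a \<odot> b)"
  using gray(9,10) assms by simp_all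

lemma interchanger [simp]:
  assumes "x \<in> Arr D" "y \<in> Arr D"
  shows "iso2 D (Ich D x y)"
    "Src D (Ich D x y) = (x \<rtimes> Cod D y) \<cdot> (Dom D x \<ltimes> y)"
    "Tgt D (Ich D x y) = (Cod D x \<ltimes> y) \<cdot> (x \<rtimes> Dom D y)"
  using gray(11) assms by (simp_all add: icell_iff)

lemma interchanger_id [simp]:
  assumes "x \<in> Arr D" "c \<in> Obj D"
  shows "Ich D x (Id1 D c) = \<guillemotleft>x \<rtimes> c\<guillemotright>" "Ich D (Id1 D c) x = \<guillemotleft>c \<ltimes> x\<guillemotright>"
  using gray(12) assms by simp_all

lemma ten1 [simp]:
  assumes "x \<in> Arr D" "y \<in> Arr D"
  shows "x \<boxtimes> y \<in> Arr D" "Dom D (x \<boxtimes> y) = Dom D x \<odot> Dom D y" "Cod D (x \<boxtimes> y) = Cod D x \<odot> Cod D y"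
  using assms by (simp_all add: ten1_def)

lemma ten2 [simp]:
  assumes "f \<in> Cel D" "g \<in> Cel D"
  shows "f \<boxtimes>\<^sub>2 g \<in> Cel D" "Src D (f \<boxtimes>\<^sub>2 g) = Src D f \<boxtimes> Src D g" "Tgt D (f \<boxtimes>\<^sub>2 g) = Tgt D f \<boxtimes> Tgt D g"
    "iso2 D f \<Longrightarrow> iso2 D g \<Longrightarrow> iso2 D (f \<boxtimes>\<^sub>2 g)"
  using assms by (simp_all add: ten1_def ten2_def)

lemma ten1_id [simp]:
  assumes "a \<in> Obj D" "b \<in> Obj D"
  shows "Id1 D a \<boxtimes> Id1 D b = Id1 D (a \<odot> b)"
  using assms by (simp add: ten1_def)

lemma ten1_unit [simp]:
  assumes "x \<in> Arr D"
  shows "Id1 D (Unt D) \<boxtimes> x = x" "x \<boxtimes> Id1 D (Unt D) = x"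
  using assms by (simp_all add: ten1_def)

lemma ten1_assoc [simp]:
  assumes "x \<in> Arr D" "y \<in> Arr D" "z \<in> Arr D"
  shows "(x \<boxtimes> y) \<boxtimes> z = x \<boxtimes> (y \<boxtimes> z)"
  using assms by (simp add: ten1_def)

lemma ten2_id [simp]:
  assumes "x \<in> Arr D" "y \<in> Arr D"
  shows "\<guillemotleft>x\<guillemotright> \<boxtimes>\<^sub>2 \<guillemotleft>y\<guillemotright> = \<guillemotleft>x \<boxtimes> y\<guillemotright>"
  using assms by (simp add: ten1_def ten2_def)

lemma ten2_vcmp:
  assumes "f \<in> Cel D" "g \<in> Cel D" "f' \<in> Cel D" "g' \<in> Cel D" "Tgt D f = Src D f'" "Tgt D g = Src D g'"
  shows "(f' \<bullet> f) \<boxtimes>\<^sub>2 (g' \<bullet> g) = (f' \<boxtimes>\<^sub>2 g') \<bullet> (f \<boxtimes>\<^sub>2 g)"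
proof -
  have "Dom D (Src D f) = Dom D (Src D f')" "Cod D (Src D g) = Cod D (Src D g')"
    using assms by (metis src_tgt(3,4))+
  then show ?thesis using assms by (simp add: ten2_def interchange)
qed

lemma ten2_vcmp_id:
  assumes "f \<in> Cel D" "g \<in> Cel D" "Tgt D f = Src D g" "x \<in> Arr D"
  shows "(g \<bullet> f) \<boxtimes>\<^sub>2 \<guillemotleft>x\<guillemotright> = (g \<boxtimes>\<^sub>2 \<guillemotleft>x\<guillemotright>) \<bullet> (f \<boxtimes>\<^sub>2 \<guillemotleft>x\<guillemotright>)"
    "\<guillemotleft>x\<guillemotright> \<boxtimes>\<^sub>2 (g \<bullet> f) = (\<guillemotleft>x\<guillemotright> \<boxtimes>\<^sub>2 g) \<bullet> (\<guillemotleft>x\<guillemotright> \<boxtimes>\<^sub>2 f)"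
  using ten2_vcmp[of "\<guillemotleft>x\<guillemotright>" f "\<guillemotleft>x\<guillemotright>" g] ten2_vcmp[of f "\<guillemotleft>x\<guillemotright>" g "\<guillemotleft>x\<guillemotright>"] assms by simp_all

lemma inv2_ten2:
  assumes "iso2 D f" "iso2 D g"
  shows "inv2 D (f \<boxtimes>\<^sub>2 g) = inv2 D f \<boxtimes>\<^sub>2 inv2 D g"
  by (rule inv2_eqI) (use assms in \<open>simp_all add: inverse2_def cell_def ten2_vcmp[symmetric]\<close>)

text \<open>The order of whiskerings in which \<open>f \<boxtimes>\<^sub>2 g\<close> appears in the pasting for \<open>\<eta>\<^sup>2\<close>.\<close>

lemma ten2_split:
  assumes "f \<in> Cel D" "g \<in> Cel D" "Src D f = x" "Dom D x = a" "Src D g = y" "Cod D y = d"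
  shows "(\<guillemotleft>Tgt D f \<rtimes> d\<guillemotright> \<star> (a \<ltimes>\<^sub>2 g)) \<bullet> ((f \<rtimes>\<^sub>2 d) \<star> \<guillemotleft>a \<ltimes> y\<guillemotright>) = f \<boxtimes>\<^sub>2 g"
  using assms hcmp_split(1)[of "a \<ltimes>\<^sub>2 g" "f \<rtimes>\<^sub>2 d"] by (auto simp: ten2_def)

lemma cub [simp]:
  assumes "x \<in> Arr D" "y \<in> Arr D" "x' \<in> Arr D" "y' \<in> Arr D" "Cod D x = Dom D x'" "Cod D y = Dom D y'"
  shows "cub D x' y' x y \<in> Cel D" "Src D (cub D x' y' x y) = (x' \<boxtimes> y') \<cdot> (x \<boxtimes> y)"
    "Tgt D (cub D x' y' x y) = (x' \<cdot> x) \<boxtimes> (y' \<cdot> y)"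
  using assms by (simp_all add: cub_def ten1_def)

end

section \<open>Normalised 3-functors are monoidal pseudofunctors\<close>

lemma idadj_simps [simp]:
  "lf (idadj D a) = Id1 D a" "rt (idadj D a) = Id1 D a"
  "au (idadj D a) = \<guillemotleft>Id1 D a\<guillemotright>\<^bsub>D\<^esub>" "ac (idadj D a) = \<guillemotleft>Id1 D a\<guillemotright>\<^bsub>D\<^esub>"
  by (simp_all add: idadj_def)

locale pseudofun = C: gray_mon C + D: gray_mon D
  for C :: "('o,'m,'t,'y) gray_scheme" and D :: "('p,'n,'u,'z) gray_scheme" +
  fixes A :: "('o,'m,'t,'p,'n,'u) threefun"
  assumes pf: "pseudofunctor C D A"
begin

lemmas pf_unfolded = pf[unfolded pseudofunctor_def arr_def cell_def icell_iff]
lemmas pfun_tail1 = conjunct2[OF pf_unfolded]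
lemmas pfun_tail2 = conjunct2[OF pfun_tail1]
lemmas pfun_tail3 = conjunct2[OF pfun_tail2]
lemmas pfun_tail4 = conjunct2[OF pfun_tail3]
lemmas pfun_tail5 = conjunct2[OF pfun_tail4]
lemmas pfun_tail6 = conjunct2[OF pfun_tail5]
lemmas pfun_tail7 = conjunct2[OF pfun_tail6]
lemmas pfun_tail8 = conjunct2[OF pfun_tail7]
lemmas pfun_tail9 = conjunct2[OF pfun_tail8]
lemmas pfun_tail10 = conjunct2[OF pfun_tail9]
lemmas pfun_tail11 = conjunct2[OF pfun_tail10]
lemmas pfun_tail12 = conjunct2[OF pfun_tail11]
lemmas pfun_tail13 = conjunct2[OF pfun_tail12]
lemmas pfun = conjunct1[OF pf_unfolded] conjunct1[OF pfun_tail1] conjunct1[OF pfun_tail2]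
  conjunct1[OF pfun_tail3] conjunct1[OF pfun_tail4] conjunct1[OF pfun_tail5]
  conjunct1[OF pfun_tail6] conjunct1[OF pfun_tail7] conjunct1[OF pfun_tail8]
  conjunct1[OF pfun_tail9] conjunct1[OF pfun_tail10] conjunct1[OF pfun_tail11]
  conjunct1[OF pfun_tail12] pfun_tail13

lemma fo [simp]: "a \<in> Obj C \<Longrightarrow> fo A a \<in> Obj D"
  using pfun(6) by simp

lemma fm [simp]:
  assumes "x \<in> Arr C"
  shows "fm A x \<in> Arr D" "Dom D (fm A x) = fo A (Dom C x)" "Cod D (fm A x) = fo A (Cod C x)"
    "fc A \<guillemotleft>x\<guillemotright>\<^bsub>C\<^esub> = \<guillemotleft>fm A x\<guillemotright>\<^bsub>D\<^esub>"
  using pfun(7) assms by simp_all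

lemma fc [simp]:
  assumes "f \<in> Cel C"
  shows "fc A f \<in> Cel D" "Src D (fc A f) = fm A (Src C f)" "Tgt D (fc A f) = fm A (Tgt C f)"
  using pfun(8) assms by simp_all

lemma fc_vcmp:
  assumes "f \<in> Cel C" "g \<in> Cel C" "Tgt C f = Src C g"
  shows "fc A (g \<bullet>\<^bsub>C\<^esub> f) = fc A g \<bullet>\<^bsub>D\<^esub> fc A f"
  using pfun(9) assms by simp

lemma fc_iso2 [simp]:
  assumes "iso2 C f"
  shows "iso2 D (fc A f)"
proof (rule D.inv2_eqI(2)[of _ "fc A (inv2 C f)"])
  show "inverse2 D (fc A f) (fc A (inv2 C f))"
    using assms by (simp add: inverse2_def cell_def fc_vcmp[symmetric])
qed (use assms in simp)

lemma fu [simp]: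
  assumes "a \<in> Obj C"
  shows "iso2 D (fu A a)" "Src D (fu A a) = Id1 D (fo A a)" "Tgt D (fu A a) = fm A (Id1 C a)"
  using pfun(10) assms by simp_all

lemma fp [simp]:
  assumes "x \<in> Arr C" "y \<in> Arr C" "Cod C x = Dom C y"
  shows "iso2 D (fp A (y, x))" "Src D (fp A (y, x)) = fm A y \<cdot>\<^bsub>D\<^esub> fm A x"
    "Tgt D (fp A (y, x)) = fm A (y \<cdot>\<^bsub>C\<^esub> x)"
  using pfun(11) assms by simp_all

lemma fp_natural:
  assumes "f \<in> Cel C" "g \<in> Cel C" "Cod C (Src C f) = Dom C (Src C g)"
    "Src C g = y" "Src C f = x"
  shows "fc A (g \<star>\<^bsub>C\<^esub> f) \<bullet>\<^bsub>D\<^esub> fp A (y, x) = fp A (Tgt C g, Tgt C f) \<bullet>\<^bsub>D\<^esub> (fc A g \<star>\<^bsub>D\<^esub> fc A f)"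
  using pfun(12) assms by blast

lemma fp_assoc:
  assumes "x \<in> Arr C" "y \<in> Arr C" "z \<in> Arr C" "Cod C x = Dom C y" "Cod C y = Dom C z"
  shows "fp A (z \<cdot>\<^bsub>C\<^esub> y, x) \<bullet>\<^bsub>D\<^esub> (fp A (z, y) \<star>\<^bsub>D\<^esub> \<guillemotleft>fm A x\<guillemotright>\<^bsub>D\<^esub>)
    = fp A (z, y \<cdot>\<^bsub>C\<^esub> x) \<bullet>\<^bsub>D\<^esub> (\<guillemotleft>fm A z\<guillemotright>\<^bsub>D\<^esub> \<star>\<^bsub>D\<^esub> fp A (y, x))"
  using pfun(13) assms by simp

lemma fp_unit:
  assumes "x \<in> Arr C"
  shows "Dom C x = a \<Longrightarrow> fp A (x, Id1 C a) \<bullet>\<^bsub>D\<^esub> (\<guillemotleft>fm A x\<guillemotright>\<^bsub>D\<^esub> \<star>\<^bsub>D\<^esub> fu A a) = \<guillemotleft>fm A x\<guillemotright>\<^bsub>D\<^esub>"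
    "Cod C x = a \<Longrightarrow> fp A (Id1 C a, x) \<bullet>\<^bsub>D\<^esub> (fu A a \<star>\<^bsub>D\<^esub> \<guillemotleft>fm A x\<guillemotright>\<^bsub>D\<^esub>) = \<guillemotleft>fm A x\<guillemotright>\<^bsub>D\<^esub>"
  using pfun(14) assms by auto

text \<open>Together with the unit axiom of \<open>\<mu>\<close>, this multiplicativity of the unit constraint is what makes
  the family \<open>A\<^sup>1\<close> a transformation out of \<open>\<pi>\<close>.\<close>

lemma fp_fu_fu:
  assumes "a \<in> Obj C"
  shows "fp A (Id1 C a, Id1 C a) \<bullet>\<^bsub>D\<^esub> (fu A a \<star>\<^bsub>D\<^esub> fu A a) = fu A a"
proof -
  have "fp A (Id1 C a, Id1 C a) \<bullet>\<^bsub>D\<^esub> (fu A a \<star>\<^bsub>D\<^esub> fu A a)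
    = fp A (Id1 C a, Id1 C a) \<bullet>\<^bsub>D\<^esub> ((\<guillemotleft>fm A (Id1 C a)\<guillemotright>\<^bsub>D\<^esub> \<star>\<^bsub>D\<^esub> fu A a) \<bullet>\<^bsub>D\<^esub> (fu A a \<star>\<^bsub>D\<^esub> \<guillemotleft>Id1 D (fo A a)\<guillemotright>\<^bsub>D\<^esub>))"
    using D.hcmp_split(1)[of "fu A a" "fu A a"] assms by simp
  also have "\<dots> = (fp A (Id1 C a, Id1 C a) \<bullet>\<^bsub>D\<^esub> (\<guillemotleft>fm A (Id1 C a)\<guillemotright>\<^bsub>D\<^esub> \<star>\<^bsub>D\<^esub> fu A a)) \<bullet>\<^bsub>D\<^esub> fu A a"
    using assms by simp
  also have "\<dots> = fu A a"
    using assms by (subst fp_unit(1)) simp_all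
  finally show ?thesis .
qed

end

text \<open>A pseudofunctor with the data of a normalised 3-functor, before any axiom on \<open>\<mu>\<close> is imposed.
  The labelling by \<open>G\<close> is replaced by multiplicativity on 0-cells, so that one notion covers
  \<open>\<pi>\<close>, 3-functors between labelled Gray-monoids and their composites.\<close>

locale norm_data = pseudofun C D A
  for C :: "('o,'m,'t,'y) gray_scheme" and D :: "('p,'n,'u,'z) gray_scheme"
    and A :: "('o,'m,'t,'p,'n,'u) threefun" +
  assumes fo_unt [simp]: "fo A (Unt C) = Unt D"
    and fo_ten [simp]: "\<And>a b. a \<in> Obj C \<Longrightarrow> b \<in> Obj C \<Longrightarrow> fo A (a \<odot>\<^bsub>C\<^esub> b) = fo A a \<odot>\<^bsub>D\<^esub> fo A b"
    and mu_eq: "mu A = (\<lambda>(a, b) \<in> Obj C \<times> Obj C. idadj D (fo A a \<odot>\<^bsub>D\<^esub> fo A b))"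
    and io_eq: "io A = idadj D (Unt D)"
    and im_eq: "im A = fu A (Unt C)"
    and om_eq: "om A = (\<lambda>(a, b, c) \<in> Obj C \<times> Obj C \<times> Obj C. \<guillemotleft>Id1 D (fo A a \<odot>\<^bsub>D\<^esub> fo A b \<odot>\<^bsub>D\<^esub> fo A c)\<guillemotright>\<^bsub>D\<^esub>)"
    and el_eq: "el A = (\<lambda>a \<in> Obj C. \<guillemotleft>Id1 D (fo A a)\<guillemotright>\<^bsub>D\<^esub>)"
    and ar_eq: "ar A = (\<lambda>a \<in> Obj C. \<guillemotleft>Id1 D (fo A a)\<guillemotright>\<^bsub>D\<^esub>)"
    and mm [simp]: "\<And>x y. x \<in> Arr C \<Longrightarrow> y \<in> Arr C \<Longrightarrow> iso2 D (mm A (x, y))"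
      "\<And>x y. x \<in> Arr C \<Longrightarrow> y \<in> Arr C \<Longrightarrow> Src D (mm A (x, y)) = fm A x \<boxtimes>\<^bsub>D\<^esub> fm A y"
      "\<And>x y. x \<in> Arr C \<Longrightarrow> y \<in> Arr C \<Longrightarrow> Tgt D (mm A (x, y)) = fm A (x \<boxtimes>\<^bsub>C\<^esub> y)"
begin

lemma data [simp]:
  "a \<in> Obj C \<Longrightarrow> b \<in> Obj C \<Longrightarrow> mu A (a, b) = idadj D (fo A a \<odot>\<^bsub>D\<^esub> fo A b)"
  "io A = idadj D (Unt D)"
  "im A = fu A (Unt C)"
  "a \<in> Obj C \<Longrightarrow> b \<in> Obj C \<Longrightarrow> c \<in> Obj C \<Longrightarrow> om A (a, b, c) = \<guillemotleft>Id1 D (fo A a \<odot>\<^bsub>D\<^esub> fo A b \<odot>\<^bsub>D\<^esub> fo A c)\<guillemotright>\<^bsub>D\<^esub>"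
  "a \<in> Obj C \<Longrightarrow> el A a = \<guillemotleft>Id1 D (fo A a)\<guillemotright>\<^bsub>D\<^esub>"
  "a \<in> Obj C \<Longrightarrow> ar A a = \<guillemotleft>Id1 D (fo A a)\<guillemotright>\<^bsub>D\<^esub>"
  by (simp_all add: mu_eq io_eq im_eq om_eq el_eq ar_eq idadj_def)

text \<open>With \<open>\<mu>\<close> and \<open>\<iota>\<close> identities the whiskerings in the pseudonaturality axioms become trivial, and
  the two remaining factors \<open>\<mu>\<^sub>x\<^sub>,\<^sub>y\<close> in the composition axiom merge into a horizontal composite.\<close>

lemma mult_iota_iff:
  "mult_iota C D A \<longleftrightarrow> mm A \<in> extensional (Arr C \<times> Arr C)
   \<and> (\<forall>f \<in> Cel C. \<forall>g \<in> Cel C. fc A (f \<boxtimes>\<^sub>2\<^bsub>C\<^esub> g) \<bullet>\<^bsub>D\<^esub> mm A (Src C f, Src C g)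
        = mm A (Tgt C f, Tgt C g) \<bullet>\<^bsub>D\<^esub> (fc A f \<boxtimes>\<^sub>2\<^bsub>D\<^esub> fc A g))
   \<and> (\<forall>x \<in> Arr C. \<forall>x' \<in> Arr C. Dom C x' = Cod C x \<longrightarrow> (\<forall>y \<in> Arr C. \<forall>y' \<in> Arr C. Dom C y' = Cod C y \<longrightarrow>
        fc A (cub C x' y' x y) \<bullet>\<^bsub>D\<^esub> fp A (x' \<boxtimes>\<^bsub>C\<^esub> y', x \<boxtimes>\<^bsub>C\<^esub> y) \<bullet>\<^bsub>D\<^esub> (mm A (x', y') \<star>\<^bsub>D\<^esub> mm A (x, y))
        = mm A (x' \<cdot>\<^bsub>C\<^esub> x, y' \<cdot>\<^bsub>C\<^esub> y) \<bullet>\<^bsub>D\<^esub> (fp A (x', x) \<boxtimes>\<^sub>2\<^bsub>D\<^esub> fp A (y', y)) \<bullet>\<^bsub>D\<^esub> cub D (fm A x') (fm A y') (fm A x) (fm A y)))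
   \<and> (\<forall>a \<in> Obj C. \<forall>b \<in> Obj C. mm A (Id1 C a, Id1 C b) \<bullet>\<^bsub>D\<^esub> (fu A a \<boxtimes>\<^sub>2\<^bsub>D\<^esub> fu A b) = fu A (a \<odot>\<^bsub>C\<^esub> b))"
  (is "_ \<longleftrightarrow> ?ext \<and> ?nat \<and> ?cmp \<and> ?unit")
proof -
  have split: "(\<guillemotleft>fm A (x' \<boxtimes>\<^bsub>C\<^esub> y')\<guillemotright>\<^bsub>D\<^esub> \<star>\<^bsub>D\<^esub> mm A (x, y)) \<bullet>\<^bsub>D\<^esub> (mm A (x', y') \<star>\<^bsub>D\<^esub> \<guillemotleft>fm A x \<boxtimes>\<^bsub>D\<^esub> fm A y\<guillemotright>\<^bsub>D\<^esub>)
     = mm A (x', y') \<star>\<^bsub>D\<^esub> mm A (x, y)"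
    if "x \<in> Arr C" "y \<in> Arr C" "x' \<in> Arr C" "y' \<in> Arr C" "Cod C x = Dom C x'" "Cod C y = Dom C y'" for x y x' y'
    using D.hcmp_split(1)[of "mm A (x, y)" "mm A (x', y')"] that by simp
  have nat: "(\<forall>f x x' a c g y y' b d. cell C f x x' \<longrightarrow> cell C g y y' \<longrightarrow> arr C x a c \<longrightarrow> arr C y b d \<longrightarrow>
        (fc A (f \<boxtimes>\<^sub>2\<^bsub>C\<^esub> g) \<star>\<^bsub>D\<^esub> \<guillemotleft>mu1 A a b\<guillemotright>\<^bsub>D\<^esub>) \<bullet>\<^bsub>D\<^esub> mm A (x, y)
          = mm A (x', y') \<bullet>\<^bsub>D\<^esub> (\<guillemotleft>mu1 A c d\<guillemotright>\<^bsub>D\<^esub> \<star>\<^bsub>D\<^esub> (fc A f \<boxtimes>\<^sub>2\<^bsub>D\<^esub> fc A g))) \<longleftrightarrow> ?nat"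
    by (simp add: arr_def cell_def Ball_def cong: imp_cong)
  have cmp: "(\<forall>x a c x' e y b d y' h. arr C x a c \<longrightarrow> arr C x' c e \<longrightarrow> arr C y b d \<longrightarrow> arr C y' d h \<longrightarrow>
        ((fc A (cub C x' y' x y) \<bullet>\<^bsub>D\<^esub> fp A (x' \<boxtimes>\<^bsub>C\<^esub> y', x \<boxtimes>\<^bsub>C\<^esub> y)) \<star>\<^bsub>D\<^esub> \<guillemotleft>mu1 A a b\<guillemotright>\<^bsub>D\<^esub>)
          \<bullet>\<^bsub>D\<^esub> (\<guillemotleft>fm A (x' \<boxtimes>\<^bsub>C\<^esub> y')\<guillemotright>\<^bsub>D\<^esub> \<star>\<^bsub>D\<^esub> mm A (x, y))
          \<bullet>\<^bsub>D\<^esub> (mm A (x', y') \<star>\<^bsub>D\<^esub> \<guillemotleft>fm A x \<boxtimes>\<^bsub>D\<^esub> fm A y\<guillemotright>\<^bsub>D\<^esub>)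
        = mm A (x' \<cdot>\<^bsub>C\<^esub> x, y' \<cdot>\<^bsub>C\<^esub> y)
          \<bullet>\<^bsub>D\<^esub> (\<guillemotleft>mu1 A e h\<guillemotright>\<^bsub>D\<^esub> \<star>\<^bsub>D\<^esub> ((fp A (x', x) \<boxtimes>\<^sub>2\<^bsub>D\<^esub> fp A (y', y)) \<bullet>\<^bsub>D\<^esub> cub D (fm A x') (fm A y') (fm A x) (fm A y)))) \<longleftrightarrow> ?cmp"
    by (simp add: arr_def split Ball_def imp_conjL cong: imp_cong)
  show ?thesis
    unfolding mult_iota_def nat cmp
    by (simp add: mu_eq adj_equiv_def icell_iff arr_def io_eq im_eq cong: imp_cong)
qed

text \<open>Interchangers with an identity are identities, so the modification axioms for \<open>\<omega>\<close>, \<open>\<ell>\<close> and \<open>r\<close> turn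
  into associativity and unitality of the 2-cells of \<open>\<mu>\<close>.\<close>

lemma assoc_unitors_iff:
  "assoc_unitors C D A \<longleftrightarrow>
     (\<forall>x \<in> Arr C. \<forall>y \<in> Arr C. \<forall>z \<in> Arr C.
        mm A (x \<boxtimes>\<^bsub>C\<^esub> y, z) \<bullet>\<^bsub>D\<^esub> (mm A (x, y) \<boxtimes>\<^sub>2\<^bsub>D\<^esub> \<guillemotleft>fm A z\<guillemotright>\<^bsub>D\<^esub>)
        = mm A (x, y \<boxtimes>\<^bsub>C\<^esub> z) \<bullet>\<^bsub>D\<^esub> (\<guillemotleft>fm A x\<guillemotright>\<^bsub>D\<^esub> \<boxtimes>\<^sub>2\<^bsub>D\<^esub> mm A (y, z)))
   \<and> (\<forall>x \<in> Arr C. mm A (Id1 C (Unt C), x) \<bullet>\<^bsub>D\<^esub> (fu A (Unt C) \<boxtimes>\<^sub>2\<^bsub>D\<^esub> \<guillemotleft>fm A x\<guillemotright>\<^bsub>D\<^esub>) = \<guillemotleft>fm A x\<guillemotright>\<^bsub>D\<^esub>)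
   \<and> (\<forall>x \<in> Arr C. mm A (x, Id1 C (Unt C)) \<bullet>\<^bsub>D\<^esub> (\<guillemotleft>fm A x\<guillemotright>\<^bsub>D\<^esub> \<boxtimes>\<^sub>2\<^bsub>D\<^esub> fu A (Unt C)) = \<guillemotleft>fm A x\<guillemotright>\<^bsub>D\<^esub>)"
  unfolding assoc_unitors_def
  by (simp add: icell_iff arr_def om_eq el_eq ar_eq Ball_def imp_conjL ten2_def ten1_def[of D] cong: imp_cong conj_cong)

text \<open>Every 2-cell in the two trihomomorphism axioms is an identity.\<close>

lemma threefun_axioms: "threefun_axioms C D A"
  unfolding threefun_axioms_def by simp

end

text \<open>Monoidal pseudofunctors: the reduced form of normalised 3-functors.\<close>

locale mon_fun = norm_data C D A
  for C :: "('o,'m,'t,'y) gray_scheme" and D :: "('p,'n,'u,'z) gray_scheme"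
    and A :: "('o,'m,'t,'p,'n,'u) threefun" +
  assumes mm_ext: "mm A \<in> extensional (Arr C \<times> Arr C)"
    and mm_natural: "\<lbrakk>f \<in> Cel C; g \<in> Cel C\<rbrakk> \<Longrightarrow>
      fc A (f \<boxtimes>\<^sub>2\<^bsub>C\<^esub> g) \<bullet>\<^bsub>D\<^esub> mm A (Src C f, Src C g) = mm A (Tgt C f, Tgt C g) \<bullet>\<^bsub>D\<^esub> (fc A f \<boxtimes>\<^sub>2\<^bsub>D\<^esub> fc A g)"
    and mm_comp: "\<lbrakk>x \<in> Arr C; x' \<in> Arr C; Dom C x' = Cod C x; y \<in> Arr C; y' \<in> Arr C; Dom C y' = Cod C y\<rbrakk> \<Longrightarrow>
      fc A (cub C x' y' x y) \<bullet>\<^bsub>D\<^esub> fp A (x' \<boxtimes>\<^bsub>C\<^esub> y', x \<boxtimes>\<^bsub>C\<^esub> y) \<bullet>\<^bsub>D\<^esub> (mm A (x', y') \<star>\<^bsub>D\<^esub> mm A (x, y))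
      = mm A (x' \<cdot>\<^bsub>C\<^esub> x, y' \<cdot>\<^bsub>C\<^esub> y) \<bullet>\<^bsub>D\<^esub> (fp A (x', x) \<boxtimes>\<^sub>2\<^bsub>D\<^esub> fp A (y', y)) \<bullet>\<^bsub>D\<^esub> cub D (fm A x') (fm A y') (fm A x) (fm A y)"
    and mm_fu: "\<lbrakk>a \<in> Obj C; b \<in> Obj C\<rbrakk> \<Longrightarrow>
      mm A (Id1 C a, Id1 C b) \<bullet>\<^bsub>D\<^esub> (fu A a \<boxtimes>\<^sub>2\<^bsub>D\<^esub> fu A b) = fu A (a \<odot>\<^bsub>C\<^esub> b)"
    and mm_assoc: "\<lbrakk>x \<in> Arr C; y \<in> Arr C; z \<in> Arr C\<rbrakk> \<Longrightarrow>
      mm A (x \<boxtimes>\<^bsub>C\<^esub> y, z) \<bullet>\<^bsub>D\<^esub> (mm A (x, y) \<boxtimes>\<^sub>2\<^bsub>D\<^esub> \<guillemotleft>fm A z\<guillemotright>\<^bsub>D\<^esub>)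
      = mm A (x, y \<boxtimes>\<^bsub>C\<^esub> z) \<bullet>\<^bsub>D\<^esub> (\<guillemotleft>fm A x\<guillemotright>\<^bsub>D\<^esub> \<boxtimes>\<^sub>2\<^bsub>D\<^esub> mm A (y, z))"
    and mm_unit_left: "x \<in> Arr C \<Longrightarrow>
      mm A (Id1 C (Unt C), x) \<bullet>\<^bsub>D\<^esub> (fu A (Unt C) \<boxtimes>\<^sub>2\<^bsub>D\<^esub> \<guillemotleft>fm A x\<guillemotright>\<^bsub>D\<^esub>) = \<guillemotleft>fm A x\<guillemotright>\<^bsub>D\<^esub>"
    and mm_unit_right: "x \<in> Arr C \<Longrightarrow>
      mm A (x, Id1 C (Unt C)) \<bullet>\<^bsub>D\<^esub> (\<guillemotleft>fm A x\<guillemotright>\<^bsub>D\<^esub> \<boxtimes>\<^sub>2\<^bsub>D\<^esub> fu A (Unt C)) = \<guillemotleft>fm A x\<guillemotright>\<^bsub>D\<^esub>"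

lemma (in norm_data) three_functor_iff: "three_functor C D A \<longleftrightarrow> mon_fun C D A"
proof -
  have "mon_fun C D A \<longleftrightarrow> mon_fun_axioms C D A"
    by (simp add: mon_fun_def norm_data_axioms)
  also have "\<dots> \<longleftrightarrow> mult_iota C D A \<and> assoc_unitors C D A"
    unfolding mon_fun_axioms_def mult_iota_iff assoc_unitors_iff by blast
  finally show ?thesis
    by (simp add: three_functor_def pf threefun_axioms)
qed

locale labelled = group G + gray_mon C
  for G :: "('g, 'w) monoid_scheme" (structure) and C :: "('o,'m,'t,'y) gray_scheme" +
  fixes c :: "'g \<Rightarrow> 'o"
  assumes lab_bij: "bij_betw c (carrier G) (Obj C)"
    and lab_mult: "\<lbrakk>g \<in> carrier G; h \<in> carrier G\<rbrakk> \<Longrightarrow> c (g \<otimes> h) = c g \<odot>\<^bsub>C\<^esub> c h"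
begin

lemma lab_obj [simp]: "g \<in> carrier G \<Longrightarrow> c g \<in> Obj C"
  using lab_bij by (auto simp: bij_betw_def)

lemma lab_cases:
  assumes "a \<in> Obj C"
  obtains g where "g \<in> carrier G" "a = c g"
  using assms lab_bij by (auto simp: bij_betw_def)

text \<open>The unit 0-cell has a label \<open>u\<close>, and \<open>c \<one> = c \<one> \<odot> c u = c (\<one> \<otimes> u) = c u\<close>.\<close>

lemma lab_one: "c \<one> = Unt C"
proof -
  obtain u where u: "u \<in> carrier G" "Unt C = c u"
    using lab_cases[OF unt(1)] .
  have "c (\<one> \<otimes> u) = c \<one> \<odot>\<^bsub>C\<^esub> c u" using u by (intro lab_mult) simp_all
  also have "\<dots> = c \<one>" using u(2) by (metis lab_obj one_closed unt(3))
  finally show ?thesis using u by simp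
qed

end

text \<open>On labelled Gray-monoids the condition \<open>A(g\<^sub>C) = g\<^sub>D\<close> forces multiplicativity on 0-cells, and since
  every 0-cell has a label the prescribed values determine \<open>\<mu>\<close>, \<open>\<omega>\<close>, \<open>\<ell>\<close> and \<open>r\<close> everywhere.\<close>

lemma normal_functor_iff:
  assumes "labelled G C c" "labelled G D d"
  shows "normal_functor G c d C D A \<longleftrightarrow> mon_fun C D A \<and> (\<forall>g \<in> carrier G. fo A (c g) = d g)"
proof -
  interpret C: labelled G C c by fact
  interpret D: labelled G D d by fact
  show ?thesis
  proof (intro iffI conjI)
    assume n: "normal_functor G c d C D A"
    then show lab: "\<forall>g \<in> carrier G. fo A (c g) = d g" by (simp add: normal_functor_def)
    have t: "three_functor C D A" and m: "mult_iota C D A" and a: "assoc_unitors C D A"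
      using n by (simp_all add: normal_functor_def three_functor_def)
    interpret pseudofun C D A
      using t by unfold_locales (simp add: three_functor_def)
    have mult: "fo A (a \<odot>\<^bsub>C\<^esub> b) = fo A a \<odot>\<^bsub>D\<^esub> fo A b" if "a \<in> Obj C" "b \<in> Obj C" for a b
      using that by (elim C.lab_cases) (simp add: C.lab_mult[symmetric] D.lab_mult[symmetric] lab)
    have mu: "mu A (a, b) = idadj D (fo A a \<odot>\<^bsub>D\<^esub> fo A b)" if "a \<in> Obj C" "b \<in> Obj C" for a b
      using that n by (elim C.lab_cases) (simp add: normal_functor_def D.lab_mult[symmetric])
    have om: "om A (a, b, c) = \<guillemotleft>Id1 D (fo A a \<odot>\<^bsub>D\<^esub> fo A b \<odot>\<^bsub>D\<^esub> fo A c)\<guillemotright>\<^bsub>D\<^esub>"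
      if "a \<in> Obj C" "b \<in> Obj C" "c \<in> Obj C" for a b c
      using that n by (elim C.lab_cases) (simp add: normal_functor_def D.lab_mult)
    have u: "el A a = \<guillemotleft>Id1 D (fo A a)\<guillemotright>\<^bsub>D\<^esub>" "ar A a = \<guillemotleft>Id1 D (fo A a)\<guillemotright>\<^bsub>D\<^esub>" if "a \<in> Obj C" for a
      using that n by (elim C.lab_cases; simp add: normal_functor_def)+
    have mm: "iso2 D (mm A (x, y))" "Src D (mm A (x, y)) = fm A x \<boxtimes>\<^bsub>D\<^esub> fm A y" "Tgt D (mm A (x, y)) = fm A (x \<boxtimes>\<^bsub>C\<^esub> y)"
      if "x \<in> Arr C" "y \<in> Arr C" for x y
    proof -
      have "icell D (mm A (x, y)) (mu1 A (Cod C x) (Cod C y) \<cdot>\<^bsub>D\<^esub> (fm A x \<boxtimes>\<^bsub>D\<^esub> fm A y))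
          (fm A (x \<boxtimes>\<^bsub>C\<^esub> y) \<cdot>\<^bsub>D\<^esub> mu1 A (Dom C x) (Dom C y))"
        using m[unfolded mult_iota_def, THEN conjunct2, THEN conjunct2, THEN conjunct2, THEN conjunct1] that
        unfolding arr_def by blast
      then show "iso2 D (mm A (x, y))" "Src D (mm A (x, y)) = fm A x \<boxtimes>\<^bsub>D\<^esub> fm A y" "Tgt D (mm A (x, y)) = fm A (x \<boxtimes>\<^bsub>C\<^esub> y)"
        using that by (simp_all add: icell_iff mu mult)
    qed
    interpret norm_data C D A
    proof
      show "fo A (Unt C) = Unt D"
        using lab by (metis C.lab_one D.lab_one C.one_closed)
      show "mu A = (\<lambda>(a, b) \<in> Obj C \<times> Obj C. idadj D (fo A a \<odot>\<^bsub>D\<^esub> fo A b))"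
        by (rule extensionalityI[of _ "Obj C \<times> Obj C"]) (use m in \<open>auto simp: mult_iota_def mu\<close>)
      show "om A = (\<lambda>(a, b, c) \<in> Obj C \<times> Obj C \<times> Obj C. \<guillemotleft>Id1 D (fo A a \<odot>\<^bsub>D\<^esub> fo A b \<odot>\<^bsub>D\<^esub> fo A c)\<guillemotright>\<^bsub>D\<^esub>)"
        by (rule extensionalityI[of _ "Obj C \<times> Obj C \<times> Obj C"]) (use a in \<open>auto simp: assoc_unitors_def om\<close>)
      show "el A = (\<lambda>a \<in> Obj C. \<guillemotleft>Id1 D (fo A a)\<guillemotright>\<^bsub>D\<^esub>)"
        by (rule extensionalityI[of _ "Obj C"]) (use a in \<open>auto simp: assoc_unitors_def u\<close>)
      show "ar A = (\<lambda>a \<in> Obj C. \<guillemotleft>Id1 D (fo A a)\<guillemotright>\<^bsub>D\<^esub>)"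
        by (rule extensionalityI[of _ "Obj C"]) (use a in \<open>auto simp: assoc_unitors_def u\<close>)
      show "io A = idadj D (Unt D)" "im A = fu A (Unt C)"
        using n by (simp_all add: normal_functor_def C.lab_one D.lab_one)
    qed (simp_all add: mult mm)
    show "mon_fun C D A" using t by (simp add: three_functor_iff)
  next
    assume m: "mon_fun C D A \<and> (\<forall>g \<in> carrier G. fo A (c g) = d g)"
    then interpret mon_fun C D A by blast
    have "three_functor C D A" by (simp add: three_functor_iff mon_fun_axioms)
    then show "normal_functor G c d C D A"
      using m by (simp add: normal_functor_def C.lab_one D.lab_one D.lab_mult)
  qed
qed

section \<open>Composition of monoidal pseudofunctors\<close>

locale gray_fun = C: gray_mon C + D: gray_mon D
  for C :: "('o,'m,'t,'y) gray_scheme" and D :: "('p,'n,'u,'z) gray_scheme" +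
  fixes P :: "('o,'m,'t,'p,'n,'u) grayfun"
  assumes gf: "gray_functor C D P"
begin

lemmas gf_unfolded = gf[unfolded gray_functor_def arr_def cell_def]
lemmas gfun_tail1 = conjunct2[OF gf_unfolded]
lemmas gfun_tail2 = conjunct2[OF gfun_tail1]
lemmas gfun_tail3 = conjunct2[OF gfun_tail2]
lemmas gfun_tail4 = conjunct2[OF gfun_tail3]
lemmas gfun_tail5 = conjunct2[OF gfun_tail4]
lemmas gfun_tail6 = conjunct2[OF gfun_tail5]
lemmas gfun_tail7 = conjunct2[OF gfun_tail6]
lemmas gfun_tail8 = conjunct2[OF gfun_tail7]
lemmas gfun_tail9 = conjunct2[OF gfun_tail8]
lemmas gfun_tail10 = conjunct2[OF gfun_tail9]
lemmas gfun_tail11 = conjunct2[OF gfun_tail10]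
lemmas gfun_tail12 = conjunct2[OF gfun_tail11]
lemmas gfun_tail13 = conjunct2[OF gfun_tail12]
lemmas gfun = conjunct1[OF gf_unfolded] conjunct1[OF gfun_tail1] conjunct1[OF gfun_tail2]
  conjunct1[OF gfun_tail3] conjunct1[OF gfun_tail4] conjunct1[OF gfun_tail5]
  conjunct1[OF gfun_tail6] conjunct1[OF gfun_tail7] conjunct1[OF gfun_tail8]
  conjunct1[OF gfun_tail9] conjunct1[OF gfun_tail10] conjunct1[OF gfun_tail11]
  conjunct1[OF gfun_tail12] gfun_tail13

lemma p0 [simp]: "a \<in> Obj C \<Longrightarrow> p0 P a \<in> Obj D" "a \<in> Obj C \<Longrightarrow> p1 P (Id1 C a) = Id1 D (p0 P a)"
    "p0 P (Unt C) = Unt D" "a \<in> Obj C \<Longrightarrow> b \<in> Obj C \<Longrightarrow> p0 P (a \<odot>\<^bsub>C\<^esub> b) = p0 P a \<odot>\<^bsub>D\<^esub> p0 P b"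
  using gfun(4,10,11) by simp_all

lemma p1 [simp]:
  assumes "x \<in> Arr C"
  shows "p1 P x \<in> Arr D" "Dom D (p1 P x) = p0 P (Dom C x)" "Cod D (p1 P x) = p0 P (Cod C x)"
    "p2 P \<guillemotleft>x\<guillemotright>\<^bsub>C\<^esub> = \<guillemotleft>p1 P x\<guillemotright>\<^bsub>D\<^esub>"
    "y \<in> Arr C \<Longrightarrow> Cod C x = Dom C y \<Longrightarrow> p1 P (y \<cdot>\<^bsub>C\<^esub> x) = p1 P y \<cdot>\<^bsub>D\<^esub> p1 P x"
    "a \<in> Obj C \<Longrightarrow> p1 P (a \<ltimes>\<^bsub>C\<^esub> x) = p0 P a \<ltimes>\<^bsub>D\<^esub> p1 P x"
    "a \<in> Obj C \<Longrightarrow> p1 P (x \<rtimes>\<^bsub>C\<^esub> a) = p1 P x \<rtimes>\<^bsub>D\<^esub> p0 P a"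
    "y \<in> Arr C \<Longrightarrow> p2 P (Ich C x y) = Ich D (p1 P x) (p1 P y)"
  using gfun(5,7,12,14) assms by simp_all

lemma p2 [simp]:
  assumes "f \<in> Cel C"
  shows "p2 P f \<in> Cel D" "Src D (p2 P f) = p1 P (Src C f)" "Tgt D (p2 P f) = p1 P (Tgt C f)"
    "g \<in> Cel C \<Longrightarrow> Tgt C f = Src C g \<Longrightarrow> p2 P (g \<bullet>\<^bsub>C\<^esub> f) = p2 P g \<bullet>\<^bsub>D\<^esub> p2 P f"
    "g \<in> Cel C \<Longrightarrow> Cod C (Src C f) = Dom C (Src C g) \<Longrightarrow> p2 P (g \<star>\<^bsub>C\<^esub> f) = p2 P g \<star>\<^bsub>D\<^esub> p2 P f"
    "a \<in> Obj C \<Longrightarrow> p2 P (a \<ltimes>\<^sub>2\<^bsub>C\<^esub> f) = p0 P a \<ltimes>\<^sub>2\<^bsub>D\<^esub> p2 P f"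
    "a \<in> Obj C \<Longrightarrow> p2 P (f \<rtimes>\<^sub>2\<^bsub>C\<^esub> a) = p2 P f \<rtimes>\<^sub>2\<^bsub>D\<^esub> p0 P a"
  using gfun(6,8,9,13) assms by simp_all

lemma p2_inv2 [simp]:
  assumes "iso2 C f"
  shows "p2 P (inv2 C f) = inv2 D (p2 P f)"
proof -
  have "inverse2 D (p2 P f) (p2 P (inv2 C f))"
    using assms by (simp add: inverse2_def cell_def p2(4)[symmetric] del: p2(4))
  then show ?thesis using assms by (simp add: D.inv2_eqI)
qed

lemma p_ten [simp]:
  "x \<in> Arr C \<Longrightarrow> y \<in> Arr C \<Longrightarrow> p1 P (x \<boxtimes>\<^bsub>C\<^esub> y) = p1 P x \<boxtimes>\<^bsub>D\<^esub> p1 P y"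
  "f \<in> Cel C \<Longrightarrow> g \<in> Cel C \<Longrightarrow> p2 P (f \<boxtimes>\<^sub>2\<^bsub>C\<^esub> g) = p2 P f \<boxtimes>\<^sub>2\<^bsub>D\<^esub> p2 P g"
  by (simp_all add: ten1_def ten2_def)

lemma p_cub [simp]:
  assumes "x \<in> Arr C" "y \<in> Arr C" "x' \<in> Arr C" "y' \<in> Arr C" "Cod C x = Dom C x'" "Cod C y = Dom C y'"
  shows "p2 P (cub C x' y' x y) = cub D (p1 P x') (p1 P y') (p1 P x) (p1 P y)"
  using assms by (simp add: cub_def)

text \<open>Covers both the identity 3-functors and the functors \<open>\<pi>\<close>.\<close>

lemma mon_fun_strict3: "mon_fun C D (strict3 C D P)"
proof
  show "pseudofunctor C D (strict3 C D P)"
    unfolding pseudofunctor_def strict3_def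
    using gfun(1-3) by (simp add: arr_def cell_def icell_iff cpairs_def)
qed (simp_all add: strict3_def cpairs_def)

end

lemma (in gray_mon) gray_fun_id:
  "gray_fun D D \<lparr> p0 = (\<lambda>a \<in> Obj D. a), p1 = (\<lambda>x \<in> Arr D. x), p2 = (\<lambda>f \<in> Cel D. f) \<rparr>"
  by unfold_locales (simp add: gray_functor_def arr_def cell_def)

lemma (in gray_mon) mon_fun_idfun3: "mon_fun D D (idfun3 D)"
  unfolding idfun3_def by (rule gray_fun.mon_fun_strict3[OF gray_fun_id])

lemma (in gray_mon) idfun3_simps [simp]:
  "a \<in> Obj D \<Longrightarrow> fo (idfun3 D) a = a"
  "x \<in> Arr D \<Longrightarrow> fm (idfun3 D) x = x"
  "f \<in> Cel D \<Longrightarrow> fc (idfun3 D) f = f"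
  "a \<in> Obj D \<Longrightarrow> fu (idfun3 D) a = \<guillemotleft>Id1 D a\<guillemotright>"
  "x \<in> Arr D \<Longrightarrow> y \<in> Arr D \<Longrightarrow> Cod D x = Dom D y \<Longrightarrow> fp (idfun3 D) (y, x) = \<guillemotleft>y \<cdot> x\<guillemotright>"
  "x \<in> Arr D \<Longrightarrow> y \<in> Arr D \<Longrightarrow> mm (idfun3 D) (x, y) = \<guillemotleft>x \<boxtimes> y\<guillemotright>"
  by (simp_all add: idfun3_def strict3_def cpairs_def)

locale mon_fun_pair = A: mon_fun C D A + B: mon_fun D E B
  for C :: "('o,'m,'t,'y) gray_scheme" and D :: "('p,'n,'u,'z) gray_scheme"
    and E :: "('q,'k,'v,'x) gray_scheme"
    and A :: "('o,'m,'t,'p,'n,'u) threefun" and B :: "('p,'n,'u,'q,'k,'v) threefun"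
begin

text \<open>The correction terms in the composite 3-functor act on identity 2-cells only, hence vanish.\<close>

lemma unloop_id [simp]: "a \<in> Obj D \<Longrightarrow> unloop E B a \<guillemotleft>Id1 D a\<guillemotright>\<^bsub>D\<^esub> = \<guillemotleft>Id1 E (fo B a)\<guillemotright>\<^bsub>E\<^esub>"
  by (simp add: unloop_def)

lemma cmp3_simps [simp]:
  "a \<in> Obj C \<Longrightarrow> fo (cmp3 C D E B A) a = fo B (fo A a)"
  "x \<in> Arr C \<Longrightarrow> fm (cmp3 C D E B A) x = fm B (fm A x)"
  "f \<in> Cel C \<Longrightarrow> fc (cmp3 C D E B A) f = fc B (fc A f)"
  "a \<in> Obj C \<Longrightarrow> fu (cmp3 C D E B A) a = fc B (fu A a) \<bullet>\<^bsub>E\<^esub> fu B (fo A a)"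
  "x \<in> Arr C \<Longrightarrow> y \<in> Arr C \<Longrightarrow> Cod C x = Dom C y \<Longrightarrow>
     fp (cmp3 C D E B A) (y, x) = fc B (fp A (y, x)) \<bullet>\<^bsub>E\<^esub> fp B (fm A y, fm A x)"
  "x \<in> Arr C \<Longrightarrow> y \<in> Arr C \<Longrightarrow> mm (cmp3 C D E B A) (x, y) = fc B (mm A (x, y)) \<bullet>\<^bsub>E\<^esub> mm B (fm A x, fm A y)"
  by (simp_all add: cmp3_def cpairs_def)

text \<open>Each axiom for \<open>B \<circ> A\<close> follows the same pattern: naturality of the constraint of \<open>B\<close> moves the
  image under \<open>B\<close> of a constraint of \<open>A\<close> to the left, where the axiom for \<open>A\<close> applies inside \<open>B\<close>,
  while the axiom for \<open>B\<close> applies to the constraints that have moved to the right.\<close>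

lemma pseudofunctor_cmp3: "pseudofunctor C E (cmp3 C D E B A)"
proof -
  have 1: "fc B (fp A (z \<cdot>\<^bsub>C\<^esub> y, x)) \<bullet>\<^bsub>E\<^esub> (fp B (fm A (z \<cdot>\<^bsub>C\<^esub> y), fm A x)
        \<bullet>\<^bsub>E\<^esub> ((fc B (fp A (z, y)) \<bullet>\<^bsub>E\<^esub> fp B (fm A z, fm A y)) \<star>\<^bsub>E\<^esub> \<guillemotleft>fm B (fm A x)\<guillemotright>\<^bsub>E\<^esub>))
      = fc B (fp A (z, y \<cdot>\<^bsub>C\<^esub> x)) \<bullet>\<^bsub>E\<^esub> (fp B (fm A z, fm A (y \<cdot>\<^bsub>C\<^esub> x))
        \<bullet>\<^bsub>E\<^esub> (\<guillemotleft>fm B (fm A z)\<guillemotright>\<^bsub>E\<^esub> \<star>\<^bsub>E\<^esub> (fc B (fp A (y, x)) \<bullet>\<^bsub>E\<^esub> fp B (fm A y, fm A x))))"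
    (is "?Bf \<bullet>\<^bsub>E\<^esub> (?f \<bullet>\<^bsub>E\<^esub> ((?Bg \<bullet>\<^bsub>E\<^esub> ?g) \<star>\<^bsub>E\<^esub> ?X)) = ?Bf' \<bullet>\<^bsub>E\<^esub> (?f' \<bullet>\<^bsub>E\<^esub> (?Z \<star>\<^bsub>E\<^esub> (?Bg' \<bullet>\<^bsub>E\<^esub> ?g')))")
    if h: "x \<in> Arr C" "y \<in> Arr C" "z \<in> Arr C" "Dom C y = Cod C x" "Dom C z = Cod C y" for x y z
  proof -
    let ?AX = "\<guillemotleft>fm A x\<guillemotright>\<^bsub>D\<^esub>" and ?AZ = "\<guillemotleft>fm A z\<guillemotright>\<^bsub>D\<^esub>"
    have e1: "?f \<bullet>\<^bsub>E\<^esub> (?Bg \<star>\<^bsub>E\<^esub> ?X) = fc B (fp A (z, y) \<star>\<^bsub>D\<^esub> ?AX) \<bullet>\<^bsub>E\<^esub> fp B (fm A z \<cdot>\<^bsub>D\<^esub> fm A y, fm A x)"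
      using B.fp_natural[of ?AX "fp A (z, y)"] h by simp
    have e2: "?Bf \<bullet>\<^bsub>E\<^esub> fc B (fp A (z, y) \<star>\<^bsub>D\<^esub> ?AX) = ?Bf' \<bullet>\<^bsub>E\<^esub> fc B (?AZ \<star>\<^bsub>D\<^esub> fp A (y, x))"
      using h by (simp add: B.fc_vcmp[symmetric] A.fp_assoc)
    have e3: "fc B (?AZ \<star>\<^bsub>D\<^esub> fp A (y, x)) \<bullet>\<^bsub>E\<^esub> fp B (fm A z, fm A y \<cdot>\<^bsub>D\<^esub> fm A x) = ?f' \<bullet>\<^bsub>E\<^esub> (?Z \<star>\<^bsub>E\<^esub> ?Bg')"
      using B.fp_natural[of "fp A (y, x)" ?AZ] h by simp
    have "?Bf \<bullet>\<^bsub>E\<^esub> (?f \<bullet>\<^bsub>E\<^esub> ((?Bg \<bullet>\<^bsub>E\<^esub> ?g) \<star>\<^bsub>E\<^esub> ?X)) = ?Bf \<bullet>\<^bsub>E\<^esub> (?f \<bullet>\<^bsub>E\<^esub> ((?Bg \<star>\<^bsub>E\<^esub> ?X) \<bullet>\<^bsub>E\<^esub> (?g \<star>\<^bsub>E\<^esub> ?X)))"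
      using h by (simp add: B.D.whisker_vcmp)
    also have "\<dots> = ?Bf \<bullet>\<^bsub>E\<^esub> (fc B (fp A (z, y) \<star>\<^bsub>D\<^esub> ?AX) \<bullet>\<^bsub>E\<^esub> (fp B (fm A z \<cdot>\<^bsub>D\<^esub> fm A y, fm A x) \<bullet>\<^bsub>E\<^esub> (?g \<star>\<^bsub>E\<^esub> ?X)))"
      using h by (subst B.D.vcmp_extend[OF e1]) simp_all
    also have "\<dots> = ?Bf \<bullet>\<^bsub>E\<^esub> (fc B (fp A (z, y) \<star>\<^bsub>D\<^esub> ?AX) \<bullet>\<^bsub>E\<^esub> (fp B (fm A z, fm A y \<cdot>\<^bsub>D\<^esub> fm A x) \<bullet>\<^bsub>E\<^esub> (?Z \<star>\<^bsub>E\<^esub> ?g')))"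
      using h by (simp add: B.fp_assoc)
    also have "\<dots> = ?Bf' \<bullet>\<^bsub>E\<^esub> (fc B (?AZ \<star>\<^bsub>D\<^esub> fp A (y, x)) \<bullet>\<^bsub>E\<^esub> (fp B (fm A z, fm A y \<cdot>\<^bsub>D\<^esub> fm A x) \<bullet>\<^bsub>E\<^esub> (?Z \<star>\<^bsub>E\<^esub> ?g')))"
      using h by (subst B.D.vcmp_extend[OF e2]) simp_all
    also have "\<dots> = ?Bf' \<bullet>\<^bsub>E\<^esub> (?f' \<bullet>\<^bsub>E\<^esub> ((?Z \<star>\<^bsub>E\<^esub> ?Bg') \<bullet>\<^bsub>E\<^esub> (?Z \<star>\<^bsub>E\<^esub> ?g')))"
      using h by (subst B.D.vcmp_extend[OF e3]) simp_all
    finally show ?thesis using h by (simp add: B.D.whisker_vcmp)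
  qed
  have 2: "fc B (fc A (g \<star>\<^bsub>C\<^esub> f)) \<bullet>\<^bsub>E\<^esub> (fc B (fp A (Src C g, Src C f)) \<bullet>\<^bsub>E\<^esub> fp B (fm A (Src C g), fm A (Src C f)))
     = fc B (fp A (Tgt C g, Tgt C f)) \<bullet>\<^bsub>E\<^esub> (fp B (fm A (Tgt C g), fm A (Tgt C f)) \<bullet>\<^bsub>E\<^esub> (fc B (fc A g) \<star>\<^bsub>E\<^esub> fc B (fc A f)))"
    if h: "f \<in> Cel C" "g \<in> Cel C" "Cod C (Src C f) = Dom C (Src C g)" for f g
  proof -
    have e1: "fc B (fc A (g \<star>\<^bsub>C\<^esub> f)) \<bullet>\<^bsub>E\<^esub> fc B (fp A (Src C g, Src C f))
      = fc B (fp A (Tgt C g, Tgt C f)) \<bullet>\<^bsub>E\<^esub> fc B (fc A g \<star>\<^bsub>D\<^esub> fc A f)"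
      using h by (simp add: B.fc_vcmp[symmetric] A.fp_natural)
    have e2: "fc B (fc A g \<star>\<^bsub>D\<^esub> fc A f) \<bullet>\<^bsub>E\<^esub> fp B (fm A (Src C g), fm A (Src C f))
      = fp B (fm A (Tgt C g), fm A (Tgt C f)) \<bullet>\<^bsub>E\<^esub> (fc B (fc A g) \<star>\<^bsub>E\<^esub> fc B (fc A f))"
      using h B.fp_natural[of "fc A f" "fc A g"] by simp
    show ?thesis
      using h by (subst B.D.vcmp_extend[OF e1]) (simp_all add: e2)
  qed
  have 3: "fc B (fp A (x, Id1 C a)) \<bullet>\<^bsub>E\<^esub> (fp B (fm A x, fm A (Id1 C a)) \<bullet>\<^bsub>E\<^esub>
      (\<guillemotleft>fm B (fm A x)\<guillemotright>\<^bsub>E\<^esub> \<star>\<^bsub>E\<^esub> (fc B (fu A a) \<bullet>\<^bsub>E\<^esub> fu B (fo A a)))) = \<guillemotleft>fm B (fm A x)\<guillemotright>\<^bsub>E\<^esub>"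
    if h: "x \<in> Arr C" "Dom C x = a" for x a
  proof -
    let ?X = "\<guillemotleft>fm A x\<guillemotright>\<^bsub>D\<^esub>"
    have a: "a \<in> Obj C" using h by auto
    have e1: "fp B (fm A x, fm A (Id1 C a)) \<bullet>\<^bsub>E\<^esub> (\<guillemotleft>fm B (fm A x)\<guillemotright>\<^bsub>E\<^esub> \<star>\<^bsub>E\<^esub> fc B (fu A a))
      = fc B (?X \<star>\<^bsub>D\<^esub> fu A a) \<bullet>\<^bsub>E\<^esub> fp B (fm A x, Id1 D (fo A a))"
      using h a B.fp_natural[of "fu A a" ?X] by simp
    have e2: "fc B (fp A (x, Id1 C a)) \<bullet>\<^bsub>E\<^esub> fc B (?X \<star>\<^bsub>D\<^esub> fu A a) = \<guillemotleft>fm B (fm A x)\<guillemotright>\<^bsub>E\<^esub> \<bullet>\<^bsub>E\<^esub> \<guillemotleft>fm B (fm A x)\<guillemotright>\<^bsub>E\<^esub>"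
      using h a by (simp add: B.fc_vcmp[symmetric] A.fp_unit)
    have "fp B (fm A x, fm A (Id1 C a)) \<bullet>\<^bsub>E\<^esub> (\<guillemotleft>fm B (fm A x)\<guillemotright>\<^bsub>E\<^esub> \<star>\<^bsub>E\<^esub> (fc B (fu A a) \<bullet>\<^bsub>E\<^esub> fu B (fo A a)))
      = fc B (?X \<star>\<^bsub>D\<^esub> fu A a) \<bullet>\<^bsub>E\<^esub> (fp B (fm A x, Id1 D (fo A a)) \<bullet>\<^bsub>E\<^esub> (\<guillemotleft>fm B (fm A x)\<guillemotright>\<^bsub>E\<^esub> \<star>\<^bsub>E\<^esub> fu B (fo A a)))"
      using h a by (simp add: B.D.whisker_vcmp) (subst B.D.vcmp_extend[OF e1], simp_all)
    also have "\<dots> = fc B (?X \<star>\<^bsub>D\<^esub> fu A a)"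
      using h a by (simp add: B.fp_unit)
    finally show ?thesis using e2 h a by simp
  qed
  have 4: "fc B (fp A (Id1 C b, x)) \<bullet>\<^bsub>E\<^esub> (fp B (fm A (Id1 C b), fm A x) \<bullet>\<^bsub>E\<^esub>
      ((fc B (fu A b) \<bullet>\<^bsub>E\<^esub> fu B (fo A b)) \<star>\<^bsub>E\<^esub> \<guillemotleft>fm B (fm A x)\<guillemotright>\<^bsub>E\<^esub>)) = \<guillemotleft>fm B (fm A x)\<guillemotright>\<^bsub>E\<^esub>"
    if h: "x \<in> Arr C" "Cod C x = b" for x b
  proof -
    let ?X = "\<guillemotleft>fm A x\<guillemotright>\<^bsub>D\<^esub>"
    have b: "b \<in> Obj C" using h by auto
    have e1: "fp B (fm A (Id1 C b), fm A x) \<bullet>\<^bsub>E\<^esub> (fc B (fu A b) \<star>\<^bsub>E\<^esub> \<guillemotleft>fm B (fm A x)\<guillemotright>\<^bsub>E\<^esub>)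
      = fc B (fu A b \<star>\<^bsub>D\<^esub> ?X) \<bullet>\<^bsub>E\<^esub> fp B (Id1 D (fo A b), fm A x)"
      using h b B.fp_natural[of ?X "fu A b"] by simp
    have e2: "fc B (fp A (Id1 C b, x)) \<bullet>\<^bsub>E\<^esub> fc B (fu A b \<star>\<^bsub>D\<^esub> ?X) = \<guillemotleft>fm B (fm A x)\<guillemotright>\<^bsub>E\<^esub> \<bullet>\<^bsub>E\<^esub> \<guillemotleft>fm B (fm A x)\<guillemotright>\<^bsub>E\<^esub>"
      using h b by (simp add: B.fc_vcmp[symmetric] A.fp_unit)
    have "fp B (fm A (Id1 C b), fm A x) \<bullet>\<^bsub>E\<^esub> ((fc B (fu A b) \<bullet>\<^bsub>E\<^esub> fu B (fo A b)) \<star>\<^bsub>E\<^esub> \<guillemotleft>fm B (fm A x)\<guillemotright>\<^bsub>E\<^esub>)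
      = fc B (fu A b \<star>\<^bsub>D\<^esub> ?X) \<bullet>\<^bsub>E\<^esub> (fp B (Id1 D (fo A b), fm A x) \<bullet>\<^bsub>E\<^esub> (fu B (fo A b) \<star>\<^bsub>E\<^esub> \<guillemotleft>fm B (fm A x)\<guillemotright>\<^bsub>E\<^esub>))"
      using h b by (simp add: B.D.whisker_vcmp) (subst B.D.vcmp_extend[OF e1], simp_all)
    also have "\<dots> = fc B (fu A b \<star>\<^bsub>D\<^esub> ?X)"
      using h b by (simp add: B.fp_unit)
    finally show ?thesis using e2 h b by simp
  qed
  have ext: "fo (cmp3 C D E B A) \<in> extensional (Obj C)" "fm (cmp3 C D E B A) \<in> extensional (Arr C)"
    "fc (cmp3 C D E B A) \<in> extensional (Cel C)" "fu (cmp3 C D E B A) \<in> extensional (Obj C)"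
    "fp (cmp3 C D E B A) \<in> extensional (cpairs C)"
    by (simp_all add: cmp3_def)
  show ?thesis
    unfolding pseudofunctor_def
    using ext by (simp add: arr_def cell_def icell_iff A.fc_vcmp B.fc_vcmp imp_conjL 1 2 3 4 cong: imp_cong)
qed

text \<open>The pattern of the previous lemma, with naturality of \<open>\<mu>\<^sup>B\<close> as an additional commutation rule.\<close>

lemma mon_fun_cmp3: "mon_fun C E (cmp3 C D E B A)"
proof
  show "pseudofunctor C E (cmp3 C D E B A)" by (rule pseudofunctor_cmp3)
  show "fo (cmp3 C D E B A) (Unt C) = Unt E" by simp
  show "fo (cmp3 C D E B A) (a \<odot>\<^bsub>C\<^esub> b) = fo (cmp3 C D E B A) a \<odot>\<^bsub>E\<^esub> fo (cmp3 C D E B A) b"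
    if "a \<in> Obj C" "b \<in> Obj C" for a b
    using that by simp
  show "mu (cmp3 C D E B A) = (\<lambda>(a, b) \<in> Obj C \<times> Obj C. idadj E (fo (cmp3 C D E B A) a \<odot>\<^bsub>E\<^esub> fo (cmp3 C D E B A) b))"
    "io (cmp3 C D E B A) = idadj E (Unt E)"
    "im (cmp3 C D E B A) = fu (cmp3 C D E B A) (Unt C)"
    "om (cmp3 C D E B A) = (\<lambda>(a, b, c) \<in> Obj C \<times> Obj C \<times> Obj C.
       \<guillemotleft>Id1 E (fo (cmp3 C D E B A) a \<odot>\<^bsub>E\<^esub> fo (cmp3 C D E B A) b \<odot>\<^bsub>E\<^esub> fo (cmp3 C D E B A) c)\<guillemotright>\<^bsub>E\<^esub>)"
    "el (cmp3 C D E B A) = (\<lambda>a \<in> Obj C. \<guillemotleft>Id1 E (fo (cmp3 C D E B A) a)\<guillemotright>\<^bsub>E\<^esub>)"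
    "ar (cmp3 C D E B A) = (\<lambda>a \<in> Obj C. \<guillemotleft>Id1 E (fo (cmp3 C D E B A) a)\<guillemotright>\<^bsub>E\<^esub>)"
    by (auto simp: cmp3_def fun_eq_iff restrict_def unloop_id[unfolded A.fo_ten])
  show "mm (cmp3 C D E B A) \<in> extensional (Arr C \<times> Arr C)" by (simp add: cmp3_def)
  show "iso2 E (mm (cmp3 C D E B A) (x, y))"
    "Src E (mm (cmp3 C D E B A) (x, y)) = fm (cmp3 C D E B A) x \<boxtimes>\<^bsub>E\<^esub> fm (cmp3 C D E B A) y"
    "Tgt E (mm (cmp3 C D E B A) (x, y)) = fm (cmp3 C D E B A) (x \<boxtimes>\<^bsub>C\<^esub> y)"
    if "x \<in> Arr C" "y \<in> Arr C" for x y
    using that by simp_all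
next
  fix f g assume h: "f \<in> Cel C" "g \<in> Cel C"
  have e1: "fc B (fc A (f \<boxtimes>\<^sub>2\<^bsub>C\<^esub> g)) \<bullet>\<^bsub>E\<^esub> fc B (mm A (Src C f, Src C g))
      = fc B (mm A (Tgt C f, Tgt C g)) \<bullet>\<^bsub>E\<^esub> fc B (fc A f \<boxtimes>\<^sub>2\<^bsub>D\<^esub> fc A g)"
    using h by (simp add: B.fc_vcmp[symmetric] A.mm_natural)
  have e2: "fc B (fc A f \<boxtimes>\<^sub>2\<^bsub>D\<^esub> fc A g) \<bullet>\<^bsub>E\<^esub> mm B (fm A (Src C f), fm A (Src C g))
      = mm B (fm A (Tgt C f), fm A (Tgt C g)) \<bullet>\<^bsub>E\<^esub> (fc B (fc A f) \<boxtimes>\<^sub>2\<^bsub>E\<^esub> fc B (fc A g))"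
    using h B.mm_natural[of "fc A f" "fc A g"] by simp
  show "fc (cmp3 C D E B A) (f \<boxtimes>\<^sub>2\<^bsub>C\<^esub> g) \<bullet>\<^bsub>E\<^esub> mm (cmp3 C D E B A) (Src C f, Src C g)
      = mm (cmp3 C D E B A) (Tgt C f, Tgt C g) \<bullet>\<^bsub>E\<^esub> (fc (cmp3 C D E B A) f \<boxtimes>\<^sub>2\<^bsub>E\<^esub> fc (cmp3 C D E B A) g)"
    using h by (simp, subst B.D.vcmp_extend[OF e1]) (simp_all add: e2)
next
  fix x x' y y'
  assume h: "x \<in> Arr C" "x' \<in> Arr C" "Dom C x' = Cod C x" "y \<in> Arr C" "y' \<in> Arr C" "Dom C y' = Cod C y"
  let ?M = "mm A (x, y)" and ?M' = "mm A (x', y')" and ?M'' = "mm A (x' \<cdot>\<^bsub>C\<^esub> x, y' \<cdot>\<^bsub>C\<^esub> y)"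
  let ?m = "mm B (fm A x, fm A y)" and ?m' = "mm B (fm A x', fm A y')"
  let ?p = "fp A (x', x)" and ?q = "fp A (y', y)"
  let ?Bp = "fc B (fp A (x' \<boxtimes>\<^bsub>C\<^esub> y', x \<boxtimes>\<^bsub>C\<^esub> y))"
  let ?Bc = "fc B (fc A (cub C x' y' x y))"
  let ?r = "fp B (fm A x' \<boxtimes>\<^bsub>D\<^esub> fm A y', fm A x \<boxtimes>\<^bsub>D\<^esub> fm A y)"
  let ?r' = "fp B (fm A (x' \<boxtimes>\<^bsub>C\<^esub> y'), fm A (x \<boxtimes>\<^bsub>C\<^esub> y))"
  let ?cD = "cub D (fm A x') (fm A y') (fm A x) (fm A y)"
  let ?cE = "cub E (fm B (fm A x')) (fm B (fm A y')) (fm B (fm A x)) (fm B (fm A y))"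
  let ?n = "mm B (fm A x' \<cdot>\<^bsub>D\<^esub> fm A x, fm A y' \<cdot>\<^bsub>D\<^esub> fm A y)"
  let ?n' = "mm B (fm A (x' \<cdot>\<^bsub>C\<^esub> x), fm A (y' \<cdot>\<^bsub>C\<^esub> y))"
  let ?s = "fp B (fm A x', fm A x)" and ?t = "fp B (fm A y', fm A y)"
  (* e2 is the axiom for A inside B, e3 the axiom for B; e1 and e4 are naturality of the constraints of B *)
  have e1: "?r' \<bullet>\<^bsub>E\<^esub> (fc B ?M' \<star>\<^bsub>E\<^esub> fc B ?M) = fc B (?M' \<star>\<^bsub>D\<^esub> ?M) \<bullet>\<^bsub>E\<^esub> ?r"
    using h B.fp_natural[of ?M ?M'] by simp
  have e2: "?Bc \<bullet>\<^bsub>E\<^esub> (?Bp \<bullet>\<^bsub>E\<^esub> fc B (?M' \<star>\<^bsub>D\<^esub> ?M)) = fc B ?M'' \<bullet>\<^bsub>E\<^esub> (fc B (?p \<boxtimes>\<^sub>2\<^bsub>D\<^esub> ?q) \<bullet>\<^bsub>E\<^esub> fc B ?cD)"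
    using h by (simp add: B.fc_vcmp[symmetric] A.mm_comp)
  have e3: "fc B ?cD \<bullet>\<^bsub>E\<^esub> (?r \<bullet>\<^bsub>E\<^esub> (?m' \<star>\<^bsub>E\<^esub> ?m)) = ?n \<bullet>\<^bsub>E\<^esub> ((?s \<boxtimes>\<^sub>2\<^bsub>E\<^esub> ?t) \<bullet>\<^bsub>E\<^esub> ?cE)"
    using h by (simp add: B.mm_comp)
  have e4: "fc B (?p \<boxtimes>\<^sub>2\<^bsub>D\<^esub> ?q) \<bullet>\<^bsub>E\<^esub> ?n = ?n' \<bullet>\<^bsub>E\<^esub> (fc B ?p \<boxtimes>\<^sub>2\<^bsub>E\<^esub> fc B ?q)"
    using h B.mm_natural[of ?p ?q] by simp
  have "?Bc \<bullet>\<^bsub>E\<^esub> (?Bp \<bullet>\<^bsub>E\<^esub> (?r' \<bullet>\<^bsub>E\<^esub> ((fc B ?M' \<bullet>\<^bsub>E\<^esub> ?m') \<star>\<^bsub>E\<^esub> (fc B ?M \<bullet>\<^bsub>E\<^esub> ?m))))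
      = ?Bc \<bullet>\<^bsub>E\<^esub> (?Bp \<bullet>\<^bsub>E\<^esub> (?r' \<bullet>\<^bsub>E\<^esub> ((fc B ?M' \<star>\<^bsub>E\<^esub> fc B ?M) \<bullet>\<^bsub>E\<^esub> (?m' \<star>\<^bsub>E\<^esub> ?m))))"
    using h by (simp add: B.D.interchange)
  also have "\<dots> = ?Bc \<bullet>\<^bsub>E\<^esub> (?Bp \<bullet>\<^bsub>E\<^esub> (fc B (?M' \<star>\<^bsub>D\<^esub> ?M) \<bullet>\<^bsub>E\<^esub> (?r \<bullet>\<^bsub>E\<^esub> (?m' \<star>\<^bsub>E\<^esub> ?m))))"
    using h by (subst B.D.vcmp_extend[OF e1]) simp_all
  also have "\<dots> = (?Bc \<bullet>\<^bsub>E\<^esub> (?Bp \<bullet>\<^bsub>E\<^esub> fc B (?M' \<star>\<^bsub>D\<^esub> ?M))) \<bullet>\<^bsub>E\<^esub> (?r \<bullet>\<^bsub>E\<^esub> (?m' \<star>\<^bsub>E\<^esub> ?m))"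
    using h by simp
  also have "\<dots> = (fc B ?M'' \<bullet>\<^bsub>E\<^esub> (fc B (?p \<boxtimes>\<^sub>2\<^bsub>D\<^esub> ?q) \<bullet>\<^bsub>E\<^esub> fc B ?cD)) \<bullet>\<^bsub>E\<^esub> (?r \<bullet>\<^bsub>E\<^esub> (?m' \<star>\<^bsub>E\<^esub> ?m))"
    by (simp only: e2)
  also have "\<dots> = fc B ?M'' \<bullet>\<^bsub>E\<^esub> (fc B (?p \<boxtimes>\<^sub>2\<^bsub>D\<^esub> ?q) \<bullet>\<^bsub>E\<^esub> (fc B ?cD \<bullet>\<^bsub>E\<^esub> (?r \<bullet>\<^bsub>E\<^esub> (?m' \<star>\<^bsub>E\<^esub> ?m))))"
    using h by simp
  also have "\<dots> = fc B ?M'' \<bullet>\<^bsub>E\<^esub> (fc B (?p \<boxtimes>\<^sub>2\<^bsub>D\<^esub> ?q) \<bullet>\<^bsub>E\<^esub> (?n \<bullet>\<^bsub>E\<^esub> ((?s \<boxtimes>\<^sub>2\<^bsub>E\<^esub> ?t) \<bullet>\<^bsub>E\<^esub> ?cE)))"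
    by (simp only: e3)
  also have "\<dots> = fc B ?M'' \<bullet>\<^bsub>E\<^esub> (?n' \<bullet>\<^bsub>E\<^esub> ((fc B ?p \<boxtimes>\<^sub>2\<^bsub>E\<^esub> fc B ?q) \<bullet>\<^bsub>E\<^esub> ((?s \<boxtimes>\<^sub>2\<^bsub>E\<^esub> ?t) \<bullet>\<^bsub>E\<^esub> ?cE)))"
    using h by (subst B.D.vcmp_extend[OF e4]) simp_all
  finally show "fc (cmp3 C D E B A) (cub C x' y' x y) \<bullet>\<^bsub>E\<^esub> fp (cmp3 C D E B A) (x' \<boxtimes>\<^bsub>C\<^esub> y', x \<boxtimes>\<^bsub>C\<^esub> y)
        \<bullet>\<^bsub>E\<^esub> (mm (cmp3 C D E B A) (x', y') \<star>\<^bsub>E\<^esub> mm (cmp3 C D E B A) (x, y))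
      = mm (cmp3 C D E B A) (x' \<cdot>\<^bsub>C\<^esub> x, y' \<cdot>\<^bsub>C\<^esub> y)
        \<bullet>\<^bsub>E\<^esub> (fp (cmp3 C D E B A) (x', x) \<boxtimes>\<^sub>2\<^bsub>E\<^esub> fp (cmp3 C D E B A) (y', y))
        \<bullet>\<^bsub>E\<^esub> cub E (fm (cmp3 C D E B A) x') (fm (cmp3 C D E B A) y') (fm (cmp3 C D E B A) x) (fm (cmp3 C D E B A) y)"
    using h by (simp add: B.D.ten2_vcmp)
next
  fix a b assume h: "a \<in> Obj C" "b \<in> Obj C"
  let ?f = "fu A a \<boxtimes>\<^sub>2\<^bsub>D\<^esub> fu A b" and ?n = "mm B (Id1 D (fo A a), Id1 D (fo A b))"
  have e1: "mm B (fm A (Id1 C a), fm A (Id1 C b)) \<bullet>\<^bsub>E\<^esub> (fc B (fu A a) \<boxtimes>\<^sub>2\<^bsub>E\<^esub> fc B (fu A b)) = fc B ?f \<bullet>\<^bsub>E\<^esub> ?n"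
    using h B.mm_natural[of "fu A a" "fu A b"] by simp
  have e2: "fc B (mm A (Id1 C a, Id1 C b)) \<bullet>\<^bsub>E\<^esub> fc B ?f = \<guillemotleft>fm B (fm A (Id1 C (a \<odot>\<^bsub>C\<^esub> b)))\<guillemotright>\<^bsub>E\<^esub> \<bullet>\<^bsub>E\<^esub> fc B (fu A (a \<odot>\<^bsub>C\<^esub> b))"
    using h by (simp add: B.fc_vcmp[symmetric] A.mm_fu del: A.fo_ten)
  have e3: "?n \<bullet>\<^bsub>E\<^esub> (fu B (fo A a) \<boxtimes>\<^sub>2\<^bsub>E\<^esub> fu B (fo A b)) = fu B (fo A a \<odot>\<^bsub>D\<^esub> fo A b)"
    using h by (simp add: B.mm_fu)
  have "fc B (mm A (Id1 C a, Id1 C b)) \<bullet>\<^bsub>E\<^esub> (mm B (fm A (Id1 C a), fm A (Id1 C b)) \<bullet>\<^bsub>E\<^esub>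
        ((fc B (fu A a) \<boxtimes>\<^sub>2\<^bsub>E\<^esub> fc B (fu A b)) \<bullet>\<^bsub>E\<^esub> (fu B (fo A a) \<boxtimes>\<^sub>2\<^bsub>E\<^esub> fu B (fo A b))))
      = fc B (mm A (Id1 C a, Id1 C b)) \<bullet>\<^bsub>E\<^esub> (fc B ?f \<bullet>\<^bsub>E\<^esub> (?n \<bullet>\<^bsub>E\<^esub> (fu B (fo A a) \<boxtimes>\<^sub>2\<^bsub>E\<^esub> fu B (fo A b))))"
    using h by (subst B.D.vcmp_extend[OF e1]) simp_all
  also have "\<dots> = fc B (fu A (a \<odot>\<^bsub>C\<^esub> b)) \<bullet>\<^bsub>E\<^esub> fu B (fo A a \<odot>\<^bsub>D\<^esub> fo A b)"
    unfolding e3 using h by (subst B.D.vcmp_extend[OF e2]) simp_all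
  finally show "mm (cmp3 C D E B A) (Id1 C a, Id1 C b) \<bullet>\<^bsub>E\<^esub> (fu (cmp3 C D E B A) a \<boxtimes>\<^sub>2\<^bsub>E\<^esub> fu (cmp3 C D E B A) b)
      = fu (cmp3 C D E B A) (a \<odot>\<^bsub>C\<^esub> b)"
    using h by (simp add: B.D.ten2_vcmp)
next
  fix x y z assume h: "x \<in> Arr C" "y \<in> Arr C" "z \<in> Arr C"
  let ?X = "\<guillemotleft>fm A x\<guillemotright>\<^bsub>D\<^esub>" and ?Z = "\<guillemotleft>fm A z\<guillemotright>\<^bsub>D\<^esub>" and ?X' = "\<guillemotleft>fm B (fm A x)\<guillemotright>\<^bsub>E\<^esub>" and ?Z' = "\<guillemotleft>fm B (fm A z)\<guillemotright>\<^bsub>E\<^esub>"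
  let ?n = "mm B (fm A x \<boxtimes>\<^bsub>D\<^esub> fm A y, fm A z)" and ?n' = "mm B (fm A x, fm A y \<boxtimes>\<^bsub>D\<^esub> fm A z)"
  let ?k = "mm B (fm A x, fm A y)" and ?k' = "mm B (fm A y, fm A z)"
  have e1: "mm B (fm A (x \<boxtimes>\<^bsub>C\<^esub> y), fm A z) \<bullet>\<^bsub>E\<^esub> (fc B (mm A (x, y)) \<boxtimes>\<^sub>2\<^bsub>E\<^esub> ?Z') = fc B (mm A (x, y) \<boxtimes>\<^sub>2\<^bsub>D\<^esub> ?Z) \<bullet>\<^bsub>E\<^esub> ?n"
    using h B.mm_natural[of "mm A (x, y)" ?Z] by simp
  have e2: "fc B (mm A (x \<boxtimes>\<^bsub>C\<^esub> y, z)) \<bullet>\<^bsub>E\<^esub> fc B (mm A (x, y) \<boxtimes>\<^sub>2\<^bsub>D\<^esub> ?Z)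
      = fc B (mm A (x, y \<boxtimes>\<^bsub>C\<^esub> z)) \<bullet>\<^bsub>E\<^esub> fc B (?X \<boxtimes>\<^sub>2\<^bsub>D\<^esub> mm A (y, z))"
    using h by (simp add: B.fc_vcmp[symmetric] A.mm_assoc)
  have e3: "?n \<bullet>\<^bsub>E\<^esub> (?k \<boxtimes>\<^sub>2\<^bsub>E\<^esub> ?Z') = ?n' \<bullet>\<^bsub>E\<^esub> (?X' \<boxtimes>\<^sub>2\<^bsub>E\<^esub> ?k')"
    using h by (simp add: B.mm_assoc)
  have e4: "fc B (?X \<boxtimes>\<^sub>2\<^bsub>D\<^esub> mm A (y, z)) \<bullet>\<^bsub>E\<^esub> ?n' = mm B (fm A x, fm A (y \<boxtimes>\<^bsub>C\<^esub> z)) \<bullet>\<^bsub>E\<^esub> (?X' \<boxtimes>\<^sub>2\<^bsub>E\<^esub> fc B (mm A (y, z)))"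
    using h B.mm_natural[of ?X "mm A (y, z)"] by simp
  have "fc B (mm A (x \<boxtimes>\<^bsub>C\<^esub> y, z)) \<bullet>\<^bsub>E\<^esub> (mm B (fm A (x \<boxtimes>\<^bsub>C\<^esub> y), fm A z)
        \<bullet>\<^bsub>E\<^esub> ((fc B (mm A (x, y)) \<boxtimes>\<^sub>2\<^bsub>E\<^esub> ?Z') \<bullet>\<^bsub>E\<^esub> (?k \<boxtimes>\<^sub>2\<^bsub>E\<^esub> ?Z')))
      = fc B (mm A (x \<boxtimes>\<^bsub>C\<^esub> y, z)) \<bullet>\<^bsub>E\<^esub> (fc B (mm A (x, y) \<boxtimes>\<^sub>2\<^bsub>D\<^esub> ?Z) \<bullet>\<^bsub>E\<^esub> (?n \<bullet>\<^bsub>E\<^esub> (?k \<boxtimes>\<^sub>2\<^bsub>E\<^esub> ?Z')))"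
    using h by (subst B.D.vcmp_extend[OF e1]) simp_all
  also have "\<dots> = fc B (mm A (x, y \<boxtimes>\<^bsub>C\<^esub> z)) \<bullet>\<^bsub>E\<^esub> (fc B (?X \<boxtimes>\<^sub>2\<^bsub>D\<^esub> mm A (y, z)) \<bullet>\<^bsub>E\<^esub> (?n' \<bullet>\<^bsub>E\<^esub> (?X' \<boxtimes>\<^sub>2\<^bsub>E\<^esub> ?k')))"
    unfolding e3 using h by (subst B.D.vcmp_extend[OF e2]) simp_all
  also have "\<dots> = fc B (mm A (x, y \<boxtimes>\<^bsub>C\<^esub> z)) \<bullet>\<^bsub>E\<^esub> (mm B (fm A x, fm A (y \<boxtimes>\<^bsub>C\<^esub> z))
        \<bullet>\<^bsub>E\<^esub> ((?X' \<boxtimes>\<^sub>2\<^bsub>E\<^esub> fc B (mm A (y, z))) \<bullet>\<^bsub>E\<^esub> (?X' \<boxtimes>\<^sub>2\<^bsub>E\<^esub> ?k')))"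
    using h by (subst B.D.vcmp_extend[OF e4]) simp_all
  finally show "mm (cmp3 C D E B A) (x \<boxtimes>\<^bsub>C\<^esub> y, z) \<bullet>\<^bsub>E\<^esub> (mm (cmp3 C D E B A) (x, y) \<boxtimes>\<^sub>2\<^bsub>E\<^esub> \<guillemotleft>fm (cmp3 C D E B A) z\<guillemotright>\<^bsub>E\<^esub>)
      = mm (cmp3 C D E B A) (x, y \<boxtimes>\<^bsub>C\<^esub> z) \<bullet>\<^bsub>E\<^esub> (\<guillemotleft>fm (cmp3 C D E B A) x\<guillemotright>\<^bsub>E\<^esub> \<boxtimes>\<^sub>2\<^bsub>E\<^esub> mm (cmp3 C D E B A) (y, z))"
    using h by (simp add: B.D.ten2_vcmp_id)
next
  fix x assume h: "x \<in> Arr C"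
  let ?X = "\<guillemotleft>fm A x\<guillemotright>\<^bsub>D\<^esub>" and ?X' = "\<guillemotleft>fm B (fm A x)\<guillemotright>\<^bsub>E\<^esub>"
  let ?u = "fu A (Unt C)" and ?v = "fu B (Unt D)"
  have e1: "mm B (fm A (Id1 C (Unt C)), fm A x) \<bullet>\<^bsub>E\<^esub> (fc B ?u \<boxtimes>\<^sub>2\<^bsub>E\<^esub> ?X') = fc B (?u \<boxtimes>\<^sub>2\<^bsub>D\<^esub> ?X) \<bullet>\<^bsub>E\<^esub> mm B (Id1 D (Unt D), fm A x)"
    using h B.mm_natural[of ?u ?X] by simp
  have e2: "fc B (mm A (Id1 C (Unt C), x)) \<bullet>\<^bsub>E\<^esub> fc B (?u \<boxtimes>\<^sub>2\<^bsub>D\<^esub> ?X) = ?X'"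
    using h by (simp add: B.fc_vcmp[symmetric] A.mm_unit_left)
  have "fc B (mm A (Id1 C (Unt C), x)) \<bullet>\<^bsub>E\<^esub> (mm B (fm A (Id1 C (Unt C)), fm A x)
        \<bullet>\<^bsub>E\<^esub> ((fc B ?u \<boxtimes>\<^sub>2\<^bsub>E\<^esub> ?X') \<bullet>\<^bsub>E\<^esub> (?v \<boxtimes>\<^sub>2\<^bsub>E\<^esub> ?X'))) = ?X'"
    using h by (subst B.D.vcmp_extend[OF e1]) (simp_all add: B.mm_unit_left e2)
  then show "mm (cmp3 C D E B A) (Id1 C (Unt C), x) \<bullet>\<^bsub>E\<^esub> (fu (cmp3 C D E B A) (Unt C) \<boxtimes>\<^sub>2\<^bsub>E\<^esub> \<guillemotleft>fm (cmp3 C D E B A) x\<guillemotright>\<^bsub>E\<^esub>)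
      = \<guillemotleft>fm (cmp3 C D E B A) x\<guillemotright>\<^bsub>E\<^esub>"
    using h by (simp add: B.D.ten2_vcmp_id)
  have e1: "mm B (fm A x, fm A (Id1 C (Unt C))) \<bullet>\<^bsub>E\<^esub> (?X' \<boxtimes>\<^sub>2\<^bsub>E\<^esub> fc B ?u) = fc B (?X \<boxtimes>\<^sub>2\<^bsub>D\<^esub> ?u) \<bullet>\<^bsub>E\<^esub> mm B (fm A x, Id1 D (Unt D))"
    using h B.mm_natural[of ?X ?u] by simp
  have e2: "fc B (mm A (x, Id1 C (Unt C))) \<bullet>\<^bsub>E\<^esub> fc B (?X \<boxtimes>\<^sub>2\<^bsub>D\<^esub> ?u) = ?X'"
    using h by (simp add: B.fc_vcmp[symmetric] A.mm_unit_right)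
  have "fc B (mm A (x, Id1 C (Unt C))) \<bullet>\<^bsub>E\<^esub> (mm B (fm A x, fm A (Id1 C (Unt C)))
        \<bullet>\<^bsub>E\<^esub> ((?X' \<boxtimes>\<^sub>2\<^bsub>E\<^esub> fc B ?u) \<bullet>\<^bsub>E\<^esub> (?X' \<boxtimes>\<^sub>2\<^bsub>E\<^esub> ?v))) = ?X'"
    using h by (subst B.D.vcmp_extend[OF e1]) (simp_all add: B.mm_unit_right e2)
  then show "mm (cmp3 C D E B A) (x, Id1 C (Unt C)) \<bullet>\<^bsub>E\<^esub> (\<guillemotleft>fm (cmp3 C D E B A) x\<guillemotright>\<^bsub>E\<^esub> \<boxtimes>\<^sub>2\<^bsub>E\<^esub> fu (cmp3 C D E B A) (Unt C))
      = \<guillemotleft>fm (cmp3 C D E B A) x\<guillemotright>\<^bsub>E\<^esub>"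
    using h by (simp add: B.D.ten2_vcmp_id)
qed

end

text \<open>Extensionality reduces equality to the values on cells; the remaining fields are functions of
  the values on 0-cells and of \<open>A\<^sup>1\<close>.\<close>

lemma (in mon_fun) mon_fun_eqI:
  assumes B: "mon_fun C D B"
    and "\<And>a. a \<in> Obj C \<Longrightarrow> fo A a = fo B a" "\<And>x. x \<in> Arr C \<Longrightarrow> fm A x = fm B x" "\<And>f. f \<in> Cel C \<Longrightarrow> fc A f = fc B f"
    and "\<And>a. a \<in> Obj C \<Longrightarrow> fu A a = fu B a"
    and "\<And>x y. \<lbrakk>x \<in> Arr C; y \<in> Arr C; Cod C x = Dom C y\<rbrakk> \<Longrightarrow> fp A (y, x) = fp B (y, x)"
    and "\<And>x y. \<lbrakk>x \<in> Arr C; y \<in> Arr C\<rbrakk> \<Longrightarrow> mm A (x, y) = mm B (x, y)"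
  shows "A = B"
proof -
  interpret B: mon_fun C D B by fact
  have eq: "fo A = fo B" "fm A = fm B" "fc A = fc B" "fu A = fu B"
    by (rule extensionalityI, (rule pfun B.pfun)+, use assms in blast)+
  have fp: "fp A = fp B"
    by (rule extensionalityI[OF pfun(5) B.pfun(5)]) (use assms in \<open>auto simp: cpairs_def\<close>)
  have mm: "mm A = mm B"
    by (rule extensionalityI[OF mm_ext B.mm_ext]) (use assms in auto)
  show ?thesis
    by (rule threefun.equality)
      (simp_all add: eq fp mm mu_eq B.mu_eq io_eq B.io_eq im_eq B.im_eq om_eq B.om_eq el_eq B.el_eq ar_eq B.ar_eq)
qed

lemma (in mon_fun) cmp3_unit:
  "cmp3 C C D A (idfun3 C) = A" "cmp3 C D D (idfun3 D) A = A"
proof -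
  interpret P: mon_fun_pair C C D "idfun3 C" A
    by (intro mon_fun_pair.intro C.mon_fun_idfun3 mon_fun_axioms)
  interpret Q: mon_fun_pair C D D A "idfun3 D"
    by (intro mon_fun_pair.intro D.mon_fun_idfun3 mon_fun_axioms)
  show "cmp3 C C D A (idfun3 C) = A"
    by (rule sym, rule mon_fun_eqI[OF P.mon_fun_cmp3]) simp_all
  show "cmp3 C D D (idfun3 D) A = A"
    by (rule sym, rule mon_fun_eqI[OF Q.mon_fun_cmp3]) simp_all
qed

lemma cmp3_assoc:
  assumes "mon_fun C D A" "mon_fun D E B" "mon_fun E F L"
  shows "cmp3 C E F L (cmp3 C D E B A) = cmp3 C D F (cmp3 D E F L B) A"
proof -
  interpret P: mon_fun_pair C D E A B by (intro mon_fun_pair.intro assms)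
  interpret Q: mon_fun_pair D E F B L by (intro mon_fun_pair.intro assms)
  interpret R: mon_fun_pair C E F "cmp3 C D E B A" L
    by (intro mon_fun_pair.intro assms P.mon_fun_cmp3)
  interpret S: mon_fun_pair C D F A "cmp3 D E F L B"
    by (intro mon_fun_pair.intro assms Q.mon_fun_cmp3)
  show ?thesis
    by (rule mon_fun.mon_fun_eqI[OF R.mon_fun_cmp3 S.mon_fun_cmp3]) (simp_all add: Q.B.fc_vcmp)
qed

section \<open>Normalised transformations are monoidal icons\<close>

locale icon_data = A: mon_fun C D A + B: mon_fun C D B
  for C :: "('o,'m,'t,'y) gray_scheme" and D :: "('p,'n,'u,'z) gray_scheme"
    and A B :: "('o,'m,'t,'p,'n,'u) threefun" +
  fixes H :: "('o,'m,'p,'n,'u) trans"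
  assumes fo_eq: "fo B = fo A"
    and ts_eq [simp]: "ts H = Unt D"
    and tc_eq: "tc H = (\<lambda>a \<in> Obj C. idadj D (fo A a))"
    and t1_eq [simp]: "t1 H = \<guillemotleft>Id1 D (Unt D)\<guillemotright>\<^bsub>D\<^esub>"
    and t2_eq: "t2 H = (\<lambda>(a, b) \<in> Obj C \<times> Obj C. \<guillemotleft>Id1 D (fo A a \<odot>\<^bsub>D\<^esub> fo A b)\<guillemotright>\<^bsub>D\<^esub>)"
    and tm [simp]: "\<And>x. x \<in> Arr C \<Longrightarrow> iso2 D (tm H x)"
      "\<And>x. x \<in> Arr C \<Longrightarrow> Src D (tm H x) = fm A x"
      "\<And>x. x \<in> Arr C \<Longrightarrow> Tgt D (tm H x) = fm B x"
begin

lemma data [simp]: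
  "a \<in> Obj C \<Longrightarrow> fo B a = fo A a"
  "a \<in> Obj C \<Longrightarrow> tc H a = idadj D (fo A a)"
  "a \<in> Obj C \<Longrightarrow> b \<in> Obj C \<Longrightarrow> t2 H (a, b) = \<guillemotleft>Id1 D (fo A a \<odot>\<^bsub>D\<^esub> fo A b)\<guillemotright>\<^bsub>D\<^esub>"
  by (simp_all add: fo_eq tc_eq t2_eq)

lemma trans_data_iff: "trans_data C D A B H \<longleftrightarrow> tm H \<in> extensional (Arr C)"
  unfolding trans_data_def
  by (simp add: tc_eq t2_eq adj_equiv_def arr_def icell_iff cong: imp_cong)

text \<open>All interchangers in the axiom for \<open>\<eta>\<^sup>2\<close> have an identity 1-cell as an argument, so the remaining
  two whiskered 2-cells \<open>\<eta>\<^sub>x\<close> and \<open>\<eta>\<^sub>y\<close> merge into \<open>\<eta>\<^sub>x \<boxtimes>\<^sub>2 \<eta>\<^sub>y\<close>.  The axiom for \<open>\<eta>\<^sup>1\<close> becomes an instance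
  of the unit axiom.\<close>

lemma trans_natural_iff: "trans_natural C D A B H \<longleftrightarrow>
    (\<forall>f \<in> Cel C. fc B f \<bullet>\<^bsub>D\<^esub> tm H (Src C f) = tm H (Tgt C f) \<bullet>\<^bsub>D\<^esub> fc A f)
  \<and> (\<forall>x \<in> Arr C. \<forall>y \<in> Arr C. Dom C y = Cod C x \<longrightarrow>
       tm H (y \<cdot>\<^bsub>C\<^esub> x) \<bullet>\<^bsub>D\<^esub> fp A (y, x) = fp B (y, x) \<bullet>\<^bsub>D\<^esub> (tm H y \<star>\<^bsub>D\<^esub> tm H x))
  \<and> (\<forall>a \<in> Obj C. tm H (Id1 C a) \<bullet>\<^bsub>D\<^esub> fu A a = fu B a)
  \<and> (\<forall>x \<in> Arr C. \<forall>y \<in> Arr C. tm H (x \<boxtimes>\<^bsub>C\<^esub> y) \<bullet>\<^bsub>D\<^esub> mm A (x, y) = mm B (x, y) \<bullet>\<^bsub>D\<^esub> (tm H x \<boxtimes>\<^sub>2\<^bsub>D\<^esub> tm H y))"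
proof -
  have 1: "(\<guillemotleft>fm B y\<guillemotright>\<^bsub>D\<^esub> \<star>\<^bsub>D\<^esub> tm H x) \<bullet>\<^bsub>D\<^esub> (tm H y \<star>\<^bsub>D\<^esub> \<guillemotleft>fm A x\<guillemotright>\<^bsub>D\<^esub>) = tm H y \<star>\<^bsub>D\<^esub> tm H x"
    if "x \<in> Arr C" "y \<in> Arr C" "Dom C y = Cod C x" for x y
    using that A.D.hcmp_split(1)[of "tm H x" "tm H y"] by simp
  have 2: "(\<guillemotleft>fm B x \<rtimes>\<^bsub>D\<^esub> fo A (Cod C y)\<guillemotright>\<^bsub>D\<^esub> \<star>\<^bsub>D\<^esub> (fo A (Dom C x) \<ltimes>\<^sub>2\<^bsub>D\<^esub> tm H y))
      \<bullet>\<^bsub>D\<^esub> ((tm H x \<rtimes>\<^sub>2\<^bsub>D\<^esub> fo A (Cod C y)) \<star>\<^bsub>D\<^esub> \<guillemotleft>fo A (Dom C x) \<ltimes>\<^bsub>D\<^esub> fm A y\<guillemotright>\<^bsub>D\<^esub>) = tm H x \<boxtimes>\<^sub>2\<^bsub>D\<^esub> tm H y"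
    if "x \<in> Arr C" "y \<in> Arr C" for x y
    using that A.D.ten2_split[of "tm H x" "tm H y"] by simp
  show ?thesis
    unfolding trans_natural_def
    by (simp add: arr_def cell_def Ball_def imp_conjL ten1_def[of D] 1 2 cong: imp_cong conj_cong)
qed

text \<open>The components \<open>\<eta>\<^sub>c\<close> and the interchangers with them in these axioms are identities.\<close>

lemma trans_axioms: "trans_axioms C D A B H"
  unfolding trans_axioms_def by simp

end

text \<open>Monoidal icons: the reduced form of normalised transformations.\<close>

locale icon = icon_data C D A B H
  for C :: "('o,'m,'t,'y) gray_scheme" and D :: "('p,'n,'u,'z) gray_scheme"
    and A B :: "('o,'m,'t,'p,'n,'u) threefun" and H :: "('o,'m,'p,'n,'u) trans" +
  assumes tm_ext: "tm H \<in> extensional (Arr C)"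
    and tm_natural: "f \<in> Cel C \<Longrightarrow> fc B f \<bullet>\<^bsub>D\<^esub> tm H (Src C f) = tm H (Tgt C f) \<bullet>\<^bsub>D\<^esub> fc A f"
    and tm_comp: "\<lbrakk>x \<in> Arr C; y \<in> Arr C; Dom C y = Cod C x\<rbrakk> \<Longrightarrow>
       tm H (y \<cdot>\<^bsub>C\<^esub> x) \<bullet>\<^bsub>D\<^esub> fp A (y, x) = fp B (y, x) \<bullet>\<^bsub>D\<^esub> (tm H y \<star>\<^bsub>D\<^esub> tm H x)"
    and tm_unit: "a \<in> Obj C \<Longrightarrow> tm H (Id1 C a) \<bullet>\<^bsub>D\<^esub> fu A a = fu B a"
    and tm_ten: "\<lbrakk>x \<in> Arr C; y \<in> Arr C\<rbrakk> \<Longrightarrow>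
       tm H (x \<boxtimes>\<^bsub>C\<^esub> y) \<bullet>\<^bsub>D\<^esub> mm A (x, y) = mm B (x, y) \<bullet>\<^bsub>D\<^esub> (tm H x \<boxtimes>\<^sub>2\<^bsub>D\<^esub> tm H y)"

lemma (in icon_data) transformation_iff: "transformation C D A B H \<longleftrightarrow> icon C D A B H"
proof -
  have "icon C D A B H \<longleftrightarrow> icon_axioms C D A B H"
    by (simp add: icon_def icon_data_axioms)
  also have "\<dots> \<longleftrightarrow> trans_data C D A B H \<and> trans_natural C D A B H"
    unfolding icon_axioms_def trans_data_iff trans_natural_iff by blast
  finally show ?thesis
    by (simp add: transformation_def trans_axioms)
qed

lemma normal_trans_iff:
  assumes "labelled G C c" "labelled G D d" "mon_fun C D A" "mon_fun C D B"
    and labA: "\<forall>g \<in> carrier G. fo A (c g) = d g" and labB: "\<forall>g \<in> carrier G. fo B (c g) = d g"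
  shows "normal_trans G c d C D A B H \<longleftrightarrow> icon C D A B H"
proof -
  interpret C: labelled G C c by fact
  interpret D: labelled G D d by fact
  interpret A: mon_fun C D A by fact
  interpret B: mon_fun C D B by fact
  have fo: "fo B = fo A"
    by (rule extensionalityI[OF B.pfun(1) A.pfun(1)]) (metis C.lab_cases labA labB)
  show ?thesis
  proof
    assume n: "normal_trans G c d C D A B H"
    then have t: "transformation C D A B H" and td: "trans_data C D A B H"
      by (simp_all add: normal_trans_def transformation_def)
    have ext: "tc H \<in> extensional (Obj C)" "t2 H \<in> extensional (Obj C \<times> Obj C)"
      using td by (simp_all add: trans_data_def)
    have ts: "ts H = Unt D" "t1 H = \<guillemotleft>Id1 D (Unt D)\<guillemotright>\<^bsub>D\<^esub>"
      using n by (simp_all add: normal_trans_def D.lab_one)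
    have tc: "tc H a = idadj D (fo A a)" if "a \<in> Obj C" for a
      using that n labA by (elim C.lab_cases) (simp add: normal_trans_def)
    have t2: "t2 H (a, b) = \<guillemotleft>Id1 D (fo A a \<odot>\<^bsub>D\<^esub> fo A b)\<guillemotright>\<^bsub>D\<^esub>" if "a \<in> Obj C" "b \<in> Obj C" for a b
      using that n labA by (elim C.lab_cases) (simp add: normal_trans_def D.lab_mult)
    have tm: "icell D (tm H x) (fm A x) (fm B x)" if x: "x \<in> Arr C" for x
    proof -
      have "icell D (tm H x) (tc1 H (Cod C x) \<cdot>\<^bsub>D\<^esub> (ts H \<ltimes>\<^bsub>D\<^esub> fm A x)) ((fm B x \<rtimes>\<^bsub>D\<^esub> ts H) \<cdot>\<^bsub>D\<^esub> tc1 H (Dom C x))"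
        using td x unfolding trans_data_def arr_def by blast
      then show ?thesis using x by (simp add: tc ts fo)
    qed
    interpret icon_data C D A B H
    proof
      show "tc H = (\<lambda>a \<in> Obj C. idadj D (fo A a))"
        by (rule extensionalityI[OF ext(1)]) (auto simp: tc)
      show "t2 H = (\<lambda>(a, b) \<in> Obj C \<times> Obj C. \<guillemotleft>Id1 D (fo A a \<odot>\<^bsub>D\<^esub> fo A b)\<guillemotright>\<^bsub>D\<^esub>)"
        by (rule extensionalityI[OF ext(2)]) (auto simp: t2)
    qed (use tm in \<open>simp_all add: fo ts icell_iff\<close>)
    show "icon C D A B H" using t by (simp add: transformation_iff)
  next
    assume i: "icon C D A B H"
    then interpret icon C D A B H .
    have "transformation C D A B H" using i by (simp add: transformation_iff)
    then show "normal_trans G c d C D A B H"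
      using labA by (simp add: normal_trans_def D.lab_one D.lab_mult)
  qed
qed

lemma icon_eqI:
  assumes "icon C D A B H" "icon C D A B K" "\<And>x. x \<in> Arr C \<Longrightarrow> tm H x = tm K x"
  shows "H = K"
proof -
  interpret H: icon C D A B H by fact
  interpret K: icon C D A B K by fact
  have "tm H = tm K" by (rule extensionalityI[OF H.tm_ext K.tm_ext assms(3)])
  then show ?thesis
    by (intro trans.equality) (simp_all add: H.tc_eq K.tc_eq H.t2_eq K.t2_eq)
qed

lemma (in mon_fun) icon_idtrans: "icon C D A A (idtrans C D A)"
  by unfold_locales
    (simp_all add: idtrans_def restrict_def fun_eq_iff extensional_def)

lemma (in mon_fun) tm_idtrans [simp]: "x \<in> Arr C \<Longrightarrow> tm (idtrans C D A) x = \<guillemotleft>fm A x\<guillemotright>\<^bsub>D\<^esub>"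
  by (simp add: idtrans_def)

text \<open>The axioms for a composite paste those for \<open>H\<close> and for \<open>K\<close>.\<close>

locale icon_pair = H: icon C D A B H + K: icon C D B L K
  for C :: "('o,'m,'t,'y) gray_scheme" and D :: "('p,'n,'u,'z) gray_scheme"
    and A B L :: "('o,'m,'t,'p,'n,'u) threefun" and H K :: "('o,'m,'p,'n,'u) trans"
begin

lemma tm_cmptrans [simp]: "x \<in> Arr C \<Longrightarrow> tm (cmptrans C D A B L K H) x = tm K x \<bullet>\<^bsub>D\<^esub> tm H x"
  by (simp add: cmptrans_def)

lemma icon_cmptrans: "icon C D A L (cmptrans C D A B L K H)"
proof
  show "fo L = fo A" by (simp add: K.fo_eq H.fo_eq)
  show "ts (cmptrans C D A B L K H) = Unt D" "t1 (cmptrans C D A B L K H) = \<guillemotleft>Id1 D (Unt D)\<guillemotright>\<^bsub>D\<^esub>"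
    by (simp_all add: cmptrans_def)
  show "tc (cmptrans C D A B L K H) = (\<lambda>a \<in> Obj C. idadj D (fo A a))"
    by (rule ext) (simp add: cmptrans_def cmpadj_def rwadj_def lwadj_def restrict_def idadj_def[of D])
  show "t2 (cmptrans C D A B L K H) = (\<lambda>(a, b) \<in> Obj C \<times> Obj C. \<guillemotleft>Id1 D (fo A a \<odot>\<^bsub>D\<^esub> fo A b)\<guillemotright>\<^bsub>D\<^esub>)"
    by (rule ext) (auto simp: cmptrans_def restrict_def)
  show "tm (cmptrans C D A B L K H) \<in> extensional (Arr C)" by (simp add: cmptrans_def)
next
  fix f assume h: "f \<in> Cel C"
  have "fc L f \<bullet>\<^bsub>D\<^esub> (tm K (Src C f) \<bullet>\<^bsub>D\<^esub> tm H (Src C f)) = tm K (Tgt C f) \<bullet>\<^bsub>D\<^esub> (fc B f \<bullet>\<^bsub>D\<^esub> tm H (Src C f))"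
    using h by (subst H.A.D.vcmp_extend[OF K.tm_natural]) simp_all
  then show "fc L f \<bullet>\<^bsub>D\<^esub> tm (cmptrans C D A B L K H) (Src C f) = tm (cmptrans C D A B L K H) (Tgt C f) \<bullet>\<^bsub>D\<^esub> fc A f"
    using h by (simp add: H.tm_natural)
next
  fix x y assume h: "x \<in> Arr C" "y \<in> Arr C" "Dom C y = Cod C x"
  have "tm K (y \<cdot>\<^bsub>C\<^esub> x) \<bullet>\<^bsub>D\<^esub> (fp B (y, x) \<bullet>\<^bsub>D\<^esub> (tm H y \<star>\<^bsub>D\<^esub> tm H x))
      = fp L (y, x) \<bullet>\<^bsub>D\<^esub> ((tm K y \<star>\<^bsub>D\<^esub> tm K x) \<bullet>\<^bsub>D\<^esub> (tm H y \<star>\<^bsub>D\<^esub> tm H x))"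
    using h by (subst H.A.D.vcmp_extend[OF K.tm_comp]) simp_all
  then show "tm (cmptrans C D A B L K H) (y \<cdot>\<^bsub>C\<^esub> x) \<bullet>\<^bsub>D\<^esub> fp A (y, x)
      = fp L (y, x) \<bullet>\<^bsub>D\<^esub> (tm (cmptrans C D A B L K H) y \<star>\<^bsub>D\<^esub> tm (cmptrans C D A B L K H) x)"
    using h by (simp add: H.tm_comp H.A.D.interchange)
next
  fix a assume h: "a \<in> Obj C"
  then show "tm (cmptrans C D A B L K H) (Id1 C a) \<bullet>\<^bsub>D\<^esub> fu A a = fu L a"
    by (simp add: H.tm_unit K.tm_unit)
next
  fix x y assume h: "x \<in> Arr C" "y \<in> Arr C"
  have "tm K (x \<boxtimes>\<^bsub>C\<^esub> y) \<bullet>\<^bsub>D\<^esub> (mm B (x, y) \<bullet>\<^bsub>D\<^esub> (tm H x \<boxtimes>\<^sub>2\<^bsub>D\<^esub> tm H y))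
      = mm L (x, y) \<bullet>\<^bsub>D\<^esub> ((tm K x \<boxtimes>\<^sub>2\<^bsub>D\<^esub> tm K y) \<bullet>\<^bsub>D\<^esub> (tm H x \<boxtimes>\<^sub>2\<^bsub>D\<^esub> tm H y))"
    using h by (subst H.A.D.vcmp_extend[OF K.tm_ten]) simp_all
  then show "tm (cmptrans C D A B L K H) (x \<boxtimes>\<^bsub>C\<^esub> y) \<bullet>\<^bsub>D\<^esub> mm A (x, y)
      = mm L (x, y) \<bullet>\<^bsub>D\<^esub> (tm (cmptrans C D A B L K H) x \<boxtimes>\<^sub>2\<^bsub>D\<^esub> tm (cmptrans C D A B L K H) y)"
    using h by (simp add: H.tm_ten H.A.D.ten2_vcmp)
qed simp_all

end

text \<open>The image under \<open>L\<close> of an icon: the axioms of \<open>H\<close> hold inside \<open>L\<close>, and naturality of the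
  constraints of \<open>L\<close> commutes them past the images of the components of \<open>H\<close>.\<close>

lemma icon_postwhisk:
  assumes "icon C D A B H" "mon_fun D E L"
  shows "icon C E (cmp3 C D E L A) (cmp3 C D E L B) (postwhisk C D E L A H)"
    and "x \<in> Arr C \<Longrightarrow> tm (postwhisk C D E L A H) x = fc L (tm H x)"
proof -
  interpret H: icon C D A B H by fact
  interpret P: mon_fun_pair C D E A L by (intro mon_fun_pair.intro H.A.mon_fun_axioms assms)
  interpret Q: mon_fun_pair C D E B L by (intro mon_fun_pair.intro H.B.mon_fun_axioms assms)
  interpret P': mon_fun C E "cmp3 C D E L A" by (rule P.mon_fun_cmp3)
  interpret Q': mon_fun C E "cmp3 C D E L B" by (rule Q.mon_fun_cmp3)
  show [simp]: "tm (postwhisk C D E L A H) x = fc L (tm H x)" if "x \<in> Arr C" for x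
    using that by (simp add: postwhisk_def)
  show "icon C E (cmp3 C D E L A) (cmp3 C D E L B) (postwhisk C D E L A H)"
  proof
    show "fo (cmp3 C D E L B) = fo (cmp3 C D E L A)" by (simp add: cmp3_def H.fo_eq)
    show "tc (postwhisk C D E L A H) = (\<lambda>a \<in> Obj C. idadj E (fo (cmp3 C D E L A) a))"
      "ts (postwhisk C D E L A H) = Unt E"
      by (simp_all add: postwhisk_def restrict_def fun_eq_iff)
    show "t1 (postwhisk C D E L A H) = \<guillemotleft>Id1 E (Unt E)\<guillemotright>\<^bsub>E\<^esub>"
      using P.unloop_id[of "Unt D"] by (simp add: postwhisk_def)
    show "t2 (postwhisk C D E L A H)
        = (\<lambda>(a, b) \<in> Obj C \<times> Obj C. \<guillemotleft>Id1 E (fo (cmp3 C D E L A) a \<odot>\<^bsub>E\<^esub> fo (cmp3 C D E L A) b)\<guillemotright>\<^bsub>E\<^esub>)"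
      by (rule ext) (auto simp: postwhisk_def restrict_def)
    show "tm (postwhisk C D E L A H) \<in> extensional (Arr C)" by (simp add: postwhisk_def)
  next
    fix f assume "f \<in> Cel C"
    then show "fc (cmp3 C D E L B) f \<bullet>\<^bsub>E\<^esub> tm (postwhisk C D E L A H) (Src C f)
        = tm (postwhisk C D E L A H) (Tgt C f) \<bullet>\<^bsub>E\<^esub> fc (cmp3 C D E L A) f"
      by (simp add: P.B.fc_vcmp[symmetric] H.tm_natural)
  next
    fix x y assume h: "x \<in> Arr C" "y \<in> Arr C" "Dom C y = Cod C x"
    have e1: "fc L (tm H (y \<cdot>\<^bsub>C\<^esub> x)) \<bullet>\<^bsub>E\<^esub> fc L (fp A (y, x)) = fc L (fp B (y, x)) \<bullet>\<^bsub>E\<^esub> fc L (tm H y \<star>\<^bsub>D\<^esub> tm H x)"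
      using h by (simp add: P.B.fc_vcmp[symmetric] H.tm_comp)
    have e2: "fc L (tm H y \<star>\<^bsub>D\<^esub> tm H x) \<bullet>\<^bsub>E\<^esub> fp L (fm A y, fm A x) = fp L (fm B y, fm B x) \<bullet>\<^bsub>E\<^esub> (fc L (tm H y) \<star>\<^bsub>E\<^esub> fc L (tm H x))"
      using h P.B.fp_natural[of "tm H x" "tm H y"] by simp
    show "tm (postwhisk C D E L A H) (y \<cdot>\<^bsub>C\<^esub> x) \<bullet>\<^bsub>E\<^esub> fp (cmp3 C D E L A) (y, x)
        = fp (cmp3 C D E L B) (y, x) \<bullet>\<^bsub>E\<^esub> (tm (postwhisk C D E L A H) y \<star>\<^bsub>E\<^esub> tm (postwhisk C D E L A H) x)"
      using h by (simp, subst P.B.D.vcmp_extend[OF e1]) (simp_all add: e2)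
  next
    fix a assume h: "a \<in> Obj C"
    have e1: "fc L (tm H (Id1 C a)) \<bullet>\<^bsub>E\<^esub> fc L (fu A a) = \<guillemotleft>fm L (fm B (Id1 C a))\<guillemotright>\<^bsub>E\<^esub> \<bullet>\<^bsub>E\<^esub> fc L (fu B a)"
      using h by (simp add: P.B.fc_vcmp[symmetric] H.tm_unit)
    show "tm (postwhisk C D E L A H) (Id1 C a) \<bullet>\<^bsub>E\<^esub> fu (cmp3 C D E L A) a = fu (cmp3 C D E L B) a"
      using h by (simp, subst P.B.D.vcmp_extend[OF e1]) simp_all
  next
    fix x y assume h: "x \<in> Arr C" "y \<in> Arr C"
    have e1: "fc L (tm H (x \<boxtimes>\<^bsub>C\<^esub> y)) \<bullet>\<^bsub>E\<^esub> fc L (mm A (x, y)) = fc L (mm B (x, y)) \<bullet>\<^bsub>E\<^esub> fc L (tm H x \<boxtimes>\<^sub>2\<^bsub>D\<^esub> tm H y)"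
      using h by (simp add: P.B.fc_vcmp[symmetric] H.tm_ten)
    have e2: "fc L (tm H x \<boxtimes>\<^sub>2\<^bsub>D\<^esub> tm H y) \<bullet>\<^bsub>E\<^esub> mm L (fm A x, fm A y) = mm L (fm B x, fm B y) \<bullet>\<^bsub>E\<^esub> (fc L (tm H x) \<boxtimes>\<^sub>2\<^bsub>E\<^esub> fc L (tm H y))"
      using h P.B.mm_natural[of "tm H x" "tm H y"] by simp
    show "tm (postwhisk C D E L A H) (x \<boxtimes>\<^bsub>C\<^esub> y) \<bullet>\<^bsub>E\<^esub> mm (cmp3 C D E L A) (x, y)
        = mm (cmp3 C D E L B) (x, y) \<bullet>\<^bsub>E\<^esub> (tm (postwhisk C D E L A H) x \<boxtimes>\<^sub>2\<^bsub>E\<^esub> tm (postwhisk C D E L A H) y)"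
      using h by (simp, subst P.B.D.vcmp_extend[OF e1]) (simp_all add: e2)
  qed simp_all
qed

text \<open>Here naturality of \<open>K\<close> with respect to the constraint 2-cells of \<open>A\<close> is used.\<close>

lemma icon_prewhisk:
  assumes "mon_fun C D A" "icon D E B L K"
  shows "icon C E (cmp3 C D E B A) (cmp3 C D E L A) (prewhisk C K A)"
    and "x \<in> Arr C \<Longrightarrow> tm (prewhisk C K A) x = tm K (fm A x)"
proof -
  interpret K: icon D E B L K by fact
  interpret P: mon_fun_pair C D E A B by (intro mon_fun_pair.intro K.A.mon_fun_axioms assms)
  interpret Q: mon_fun_pair C D E A L by (intro mon_fun_pair.intro K.B.mon_fun_axioms assms)
  interpret P': mon_fun C E "cmp3 C D E B A" by (rule P.mon_fun_cmp3)
  interpret Q': mon_fun C E "cmp3 C D E L A" by (rule Q.mon_fun_cmp3)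
  show [simp]: "tm (prewhisk C K A) x = tm K (fm A x)" if "x \<in> Arr C" for x
    using that by (simp add: prewhisk_def)
  show "icon C E (cmp3 C D E B A) (cmp3 C D E L A) (prewhisk C K A)"
  proof
    show "fo (cmp3 C D E L A) = fo (cmp3 C D E B A)" by (simp add: cmp3_def K.fo_eq)
    show "tc (prewhisk C K A) = (\<lambda>a \<in> Obj C. idadj E (fo (cmp3 C D E B A) a))"
      "ts (prewhisk C K A) = Unt E" "t1 (prewhisk C K A) = \<guillemotleft>Id1 E (Unt E)\<guillemotright>\<^bsub>E\<^esub>"
      by (simp_all add: prewhisk_def restrict_def fun_eq_iff)
    show "t2 (prewhisk C K A)
        = (\<lambda>(a, b) \<in> Obj C \<times> Obj C. \<guillemotleft>Id1 E (fo (cmp3 C D E B A) a \<odot>\<^bsub>E\<^esub> fo (cmp3 C D E B A) b)\<guillemotright>\<^bsub>E\<^esub>)"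
      by (rule ext) (auto simp: prewhisk_def restrict_def)
    show "tm (prewhisk C K A) \<in> extensional (Arr C)" by (simp add: prewhisk_def)
  next
    fix f assume "f \<in> Cel C"
    then show "fc (cmp3 C D E L A) f \<bullet>\<^bsub>E\<^esub> tm (prewhisk C K A) (Src C f)
        = tm (prewhisk C K A) (Tgt C f) \<bullet>\<^bsub>E\<^esub> fc (cmp3 C D E B A) f"
      using K.tm_natural[of "fc A f"] by simp
  next
    fix x y assume h: "x \<in> Arr C" "y \<in> Arr C" "Dom C y = Cod C x"
    have e1: "tm K (fm A (y \<cdot>\<^bsub>C\<^esub> x)) \<bullet>\<^bsub>E\<^esub> fc B (fp A (y, x)) = fc L (fp A (y, x)) \<bullet>\<^bsub>E\<^esub> tm K (fm A y \<cdot>\<^bsub>D\<^esub> fm A x)"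
      using h K.tm_natural[of "fp A (y, x)"] by simp
    show "tm (prewhisk C K A) (y \<cdot>\<^bsub>C\<^esub> x) \<bullet>\<^bsub>E\<^esub> fp (cmp3 C D E B A) (y, x)
        = fp (cmp3 C D E L A) (y, x) \<bullet>\<^bsub>E\<^esub> (tm (prewhisk C K A) y \<star>\<^bsub>E\<^esub> tm (prewhisk C K A) x)"
      using h by (simp, subst K.A.D.vcmp_extend[OF e1]) (simp_all add: K.tm_comp)
  next
    fix a assume h: "a \<in> Obj C"
    have e1: "tm K (fm A (Id1 C a)) \<bullet>\<^bsub>E\<^esub> fc B (fu A a) = fc L (fu A a) \<bullet>\<^bsub>E\<^esub> tm K (Id1 D (fo A a))"
      using h K.tm_natural[of "fu A a"] by simp
    show "tm (prewhisk C K A) (Id1 C a) \<bullet>\<^bsub>E\<^esub> fu (cmp3 C D E B A) a = fu (cmp3 C D E L A) a"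
      using h by (simp, subst K.A.D.vcmp_extend[OF e1]) (simp_all add: K.tm_unit)
  next
    fix x y assume h: "x \<in> Arr C" "y \<in> Arr C"
    have e1: "tm K (fm A (x \<boxtimes>\<^bsub>C\<^esub> y)) \<bullet>\<^bsub>E\<^esub> fc B (mm A (x, y)) = fc L (mm A (x, y)) \<bullet>\<^bsub>E\<^esub> tm K (fm A x \<boxtimes>\<^bsub>D\<^esub> fm A y)"
      using h K.tm_natural[of "mm A (x, y)"] by simp
    show "tm (prewhisk C K A) (x \<boxtimes>\<^bsub>C\<^esub> y) \<bullet>\<^bsub>E\<^esub> mm (cmp3 C D E B A) (x, y)
        = mm (cmp3 C D E L A) (x, y) \<bullet>\<^bsub>E\<^esub> (tm (prewhisk C K A) x \<boxtimes>\<^sub>2\<^bsub>E\<^esub> tm (prewhisk C K A) y)"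
      using h by (simp, subst K.A.D.vcmp_extend[OF e1]) (simp_all add: K.tm_ten)
  qed simp_all
qed

lemma icon_htrans:
  assumes "icon C D A B H" "icon D E A' B' K"
  shows "icon C E (cmp3 C D E A' A) (cmp3 C D E B' B) (htrans C D E A B A' B' K H)"
    and "x \<in> Arr C \<Longrightarrow> tm (htrans C D E A B A' B' K H) x = tm K (fm B x) \<bullet>\<^bsub>E\<^esub> fc A' (tm H x)"
proof -
  interpret H: icon C D A B H by fact
  interpret K: icon D E A' B' K by fact
  interpret P: icon_pair C E "cmp3 C D E A' A" "cmp3 C D E A' B" "cmp3 C D E B' B" "postwhisk C D E A' A H" "prewhisk C K B"
    by (intro icon_pair.intro icon_postwhisk icon_prewhisk assms K.A.mon_fun_axioms H.B.mon_fun_axioms)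
  show "icon C E (cmp3 C D E A' A) (cmp3 C D E B' B) (htrans C D E A B A' B' K H)"
    unfolding htrans_def by (rule P.icon_cmptrans)
  show "x \<in> Arr C \<Longrightarrow> tm (htrans C D E A B A' B' K H) x = tm K (fm B x) \<bullet>\<^bsub>E\<^esub> fc A' (tm H x)"
    unfolding htrans_def
    using assms K.A.mon_fun_axioms H.B.mon_fun_axioms by (simp add: icon_prewhisk icon_postwhisk)
qed

section \<open>The strict 2-category of labelled Gray-monoids\<close>

lemma cmptrans_idtrans:
  assumes "icon C D A B H"
  shows "cmptrans C D A A B H (idtrans C D A) = H" "cmptrans C D A B B (idtrans C D B) H = H"
proof -
  interpret H: icon C D A B H by fact
  interpret P: icon_pair C D A A B "idtrans C D A" H
    by (intro icon_pair.intro assms H.A.icon_idtrans)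
  interpret Q: icon_pair C D A B B H "idtrans C D B"
    by (intro icon_pair.intro assms H.B.icon_idtrans)
  show "cmptrans C D A A B H (idtrans C D A) = H"
    by (rule icon_eqI[OF P.icon_cmptrans assms]) simp
  show "cmptrans C D A B B (idtrans C D B) H = H"
    by (rule icon_eqI[OF Q.icon_cmptrans assms]) simp
qed

lemma cmptrans_assoc:
  assumes "icon C D A B H" "icon C D B L K" "icon C D L M J"
  shows "cmptrans C D A B M (cmptrans C D B L M J K) H = cmptrans C D A L M J (cmptrans C D A B L K H)"
proof -
  interpret P: icon_pair C D A B L H K by (intro icon_pair.intro assms)
  interpret Q: icon_pair C D B L M K J by (intro icon_pair.intro assms)
  interpret R: icon_pair C D A B M H "cmptrans C D B L M J K"
    by (intro icon_pair.intro assms Q.icon_cmptrans)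
  interpret S: icon_pair C D A L M "cmptrans C D A B L K H" J
    by (intro icon_pair.intro assms P.icon_cmptrans)
  show ?thesis
    by (rule icon_eqI[OF R.icon_cmptrans S.icon_cmptrans]) simp
qed

lemma htrans_idtrans:
  assumes "mon_fun C D A" "mon_fun D E B"
  shows "htrans C D E A A B B (idtrans D E B) (idtrans C D A) = idtrans C E (cmp3 C D E B A)"
proof -
  interpret mon_fun_pair C D E A B by (intro mon_fun_pair.intro assms)
  interpret P: mon_fun C E "cmp3 C D E B A" by (rule mon_fun_cmp3)
  show ?thesis
    by (rule icon_eqI[OF icon_htrans(1)[OF A.icon_idtrans B.icon_idtrans] P.icon_idtrans])
      (simp add: icon_htrans(2)[OF A.icon_idtrans B.icon_idtrans])
qed

lemma htrans_unit:
  assumes H: "icon C D A B H"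
  shows "htrans C C D (idfun3 C) (idfun3 C) A B H (idtrans C C (idfun3 C)) = H"
    and "htrans C D D A B (idfun3 D) (idfun3 D) (idtrans D D (idfun3 D)) H = H"
proof -
  interpret H: icon C D A B H by fact
  interpret IC: mon_fun C C "idfun3 C" by (rule H.A.C.mon_fun_idfun3)
  interpret ID: mon_fun D D "idfun3 D" by (rule H.A.D.mon_fun_idfun3)
  have 1: "icon C D A B (htrans C C D (idfun3 C) (idfun3 C) A B H (idtrans C C (idfun3 C)))"
    using icon_htrans(1)[OF IC.icon_idtrans H] by (simp add: H.A.cmp3_unit H.B.cmp3_unit)
  show "htrans C C D (idfun3 C) (idfun3 C) A B H (idtrans C C (idfun3 C)) = H"
    by (rule icon_eqI[OF 1 H]) (simp add: icon_htrans(2)[OF IC.icon_idtrans H])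
  have 2: "icon C D A B (htrans C D D A B (idfun3 D) (idfun3 D) (idtrans D D (idfun3 D)) H)"
    using icon_htrans(1)[OF H ID.icon_idtrans] by (simp add: H.A.cmp3_unit H.B.cmp3_unit)
  show "htrans C D D A B (idfun3 D) (idfun3 D) (idtrans D D (idfun3 D)) H = H"
    by (rule icon_eqI[OF 2 H]) (simp add: icon_htrans(2)[OF H ID.icon_idtrans])
qed

lemma htrans_assoc:
  assumes H: "icon C D A B H" and K: "icon D E A' B' K" and M: "icon E F A'' B'' M"
  shows "htrans C D F A B (cmp3 D E F A'' A') (cmp3 D E F B'' B') (htrans D E F A' B' A'' B'' M K) H
    = htrans C E F (cmp3 C D E A' A) (cmp3 C D E B' B) A'' B'' M (htrans C D E A B A' B' K H)"
    (is "?l = ?r")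
proof -
  interpret H: icon C D A B H by fact
  interpret K: icon D E A' B' K by fact
  interpret M: icon E F A'' B'' M by fact
  interpret P: mon_fun_pair D E F A' A'' by (intro mon_fun_pair.intro K.A.mon_fun_axioms M.A.mon_fun_axioms)
  interpret Q: mon_fun_pair C D E B B' by (intro mon_fun_pair.intro H.B.mon_fun_axioms K.B.mon_fun_axioms)
  note 1 = icon_htrans[OF H icon_htrans(1)[OF K M]]
  note 2 = icon_htrans[OF icon_htrans(1)[OF H K] M]
  have a: "cmp3 C D F (cmp3 D E F A'' A') A = cmp3 C E F A'' (cmp3 C D E A' A)"
    "cmp3 C D F (cmp3 D E F B'' B') B = cmp3 C E F B'' (cmp3 C D E B' B)"
    by (rule cmp3_assoc[symmetric];
        fact H.A.mon_fun_axioms K.A.mon_fun_axioms M.A.mon_fun_axioms H.B.mon_fun_axioms K.B.mon_fun_axioms M.B.mon_fun_axioms)+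
  show ?thesis
  proof (rule icon_eqI[OF 1(1) 2(1)[folded a]])
    fix x assume "x \<in> Arr C"
    then show "tm ?l x = tm ?r x"
      by (simp add: 1(2) 2(2) icon_htrans(2)[OF H K] icon_htrans(2)[OF K M] M.A.fc_vcmp)
  qed
qed

text \<open>The components differ in the order of \<open>K\<close> and \<open>H'\<close>, which naturality of \<open>K\<close> with respect to the
  2-cell \<open>H'\<^sub>x\<close> exchanges.\<close>

lemma htrans_cmptrans:
  assumes H: "icon C D A B H" and H': "icon C D B L H'" and K: "icon D E A' B' K" and K': "icon D E B' L' K'"
  shows "htrans C D E A L A' L' (cmptrans D E A' B' L' K' K) (cmptrans C D A B L H' H)
    = cmptrans C E (cmp3 C D E A' A) (cmp3 C D E B' B) (cmp3 C D E L' L)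
        (htrans C D E B L B' L' K' H') (htrans C D E A B A' B' K H)"
    (is "?l = ?r")
proof -
  interpret P: icon_pair C D A B L H H' by (intro icon_pair.intro assms)
  interpret Q: icon_pair D E A' B' L' K K' by (intro icon_pair.intro assms)
  interpret R: icon_pair C E "cmp3 C D E A' A" "cmp3 C D E B' B" "cmp3 C D E L' L"
      "htrans C D E A B A' B' K H" "htrans C D E B L B' L' K' H'"
    by (intro icon_pair.intro icon_htrans assms)
  note 1 = icon_htrans[OF P.icon_cmptrans Q.icon_cmptrans]
  show ?thesis
  proof (rule icon_eqI[OF 1(1) R.icon_cmptrans])
    fix x assume x: "x \<in> Arr C"
    have e: "tm K (fm L x) \<bullet>\<^bsub>E\<^esub> fc A' (tm H' x) = fc B' (tm H' x) \<bullet>\<^bsub>E\<^esub> tm K (fm B x)"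
      using Q.H.tm_natural[of "tm H' x"] x by simp
    have "tm K (fm L x) \<bullet>\<^bsub>E\<^esub> (fc A' (tm H' x) \<bullet>\<^bsub>E\<^esub> fc A' (tm H x)) = fc B' (tm H' x) \<bullet>\<^bsub>E\<^esub> (tm K (fm B x) \<bullet>\<^bsub>E\<^esub> fc A' (tm H x))"
      using x by (subst Q.H.A.D.vcmp_extend[OF e]) simp_all
    then show "tm ?l x = tm ?r x"
      using x by (simp add: 1(2) icon_htrans(2)[OF H K] icon_htrans(2)[OF H' K'] Q.H.A.fc_vcmp)
  qed
qed

lemma st_obj_iff: "group G \<Longrightarrow> X \<in> st_obj G \<longleftrightarrow> labelled G (fst X) (snd X) \<and> snd X \<in> extensional (carrier G)"
  by (auto simp: st_obj_def labelled_def labelled_axioms_def gray_mon_def)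

lemma st_mor_iff:
  assumes "group G"
  shows "(X, Y, A) \<in> st_mor G \<longleftrightarrow> X \<in> st_obj G \<and> Y \<in> st_obj G \<and> mon_fun (fst X) (fst Y) A
    \<and> (\<forall>g \<in> carrier G. fo A (snd X g) = snd Y g)"
proof -
  have "normal_functor G (snd X) (snd Y) (fst X) (fst Y) A \<longleftrightarrow>
      mon_fun (fst X) (fst Y) A \<and> (\<forall>g \<in> carrier G. fo A (snd X g) = snd Y g)"
    if "X \<in> st_obj G" "Y \<in> st_obj G"
    using that assms by (intro normal_functor_iff) (simp_all add: st_obj_iff)
  then show ?thesis
    by (cases X; cases Y) (auto simp: st_mor_def)
qed

lemma st_cel_iff:
  assumes "group G"
  shows "((X, Y, A), (X', Y', B), H) \<in> st_cel G \<longleftrightarrow> (X, Y, A) \<in> st_mor G \<and> (X, Y, B) \<in> st_mor G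
    \<and> X' = X \<and> Y' = Y \<and> icon (fst X) (fst Y) A B H"
proof -
  have "normal_trans G (snd X) (snd Y) (fst X) (fst Y) A B H \<longleftrightarrow> icon (fst X) (fst Y) A B H"
    if "(X, Y, A) \<in> st_mor G" "(X, Y, B) \<in> st_mor G"
    using that assms by (intro normal_trans_iff) (simp_all add: st_mor_iff st_obj_iff)
  then show ?thesis
    by (cases X; cases Y; cases X'; cases Y') (auto simp: st_cel_def)
qed

lemma Cat3st_simps [simp]:
  "Obj (Cat3st G) = st_obj G" "Arr (Cat3st G) = st_mor G" "Cel (Cat3st G) = st_cel G"
  "Dom (Cat3st G) (X, Y, A) = X" "Cod (Cat3st G) (X, Y, A) = Y"
  "Src (Cat3st G) (F, F', H) = F" "Tgt (Cat3st G) (F, F', H) = F'"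
  "Id1 (Cat3st G) X = (X, X, idfun3 (fst X))"
  "Id2 (Cat3st G) (X, Y, A) = ((X, Y, A), (X, Y, A), idtrans (fst X) (fst Y) A)"
  "Cmp (Cat3st G) (Y', Z, B) (X, Y, A) = (X, Z, cmp3 (fst X) (fst Y) (fst Z) B A)"
  "VCmp (Cat3st G) (F', (X', Y', L), K) ((X, Y, A), (X'', Y'', B), H) =
     ((X, Y, A), (X, Y, L), cmptrans (fst X) (fst Y) A B L K H)"
  "HCmp (Cat3st G) ((Y', Z, A'), (Y'', Z', B'), K) ((X, Y, A), (X'', Y''', B), H) =
     ((X, Z, cmp3 (fst X) (fst Y) (fst Z) A' A), (X, Z, cmp3 (fst X) (fst Y) (fst Z) B' B),
      htrans (fst X) (fst Y) (fst Z) A B A' B' K H)"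
  by (simp_all add: Cat3st_def)

lemma st_mor_idfun3:
  assumes "group G" "X \<in> st_obj G"
  shows "(X, X, idfun3 (fst X)) \<in> st_mor G"
proof -
  interpret labelled G "fst X" "snd X" using assms by (simp add: st_obj_iff)
  show ?thesis using assms by (simp add: st_mor_iff mon_fun_idfun3)
qed

lemma st_mor_cmp3:
  assumes "group G" "(X, Y, A) \<in> st_mor G" "(Y, Z, B) \<in> st_mor G"
  shows "(X, Z, cmp3 (fst X) (fst Y) (fst Z) B A) \<in> st_mor G"
proof -
  interpret X: labelled G "fst X" "snd X" using assms by (simp add: st_mor_iff st_obj_iff)
  interpret mon_fun_pair "fst X" "fst Y" "fst Z" A B
    using assms by (simp add: st_mor_iff mon_fun_pair_def)
  show ?thesis using assms by (simp add: st_mor_iff mon_fun_cmp3)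
qed

theorem strict_2category_Cat3st:
  assumes G: "group G"
  shows "strict_2category (Cat3st G :: (('g,'o,'m,'t) st0, ('g,'o,'m,'t) st1, ('g,'o,'m,'t) st2) twocat)"
proof -
  let ?S = "Cat3st G :: (('g,'o,'m,'t) st0, ('g,'o,'m,'t) st1, ('g,'o,'m,'t) st2) twocat"
  note mor = st_mor_iff[OF G] and cel = st_cel_iff[OF G]
  have id2: "((X, Y, A), (X, Y, A), idtrans (fst X) (fst Y) A) \<in> st_cel G" if "(X, Y, A) \<in> st_mor G"
    for X Y :: "('g,'o,'m,'t) st0" and A
    using that by (simp add: cel mor mon_fun.icon_idtrans)
  show ?thesis
    unfolding strict_2category_def
  proof (intro conjI)
    show "\<forall>x \<in> Arr ?S. Dom ?S x \<in> Obj ?S \<and> Cod ?S x \<in> Obj ?S"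
      by (auto simp: mor)
    show "\<forall>f \<in> Cel ?S. Src ?S f \<in> Arr ?S \<and> Tgt ?S f \<in> Arr ?S
        \<and> Dom ?S (Src ?S f) = Dom ?S (Tgt ?S f) \<and> Cod ?S (Src ?S f) = Cod ?S (Tgt ?S f)"
      by (auto simp: cel)
    show "\<forall>a \<in> Obj ?S. arr ?S (Id1 ?S a) a a"
      using st_mor_idfun3[OF G] by (auto simp: arr_def)
    show "\<forall>x \<in> Arr ?S. cell ?S (Id2 ?S x) x x"
      using id2 by (force simp: cell_def)
    show "\<forall>x a b y c. arr ?S x a b \<longrightarrow> arr ?S y b c \<longrightarrow> arr ?S (Cmp ?S y x) a c"
      using st_mor_cmp3[OF G] by (fastforce simp: arr_def)
    show "\<forall>x a b. arr ?S x a b \<longrightarrow> Cmp ?S x (Id1 ?S a) = x \<and> Cmp ?S (Id1 ?S b) x = x"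
      by (auto simp: arr_def mor mon_fun.cmp3_unit)
    show "\<forall>x a b y c z d. arr ?S x a b \<longrightarrow> arr ?S y b c \<longrightarrow> arr ?S z c d \<longrightarrow>
        Cmp ?S (Cmp ?S z y) x = Cmp ?S z (Cmp ?S y x)"
      by (auto simp: arr_def mor cmp3_assoc)
    show "\<forall>f g x y z. cell ?S f x y \<longrightarrow> cell ?S g y z \<longrightarrow> cell ?S (VCmp ?S g f) x z"
      by (auto simp: cell_def cel icon_pair.icon_cmptrans icon_pair_def)
    show "\<forall>f x y. cell ?S f x y \<longrightarrow> VCmp ?S f (Id2 ?S x) = f \<and> VCmp ?S (Id2 ?S y) f = f"
      by (auto simp: cell_def cel cmptrans_idtrans)
    show "\<forall>f g h w x y z. cell ?S f w x \<longrightarrow> cell ?S g x y \<longrightarrow> cell ?S h y z \<longrightarrow>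
        VCmp ?S (VCmp ?S h g) f = VCmp ?S h (VCmp ?S g f)"
      by (auto simp: cell_def cel cmptrans_assoc)
    show "\<forall>f g x x' y y'. cell ?S f x x' \<longrightarrow> cell ?S g y y' \<longrightarrow> Cod ?S x = Dom ?S y \<longrightarrow>
        cell ?S (HCmp ?S g f) (Cmp ?S y x) (Cmp ?S y' x')"
      using st_mor_cmp3[OF G] by (fastforce simp: cell_def cel icon_htrans)
    show "\<forall>x y. x \<in> Arr ?S \<longrightarrow> y \<in> Arr ?S \<longrightarrow> Cod ?S x = Dom ?S y \<longrightarrow>
        HCmp ?S (Id2 ?S y) (Id2 ?S x) = Id2 ?S (Cmp ?S y x)"
      by (auto simp: mor htrans_idtrans)
    show "\<forall>f f' g g' x x' x'' y y' y''. cell ?S f x x' \<longrightarrow> cell ?S f' x' x'' \<longrightarrow> cell ?S g y y' \<longrightarrow> cell ?S g' y' y'' \<longrightarrow>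
        Cod ?S x = Dom ?S y \<longrightarrow> HCmp ?S (VCmp ?S g' g) (VCmp ?S f' f) = VCmp ?S (HCmp ?S g' f') (HCmp ?S g f)"
      by (auto simp: cell_def cel htrans_cmptrans)
    show "\<forall>f x y. cell ?S f x y \<longrightarrow> HCmp ?S f (Id2 ?S (Id1 ?S (Dom ?S x))) = f
        \<and> HCmp ?S (Id2 ?S (Id1 ?S (Cod ?S x))) f = f"
      by (auto simp: cell_def cel mor htrans_unit mon_fun.cmp3_unit)
    show "\<forall>f g h x x' y y' z z'. cell ?S f x x' \<longrightarrow> cell ?S g y y' \<longrightarrow> cell ?S h z z' \<longrightarrow>
        Cod ?S x = Dom ?S y \<longrightarrow> Cod ?S y = Dom ?S z \<longrightarrow> HCmp ?S (HCmp ?S h g) f = HCmp ?S h (HCmp ?S g f)"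
      by (auto simp: cell_def cel mor htrans_assoc cmp3_assoc)
  qed
qed

section \<open>Pointings, modifications and perturbations\<close>

lemma disc_simps [simp]:
  "Obj (disc G) = carrier G" "Arr (disc G) = carrier G" "Cel (disc G) = carrier G"
  "Dom (disc G) g = g" "Cod (disc G) g = g" "Src (disc G) g = g" "Tgt (disc G) g = g"
  "Id1 (disc G) g = g" "Id2 (disc G) g = g"
  "Cmp (disc G) g h = g" "VCmp (disc G) g h = g" "HCmp (disc G) g h = g"
  "Unt (disc G) = \<one>\<^bsub>G\<^esub>" "Ten (disc G) = mult G"
  "LW1 (disc G) = mult G" "LW2 (disc G) = mult G" "RW1 (disc G) = mult G" "RW2 (disc G) = mult G" "Ich (disc G) = mult G"
  by (simp_all add: disc_def)

lemma ten1_disc [simp]: "ten1 (disc G) g h = g \<otimes>\<^bsub>G\<^esub> h"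
  by (simp add: ten1_def)

lemma labelled_disc: "group G \<Longrightarrow> labelled G (disc G) (\<lambda>g. g)"
proof -
  assume "group G"
  then interpret group G .
  have "strict_2category (disc G)"
    by (auto simp: strict_2category_def arr_def cell_def)
  moreover have "strict_2endo (disc G) (\<lambda>b. a \<otimes>\<^bsub>G\<^esub> b) (\<lambda>b. a \<otimes>\<^bsub>G\<^esub> b) (\<lambda>b. a \<otimes>\<^bsub>G\<^esub> b)"
    "strict_2endo (disc G) (\<lambda>b. b \<otimes>\<^bsub>G\<^esub> a) (\<lambda>b. b \<otimes>\<^bsub>G\<^esub> a) (\<lambda>b. b \<otimes>\<^bsub>G\<^esub> a)" if "a \<in> carrier G" for a
    using that by (auto simp: strict_2endo_def arr_def cell_def)
  ultimately have "gray_monoid (disc G)"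
    by (auto simp: gray_monoid_def icell_def arr_def cell_def inverse2_def m_assoc)
  then show ?thesis
    by unfold_locales (auto simp: bij_betw_def)
qed

text \<open>The functor \<open>\<pi>\<close> with labelling \<open>c\<close>.\<close>

definition lab_grayfun :: "('g,'w) monoid_scheme \<Rightarrow> ('o,'m,'t) gray \<Rightarrow> ('g \<Rightarrow> 'o) \<Rightarrow> ('g,'g,'g,'o,'m,'t) grayfun" where
  "lab_grayfun G C c = \<lparr> p0 = c, p1 = (\<lambda>g \<in> carrier G. Id1 C (c g)), p2 = (\<lambda>g \<in> carrier G. \<guillemotleft>Id1 C (c g)\<guillemotright>\<^bsub>C\<^esub>) \<rparr>"

lemma lab_grayfun_components:
  assumes "P = lab_grayfun G C c"
  shows "p1 P = (\<lambda>g \<in> carrier G. Id1 C (c g))" "p2 P = (\<lambda>g \<in> carrier G. \<guillemotleft>Id1 C (c g)\<guillemotright>\<^bsub>C\<^esub>)"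
  by (simp_all add: assms lab_grayfun_def)

text \<open>A Gray-functor out of \<open>BG\<close> preserves identities, and \<open>BG\<close> has only identity higher cells: it is
  determined by its values on 0-cells, and any labelling gives one.\<close>

lemma gray_functor_disc_iff:
  assumes "group G" "gray_monoid C"
  shows "gray_functor (disc G) C P \<and> bij_betw (p0 P) (carrier G) (Obj C)
    \<longleftrightarrow> labelled G C (p0 P) \<and> p0 P \<in> extensional (carrier G) \<and> P = lab_grayfun G C (p0 P)"
proof (intro iffI)
  interpret group G by fact
  interpret gray_mon C by unfold_locales fact
  interpret dG: labelled G "disc G" "\<lambda>g. g" by (rule labelled_disc) fact
  {
    assume h: "gray_functor (disc G) C P \<and> bij_betw (p0 P) (carrier G) (Obj C)"
    then interpret gray_fun "disc G" C P by unfold_locales simp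
    have "p1 P = (\<lambda>g \<in> carrier G. Id1 C (p0 P g))"
      by (rule extensionalityI[OF gfun(2)]) (use p0(2) in simp_all)
    moreover have "p2 P = (\<lambda>g \<in> carrier G. \<guillemotleft>Id1 C (p0 P g)\<guillemotright>\<^bsub>C\<^esub>)"
      by (rule extensionalityI[OF gfun(3)]) (use p1(4) p0(2) in simp_all)
    ultimately have "P = lab_grayfun G C (p0 P)"
      by (simp add: lab_grayfun_def)
    moreover have "labelled G C (p0 P)"
      by unfold_locales (use h p0(4) in simp_all)
    ultimately show "labelled G C (p0 P) \<and> p0 P \<in> extensional (carrier G) \<and> P = lab_grayfun G C (p0 P)"
      using gfun(1) by simp
  next
    assume h: "labelled G C (p0 P) \<and> p0 P \<in> extensional (carrier G) \<and> P = lab_grayfun G C (p0 P)"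
    then interpret C: labelled G C "p0 P" by simp
    have P: "p1 P = (\<lambda>g \<in> carrier G. Id1 C (p0 P g))" "p2 P = (\<lambda>g \<in> carrier G. \<guillemotleft>Id1 C (p0 P g)\<guillemotright>\<^bsub>C\<^esub>)"
      using h lab_grayfun_components[of P G C "p0 P"] by simp_all
    show "gray_functor (disc G) C P \<and> bij_betw (p0 P) (carrier G) (Obj C)"
      using h by (simp add: gray_functor_def arr_def cell_def P C.lab_one C.lab_mult C.lab_bij)
  }
qed

lemma pt_obj_iff:
  assumes "group G"
  shows "X \<in> pt_obj G \<longleftrightarrow> labelled G (fst X) (p0 (snd X)) \<and> p0 (snd X) \<in> extensional (carrier G)
    \<and> snd X = lab_grayfun G (fst X) (p0 (snd X))"
proof (cases X)
  case (Pair C P)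
  have "labelled G C (p0 P) \<Longrightarrow> gray_monoid C"
    by (simp add: labelled_def gray_mon_def)
  with Pair show ?thesis
    using gray_functor_disc_iff[OF assms, of C P] by (auto simp: pt_obj_def)
qed

lemma mon_fun_pi3:
  assumes "group G" "X \<in> pt_obj G"
  shows "mon_fun (disc G) (fst X) (pi3 G X)"
proof -
  interpret dG: labelled G "disc G" "\<lambda>g. g" by (rule labelled_disc) fact
  interpret gray_fun "disc G" "fst X" "snd X"
    by unfold_locales (use assms in \<open>auto simp: pt_obj_def\<close>)
  show ?thesis by (rule mon_fun_strict3)
qed

lemma pi3_simps:
  assumes "group G" "X \<in> pt_obj G" "g \<in> carrier G"
  shows "fo (pi3 G X) g = p0 (snd X) g" "fm (pi3 G X) g = Id1 (fst X) (p0 (snd X) g)"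
    "fc (pi3 G X) g = \<guillemotleft>Id1 (fst X) (p0 (snd X) g)\<guillemotright>\<^bsub>fst X\<^esub>"
    "fu (pi3 G X) g = \<guillemotleft>Id1 (fst X) (p0 (snd X) g)\<guillemotright>\<^bsub>fst X\<^esub>"
    "fp (pi3 G X) (g, g) = \<guillemotleft>Id1 (fst X) (p0 (snd X) g)\<guillemotright>\<^bsub>fst X\<^esub>"
    "h \<in> carrier G \<Longrightarrow> mm (pi3 G X) (g, h) = \<guillemotleft>Id1 (fst X) (p0 (snd X) (g \<otimes>\<^bsub>G\<^esub> h))\<guillemotright>\<^bsub>fst X\<^esub>"
proof -
  interpret X: labelled G "fst X" "p0 (snd X)" using assms by (simp add: pt_obj_iff)
  have P: "p1 (snd X) = (\<lambda>g \<in> carrier G. Id1 (fst X) (p0 (snd X) g))"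
    "p2 (snd X) = (\<lambda>g \<in> carrier G. \<guillemotleft>Id1 (fst X) (p0 (snd X) g)\<guillemotright>\<^bsub>fst X\<^esub>)"
    using assms(2) lab_grayfun_components[of "snd X" G "fst X" "p0 (snd X)"] by (simp_all add: pt_obj_iff[OF assms(1)])
  show "fo (pi3 G X) g = p0 (snd X) g" "fm (pi3 G X) g = Id1 (fst X) (p0 (snd X) g)"
    "fc (pi3 G X) g = \<guillemotleft>Id1 (fst X) (p0 (snd X) g)\<guillemotright>\<^bsub>fst X\<^esub>"
    "fu (pi3 G X) g = \<guillemotleft>Id1 (fst X) (p0 (snd X) g)\<guillemotright>\<^bsub>fst X\<^esub>"
    "fp (pi3 G X) (g, g) = \<guillemotleft>Id1 (fst X) (p0 (snd X) g)\<guillemotright>\<^bsub>fst X\<^esub>"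
    "h \<in> carrier G \<Longrightarrow> mm (pi3 G X) (g, h) = \<guillemotleft>Id1 (fst X) (p0 (snd X) (g \<otimes>\<^bsub>G\<^esub> h))\<guillemotright>\<^bsub>fst X\<^esub>"
    using assms(3) by (simp_all add: strict3_def cpairs_def P X.lab_mult)
qed

text \<open>The inverses of the components form an icon, and the composites are equal to the identity icons, so
  that identity modifications witness invertibility.\<close>

lemma (in icon) icon_inverse:
  obtains K where "icon C D B A K" "cmptrans C D A B A K H = idtrans C D A" "cmptrans C D B A B H K = idtrans C D B"
proof -
  define K :: "('o,'m,'p,'n,'u) trans" where
    "K = \<lparr> ts = Unt D, tc = tc H, tm = (\<lambda>x \<in> Arr C. inv2 D (tm H x)), t1 = t1 H, t2 = t2 H \<rparr>"
  have K: "icon C D B A K"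
  proof
    show "fo A = fo B" by (simp add: fo_eq)
    show "ts K = Unt D" "t1 K = \<guillemotleft>Id1 D (Unt D)\<guillemotright>\<^bsub>D\<^esub>" "tc K = (\<lambda>a \<in> Obj C. idadj D (fo B a))"
      "t2 K = (\<lambda>(a, b) \<in> Obj C \<times> Obj C. \<guillemotleft>Id1 D (fo B a \<odot>\<^bsub>D\<^esub> fo B b)\<guillemotright>\<^bsub>D\<^esub>)"
      "tm K \<in> extensional (Arr C)"
      by (simp_all add: K_def fo_eq tc_eq t2_eq)
    show "iso2 D (tm K x)" "Src D (tm K x) = fm B x" "Tgt D (tm K x) = fm A x" if "x \<in> Arr C" for x
      using that by (simp_all add: K_def)
    show "fc A f \<bullet>\<^bsub>D\<^esub> tm K (Src C f) = tm K (Tgt C f) \<bullet>\<^bsub>D\<^esub> fc B f" if "f \<in> Cel C" for f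
      using that A.D.vcmp_inv2_swap[OF tm_natural[symmetric], of f] by (simp add: K_def)
    show "tm K (y \<cdot>\<^bsub>C\<^esub> x) \<bullet>\<^bsub>D\<^esub> fp B (y, x) = fp A (y, x) \<bullet>\<^bsub>D\<^esub> (tm K y \<star>\<^bsub>D\<^esub> tm K x)"
      if "x \<in> Arr C" "y \<in> Arr C" "Dom C y = Cod C x" for x y
      using that A.D.vcmp_inv2_swap[OF tm_comp[OF that]] by (simp add: K_def A.D.inv2_hcmp)
    show "tm K (Id1 C a) \<bullet>\<^bsub>D\<^esub> fu B a = fu A a" if "a \<in> Obj C" for a
      using that A.D.vcmp_inv2_swap[of "tm H (Id1 C a)" "fu A a" "fu B a" "\<guillemotleft>Id1 D (fo A a)\<guillemotright>\<^bsub>D\<^esub>"]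
      by (simp add: K_def tm_unit)
    show "tm K (x \<boxtimes>\<^bsub>C\<^esub> y) \<bullet>\<^bsub>D\<^esub> mm B (x, y) = mm A (x, y) \<bullet>\<^bsub>D\<^esub> (tm K x \<boxtimes>\<^sub>2\<^bsub>D\<^esub> tm K y)"
      if "x \<in> Arr C" "y \<in> Arr C" for x y
      using that A.D.vcmp_inv2_swap[OF tm_ten[OF that]] by (simp add: K_def A.D.inv2_ten2)
  qed
  have tmK: "tm K x = inv2 D (tm H x)" if "x \<in> Arr C" for x
    using that by (simp add: K_def)
  interpret P: icon_pair C D A B A H K by (intro icon_pair.intro icon_axioms K)
  interpret Q: icon_pair C D B A B K H by (intro icon_pair.intro icon_axioms K)
  have "cmptrans C D A B A K H = idtrans C D A"
    by (rule icon_eqI[OF P.icon_cmptrans A.icon_idtrans]) (simp add: tmK)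
  moreover have "cmptrans C D B A B H K = idtrans C D B"
    by (rule icon_eqI[OF Q.icon_cmptrans B.icon_idtrans]) (simp add: tmK)
  ultimately show ?thesis using that K by blast
qed

lemma (in icon) idmod_eq:
  "idmod C D H = \<lparr> ms = Id1 D (Unt D), mc = (\<lambda>a \<in> Obj C. \<guillemotleft>Id1 D (fo A a)\<guillemotright>\<^bsub>D\<^esub>) \<rparr>"
  by (simp add: idmod_def restrict_def fun_eq_iff)

text \<open>With identity components, compatibility with a 1-cell \<open>x\<close> reads \<open>K\<^sub>x = H\<^sub>x\<close>, and the other
  equations are trivial.  Two consequences are needed: 3-cells are identities, and the modification
  component of a 2-cell exists once the icons that it connects coincide.\<close>

lemma modification_iff_eq:
  assumes "icon C D A B H" "icon C D A B K"
    and m: "mc m \<in> extensional (Obj C)" "ms m = Id1 D (Unt D)" "\<And>a. a \<in> Obj C \<Longrightarrow> mc m a = \<guillemotleft>Id1 D (fo A a)\<guillemotright>\<^bsub>D\<^esub>"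
  shows "modification C D A B H K m \<longleftrightarrow> H = K"
proof -
  interpret H: icon C D A B H by fact
  interpret K: icon C D A B K by fact
  have "modification C D A B H K m \<longleftrightarrow> (\<forall>x \<in> Arr C. tm K x = tm H x)"
    unfolding modification_def
    using m(1) by (simp add: m(2,3) arr_def icell_iff Ball_def cong: imp_cong conj_cong)
  also have "\<dots> \<longleftrightarrow> H = K"
    using icon_eqI[OF assms(1,2)] by auto
  finally show ?thesis .
qed

lemma (in icon) modification_idmod: "modification C D A B H H (idmod C D H)"
  by (subst modification_iff_eq) (simp_all add: idmod_eq icon_axioms)

lemma (in icon) invertible_idmod: "invertible_modification C D A B H H (idmod C D H)"
proof -
  have c: "cmpmod C D A B (idmod C D H) (idmod C D H) = idmod C D H"
    by (simp add: cmpmod_def idmod_eq restrict_def fun_eq_iff)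
  have "isomorphic_mod C D A B H H (idmod C D H) (idmod C D H)"
    unfolding isomorphic_mod_def perturbation_def
    by (rule exI[of _ "\<guillemotleft>Id1 D (Unt D)\<guillemotright>\<^bsub>D\<^esub>"]) (simp add: idmod_eq cell_def icell_iff)
  then show ?thesis
    unfolding invertible_modification_def using modification_idmod c by auto
qed

lemma (in icon) invertible_transformation: "invertible_transformation C D A B H"
proof -
  obtain K where K: "icon C D B A K" "cmptrans C D A B A K H = idtrans C D A" "cmptrans C D B A B H K = idtrans C D B"
    using icon_inverse .
  interpret K: icon C D B A K by fact
  have "transformation C D A B H" "transformation C D B A K"
    using icon_axioms K(1) by (simp_all add: transformation_iff K.transformation_iff)
  moreover have "invertible_modification C D A A (cmptrans C D A B A K H) (idtrans C D A) (idmod C D (idtrans C D A))"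
    "invertible_modification C D B B (cmptrans C D B A B H K) (idtrans C D B) (idmod C D (idtrans C D B))"
    unfolding K using icon.invertible_idmod A.icon_idtrans B.icon_idtrans by blast+
  ultimately show ?thesis unfolding invertible_transformation_def by blast
qed

text \<open>The only candidate for \<open>\<alpha>\<close>.\<close>

definition pointing :: "('g,'w) monoid_scheme \<Rightarrow> ('g,'o,'m,'t) pt0 \<Rightarrow> ('g,'o,'m,'t) pt0
    \<Rightarrow> ('o,'m,'t,'o,'m,'t) threefun \<Rightarrow> ('g,'g,'o,'m,'t) trans" where
  "pointing G X Y A = \<lparr>
     ts = Unt (fst Y),
     tc = (\<lambda>g \<in> carrier G. idadj (fst Y) (p0 (snd Y) g)),
     tm = (\<lambda>g \<in> carrier G. fu A (p0 (snd X) g)),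
     t1 = \<guillemotleft>Id1 (fst Y) (Unt (fst Y))\<guillemotright>\<^bsub>fst Y\<^esub>,
     t2 = (\<lambda>(g, h) \<in> carrier G \<times> carrier G. \<guillemotleft>Id1 (fst Y) (p0 (snd Y) (g \<otimes>\<^bsub>G\<^esub> h))\<guillemotright>\<^bsub>fst Y\<^esub>) \<rparr>"

lemma tm_pointing [simp]: "g \<in> carrier G \<Longrightarrow> tm (pointing G X Y A) g = fu A (p0 (snd X) g)"
  by (simp add: pointing_def)

locale pt_functor = X: labelled G "fst X" "p0 (snd X)" + Y: labelled G "fst Y" "p0 (snd Y)"
    + A: mon_fun "fst X" "fst Y" A
  for G :: "('g,'w) monoid_scheme" and X Y :: "('g,'o,'m,'t) pt0" and A :: "('o,'m,'t,'o,'m,'t) threefun" +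
  assumes X: "X \<in> pt_obj G" and Y: "Y \<in> pt_obj G" and lab: "\<forall>g \<in> carrier G. fo A (p0 (snd X) g) = p0 (snd Y) g"
begin

lemma fo_lab [simp]: "g \<in> carrier G \<Longrightarrow> fo A (p0 (snd X) g) = p0 (snd Y) g"
  using lab by simp

lemmas pi3X [simp] = pi3_simps[OF X.group_axioms X] and pi3Y [simp] = pi3_simps[OF X.group_axioms Y]

sublocale dG: labelled G "disc G" "\<lambda>g. g" by (rule labelled_disc) (rule X.group_axioms)
sublocale piX: mon_fun "disc G" "fst X" "pi3 G X" by (rule mon_fun_pi3[OF X.group_axioms X])
sublocale piY: mon_fun "disc G" "fst Y" "pi3 G Y" by (rule mon_fun_pi3[OF X.group_axioms Y])
sublocale Api: mon_fun_pair "disc G" "fst X" "fst Y" "pi3 G X" A ..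
sublocale api: mon_fun "disc G" "fst Y" "api3 G X Y A" by (rule Api.mon_fun_cmp3)

text \<open>The only nontrivial axioms are the ones for composition and for \<open>\<boxtimes>\<close>.  They say that \<open>A\<^sup>1\<close> is
  compatible with \<open>A\<^sup>2\<close> and with \<open>\<mu>\<^sup>A\<close>, that is \<open>fp_fu_fu\<close> and the unit axiom of \<open>\<mu>\<^sup>A\<close>.\<close>

lemma icon_pointing: "icon (disc G) (fst Y) (pi3 G Y) (api3 G X Y A) (pointing G X Y A)"
proof
  show "fo (api3 G X Y A) = fo (pi3 G Y)"
    by (rule extensionalityI[OF api.pfun(1) piY.pfun(1)]) simp
  show "ts (pointing G X Y A) = Unt (fst Y)"
    "t1 (pointing G X Y A) = \<guillemotleft>Id1 (fst Y) (Unt (fst Y))\<guillemotright>\<^bsub>fst Y\<^esub>"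
    "tm (pointing G X Y A) \<in> extensional (Arr (disc G))"
    by (simp_all add: pointing_def)
  show "tc (pointing G X Y A) = (\<lambda>a \<in> Obj (disc G). idadj (fst Y) (fo (pi3 G Y) a))"
    by (simp add: pointing_def restrict_def fun_eq_iff)
  show "t2 (pointing G X Y A) = (\<lambda>(a, b) \<in> Obj (disc G) \<times> Obj (disc G).
      \<guillemotleft>Id1 (fst Y) (fo (pi3 G Y) a \<odot>\<^bsub>fst Y\<^esub> fo (pi3 G Y) b)\<guillemotright>\<^bsub>fst Y\<^esub>)"
    by (rule ext) (auto simp: pointing_def restrict_def Y.lab_mult)
  show "iso2 (fst Y) (tm (pointing G X Y A) x)"
    "Src (fst Y) (tm (pointing G X Y A) x) = fm (pi3 G Y) x"
    "Tgt (fst Y) (tm (pointing G X Y A) x) = fm (api3 G X Y A) x" if "x \<in> Arr (disc G)" for x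
    using that by simp_all
  show "fc (api3 G X Y A) f \<bullet>\<^bsub>fst Y\<^esub> tm (pointing G X Y A) (Src (disc G) f)
      = tm (pointing G X Y A) (Tgt (disc G) f) \<bullet>\<^bsub>fst Y\<^esub> fc (pi3 G Y) f" if "f \<in> Cel (disc G)" for f
    using that by simp
  show "tm (pointing G X Y A) (y \<cdot>\<^bsub>disc G\<^esub> x) \<bullet>\<^bsub>fst Y\<^esub> fp (pi3 G Y) (y, x)
      = fp (api3 G X Y A) (y, x) \<bullet>\<^bsub>fst Y\<^esub> (tm (pointing G X Y A) y \<star>\<^bsub>fst Y\<^esub> tm (pointing G X Y A) x)"
    if "x \<in> Arr (disc G)" "y \<in> Arr (disc G)" "Dom (disc G) y = Cod (disc G) x" for x y
    using that by (simp add: A.fp_fu_fu)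
  show "tm (pointing G X Y A) (Id1 (disc G) a) \<bullet>\<^bsub>fst Y\<^esub> fu (pi3 G Y) a = fu (api3 G X Y A) a"
    if "a \<in> Obj (disc G)" for a
    using that by simp
  show "tm (pointing G X Y A) (x \<boxtimes>\<^bsub>disc G\<^esub> y) \<bullet>\<^bsub>fst Y\<^esub> mm (pi3 G Y) (x, y)
      = mm (api3 G X Y A) (x, y) \<bullet>\<^bsub>fst Y\<^esub> (tm (pointing G X Y A) x \<boxtimes>\<^sub>2\<^bsub>fst Y\<^esub> tm (pointing G X Y A) y)"
    if "x \<in> Arr (disc G)" "y \<in> Arr (disc G)" for x y
    using that by (simp add: A.mm_fu X.lab_mult Y.lab_mult)
qed

lemma pointing_eqI:
  assumes "icon (disc G) (fst Y) (pi3 G Y) (api3 G X Y A) \<alpha>" "\<And>g. g \<in> carrier G \<Longrightarrow> tm \<alpha> g = fu A (p0 (snd X) g)"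
  shows "\<alpha> = pointing G X Y A"
  by (rule icon_eqI[OF assms(1) icon_pointing]) (use assms(2) in simp)

lemma pt_unitmod_eq: "pt_unitmod G Y = idmod (disc G) (fst Y) (pointing G X Y A)"
  by (simp add: pt_unitmod_def idmod_def pointing_def Y.lab_one restrict_def fun_eq_iff)

end

lemma pt_functor_iff:
  assumes "group G"
  shows "pt_functor G X Y A \<longleftrightarrow> X \<in> pt_obj G \<and> Y \<in> pt_obj G \<and> mon_fun (fst X) (fst Y) A
    \<and> (\<forall>g \<in> carrier G. fo A (p0 (snd X) g) = p0 (snd Y) g)"
  using assms by (auto simp: pt_functor_def pt_functor_axioms_def pt_obj_iff)

text \<open>The prescribed values determine \<open>\<alpha>\<close> by extensionality; conversely the canonical pointing is an
  icon and hence an invertible transformation.\<close>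

lemma pt_mor_iff:
  assumes "group G"
  shows "(X, Y, A, \<alpha>) \<in> pt_mor G \<longleftrightarrow> pt_functor G X Y A \<and> \<alpha> = pointing G X Y A"
proof
  assume m: "(X, Y, A, \<alpha>) \<in> pt_mor G"
  then have o: "X \<in> pt_obj G" "Y \<in> pt_obj G" by (simp_all add: pt_mor_def)
  then have l: "labelled G (fst X) (p0 (snd X))" "labelled G (fst Y) (p0 (snd Y))"
    using assms by (simp_all add: pt_obj_iff)
  then have p: "pt_functor G X Y A"
    using m o by (simp add: pt_functor_iff[OF assms] pt_mor_def normal_functor_iff)
  interpret pt_functor G X Y A by fact
  have td: "trans_data (disc G) (fst Y) (pi3 G Y) (api3 G X Y A) \<alpha>"
    using m by (simp add: pt_mor_def invertible_transformation_def transformation_def)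
  have "\<alpha> = pointing G X Y A"
  proof (rule trans.equality)
    show "ts \<alpha> = ts (pointing G X Y A)" "t1 \<alpha> = t1 (pointing G X Y A)"
      using m by (simp_all add: pt_mor_def pointing_def Y.lab_one)
    show "tc \<alpha> = tc (pointing G X Y A)"
      by (rule extensionalityI[of _ "carrier G"]) (use m td in \<open>simp_all add: pt_mor_def pointing_def trans_data_def\<close>)
    show "tm \<alpha> = tm (pointing G X Y A)"
      by (rule extensionalityI[of _ "carrier G"]) (use m td in \<open>simp_all add: pt_mor_def pointing_def trans_data_def\<close>)
    show "t2 \<alpha> = t2 (pointing G X Y A)"
      by (rule extensionalityI[of _ "carrier G \<times> carrier G"]) (use m td in \<open>auto simp: pt_mor_def pointing_def trans_data_def\<close>)
  qed simp
  with p show "pt_functor G X Y A \<and> \<alpha> = pointing G X Y A" by simp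
next
  assume p: "pt_functor G X Y A \<and> \<alpha> = pointing G X Y A"
  then interpret pt_functor G X Y A by simp
  have "normal_functor G (p0 (snd X)) (p0 (snd Y)) (fst X) (fst Y) A"
    using A.mon_fun_axioms X.labelled_axioms Y.labelled_axioms by (simp add: normal_functor_iff)
  then show "(X, Y, A, \<alpha>) \<in> pt_mor G"
    using p X Y icon.invertible_transformation[OF icon_pointing]
    by (simp add: pt_mor_def pointing_def Y.lab_one)
qed

text \<open>This is the unit axiom \<open>H \<bullet> A\<^sup>1 = B\<^sup>1\<close> of the icon \<open>H\<close>.\<close>

lemma pt_act_pointing:
  assumes "pt_functor G X Y A" "pt_functor G X Y B" "icon (fst X) (fst Y) A B H"
  shows "pt_act G X Y A B H (pointing G X Y A) = pointing G X Y B"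
proof -
  interpret A: pt_functor G X Y A by fact
  interpret B: pt_functor G X Y B by fact
  interpret H: icon "fst X" "fst Y" A B H by fact
  interpret P: icon_pair "disc G" "fst Y" "pi3 G Y" "api3 G X Y A" "api3 G X Y B" "pointing G X Y A" "prewhisk (disc G) H (pi3 G X)"
    by (intro icon_pair.intro A.icon_pointing icon_prewhisk assms A.piX.mon_fun_axioms)
  show ?thesis
    unfolding pt_act_def
  proof (rule B.pointing_eqI[OF P.icon_cmptrans])
    fix g assume "g \<in> carrier G"
    then show "tm (cmptrans (disc G) (fst Y) (pi3 G Y) (api3 G X Y A) (api3 G X Y B) (prewhisk (disc G) H (pi3 G X)) (pointing G X Y A)) g
        = fu B (p0 (snd X) g)"
      by (simp add: icon_prewhisk(2)[OF A.piX.mon_fun_axioms assms(3)] H.tm_unit)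
  qed
qed

text \<open>Both \<open>\<beta>\<close> and \<open>(H \<circ> \<pi>) * \<alpha>\<close> are the canonical pointing of \<open>B\<close>, so the identity modification connects
  them.\<close>

lemma pt_cel_iff:
  assumes "group G"
  shows "((X, Y, A, \<alpha>), (X', Y', B, \<beta>), H, m) \<in> pt_cel G \<longleftrightarrow> (X, Y, A, \<alpha>) \<in> pt_mor G \<and> (X, Y, B, \<beta>) \<in> pt_mor G
    \<and> X' = X \<and> Y' = Y \<and> icon (fst X) (fst Y) A B H \<and> m = pt_unitmod G Y"
proof -
  have "normal_trans G (p0 (snd X)) (p0 (snd Y)) (fst X) (fst Y) A B H
      \<and> modification (disc G) (fst Y) (pi3 G Y) (api3 G X Y B) \<beta> (pt_act G X Y A B H \<alpha>) m
      \<and> ms m = Id1 (fst Y) (p0 (snd Y) \<one>\<^bsub>G\<^esub>)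
      \<and> (\<forall>g \<in> carrier G. mc m g = \<guillemotleft>Id1 (fst Y) (p0 (snd Y) g)\<guillemotright>\<^bsub>fst Y\<^esub>)
    \<longleftrightarrow> icon (fst X) (fst Y) A B H \<and> m = pt_unitmod G Y" (is "?l \<longleftrightarrow> ?r")
    if "(X, Y, A, \<alpha>) \<in> pt_mor G" "(X, Y, B, \<beta>) \<in> pt_mor G"
  proof -
    interpret A: pt_functor G X Y A using that assms by (simp add: pt_mor_iff)
    interpret B: pt_functor G X Y B using that assms by (simp add: pt_mor_iff)
    have \<alpha>: "\<alpha> = pointing G X Y A" and \<beta>: "\<beta> = pointing G X Y B"
      using that assms by (simp_all add: pt_mor_iff)
    have n: "normal_trans G (p0 (snd X)) (p0 (snd Y)) (fst X) (fst Y) A B H \<longleftrightarrow> icon (fst X) (fst Y) A B H"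
      by (rule normal_trans_iff) (use A.lab B.lab in \<open>simp_all add: A.X.labelled_axioms A.Y.labelled_axioms A.A.mon_fun_axioms B.A.mon_fun_axioms\<close>)
    show ?thesis
    proof
      assume l: ?l
      have "mc m \<in> extensional (carrier G)" using l by (simp add: modification_def)
      then have "mc m = mc (pt_unitmod G Y)"
        by (rule extensionalityI) (use l in \<open>simp_all add: pt_unitmod_def\<close>)
      moreover have "ms m = ms (pt_unitmod G Y)" using l by (simp add: pt_unitmod_def)
      ultimately show ?r using l n by simp
    next
      assume r: ?r
      then have "pt_act G X Y A B H \<alpha> = pointing G X Y B"
        unfolding \<alpha> by (intro pt_act_pointing A.pt_functor_axioms B.pt_functor_axioms) simp
      then have "modification (disc G) (fst Y) (pi3 G Y) (api3 G X Y B) \<beta> (pt_act G X Y A B H \<alpha>) m"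
        using r icon.modification_idmod[OF B.icon_pointing] unfolding \<beta> by (simp add: B.pt_unitmod_eq)
      then show ?l using r n by (simp add: pt_unitmod_def)
    qed
  qed
  then show ?thesis
    unfolding pt_cel_def by auto
qed

section \<open>The isomorphism\<close>

definition unpoint0 :: "('g,'o,'m,'t) pt0 \<Rightarrow> ('g,'o,'m,'t) st0" where
  "unpoint0 X = (fst X, p0 (snd X))"

definition unpoint1 :: "('g,'o,'m,'t) pt1 \<Rightarrow> ('g,'o,'m,'t) st1" where
  "unpoint1 = (\<lambda>(X, Y, A, \<alpha>). (unpoint0 X, unpoint0 Y, A))"

definition unpoint2 :: "('g,'o,'m,'t) pt2 \<Rightarrow> ('g,'o,'m,'t) st2" where
  "unpoint2 = (\<lambda>(F, F', H, m). (unpoint1 F, unpoint1 F', H))"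

text \<open>The maps in the other direction reinstate the canonical \<open>\<pi>\<close>, \<open>\<alpha>\<close> and \<open>m\<close>.\<close>

definition point0 :: "('g,'w) monoid_scheme \<Rightarrow> ('g,'o,'m,'t) st0 \<Rightarrow> ('g,'o,'m,'t) pt0" where
  "point0 G X = (fst X, lab_grayfun G (fst X) (snd X))"

definition point1 :: "('g,'w) monoid_scheme \<Rightarrow> ('g,'o,'m,'t) st1 \<Rightarrow> ('g,'o,'m,'t) pt1" where
  "point1 G = (\<lambda>(X, Y, A). (point0 G X, point0 G Y, A, pointing G (point0 G X) (point0 G Y) A))"

definition point2 :: "('g,'w) monoid_scheme \<Rightarrow> ('g,'o,'m,'t) st2 \<Rightarrow> ('g,'o,'m,'t) pt2" where
  "point2 G = (\<lambda>((X, Y, A), F', H). (point1 G (X, Y, A), point1 G F', H, pt_unitmod G (point0 G Y)))"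

lemma unpoint_simps [simp]:
  "fst (unpoint0 X) = fst X" "snd (unpoint0 X) = p0 (snd X)"
  "unpoint1 (X, Y, A, \<alpha>) = (unpoint0 X, unpoint0 Y, A)"
  "unpoint2 (F, F', H, m) = (unpoint1 F, unpoint1 F', H)"
  by (simp_all add: unpoint0_def unpoint1_def unpoint2_def)

lemma point_simps [simp]:
  "fst (point0 G Z) = fst Z" "p0 (snd (point0 G Z)) = snd Z" "unpoint0 (point0 G Z) = Z"
  "point1 G (Z, W, A) = (point0 G Z, point0 G W, A, pointing G (point0 G Z) (point0 G W) A)"
  "point2 G ((Z, W, A), F', H) = (point1 G (Z, W, A), point1 G F', H, pt_unitmod G (point0 G W))"
  by (simp_all add: point0_def point1_def point2_def lab_grayfun_def unpoint0_def)

context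
  fixes G :: "('g, 'w) monoid_scheme"
  assumes G: "group G"
begin

lemma pt_obj_iff_st: "X \<in> pt_obj G \<longleftrightarrow> unpoint0 X \<in> st_obj G \<and> point0 G (unpoint0 X) = X"
  by (cases X) (auto simp: pt_obj_iff[OF G] st_obj_iff[OF G] point0_def)

lemma pt_mor_iff_st: "(X, Y, A, \<alpha>) \<in> pt_mor G \<longleftrightarrow> X \<in> pt_obj G \<and> Y \<in> pt_obj G
    \<and> (unpoint0 X, unpoint0 Y, A) \<in> st_mor G \<and> \<alpha> = pointing G X Y A"
  by (auto simp: pt_mor_iff[OF G] pt_functor_iff[OF G] st_mor_iff[OF G] pt_obj_iff_st)

lemma pt_cel_iff_st: "((X, Y, A, \<alpha>), (X', Y', B, \<beta>), H, m) \<in> pt_cel G \<longleftrightarrow> (X, Y, A, \<alpha>) \<in> pt_mor G \<and> (X', Y', B, \<beta>) \<in> pt_mor G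
    \<and> X' = X \<and> Y' = Y \<and> ((unpoint0 X, unpoint0 Y, A), (unpoint0 X, unpoint0 Y, B), H) \<in> st_cel G \<and> m = pt_unitmod G Y"
  by (auto simp: pt_cel_iff[OF G] st_cel_iff[OF G] pt_mor_iff_st)

lemma point0_obj: "Z \<in> st_obj G \<Longrightarrow> point0 G Z \<in> pt_obj G"
  by (simp add: pt_obj_iff_st)

lemma bij_unpoint0: "bij_betw unpoint0 (pt_obj G) (st_obj G)"
  by (rule bij_betw_byWitness[where f' = "point0 G"]) (auto simp: pt_obj_iff_st)

lemma bij_unpoint1: "bij_betw unpoint1 (pt_mor G) (st_mor G)"
proof (rule bij_betw_byWitness[where f' = "point1 G"])
  show "\<forall>x \<in> pt_mor G. point1 G (unpoint1 x) = x"
    by (auto simp: pt_mor_iff_st pt_obj_iff_st)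
  show "\<forall>y \<in> st_mor G. unpoint1 (point1 G y) = y"
    by auto
  show "unpoint1 ` pt_mor G \<subseteq> st_mor G"
    by (auto simp: pt_mor_iff_st)
  show "point1 G ` st_mor G \<subseteq> pt_mor G"
    by (auto simp: pt_mor_iff_st point0_obj st_mor_iff[OF G])
qed

lemma bij_unpoint2: "bij_betw unpoint2 (pt_cel G) (st_cel G)"
proof (rule bij_betw_byWitness[where f' = "point2 G"])
  show "\<forall>x \<in> pt_cel G. point2 G (unpoint2 x) = x"
    by (auto simp: pt_cel_iff_st pt_mor_iff_st pt_obj_iff_st)
  show "\<forall>y \<in> st_cel G. unpoint2 (point2 G y) = y"
    by auto
  show "unpoint2 ` pt_cel G \<subseteq> st_cel G"
    by (auto simp: pt_cel_iff_st)
  show "point2 G ` st_cel G \<subseteq> pt_cel G"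
    by (auto simp: pt_cel_iff_st pt_mor_iff_st point0_obj st_cel_iff[OF G] st_mor_iff[OF G])
qed

lemma pt_id1:
  assumes X: "X \<in> pt_obj G"
  shows "(X, X, idfun3 (fst X), idtrans (disc G) (fst X) (pi3 G X)) \<in> pt_mor G"
proof -
  interpret C: labelled G "fst X" "p0 (snd X)" using X by (simp add: pt_obj_iff[OF G])
  have p: "pt_functor G X X (idfun3 (fst X))"
    using X by (simp add: pt_functor_iff[OF G] C.mon_fun_idfun3)
  interpret pt_functor G X X "idfun3 (fst X)" by fact
  have "idtrans (disc G) (fst X) (pi3 G X) = pointing G X X (idfun3 (fst X))"
    by (rule pointing_eqI) (use piX.icon_idtrans in \<open>simp_all add: piX.cmp3_unit\<close>)
  then show ?thesis using p by (simp add: pt_mor_iff[OF G])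
qed

text \<open>The composite pointing has component \<open>B(A\<^sup>1) \<bullet> B\<^sup>1\<close> at \<open>g\<close>, which is the unit constraint of \<open>B \<circ> A\<close>.\<close>

lemma pt_cmp_eq:
  assumes A: "(X, Y, A, \<alpha>) \<in> pt_mor G" and B: "(Y, Z, B, \<beta>) \<in> pt_mor G"
  shows "pt_cmp G (Y, Z, B, \<beta>) (X, Y, A, \<alpha>) \<in> pt_mor G"
    "unpoint1 (pt_cmp G (Y, Z, B, \<beta>) (X, Y, A, \<alpha>)) = (unpoint0 X, unpoint0 Z, cmp3 (fst X) (fst Y) (fst Z) B A)"
proof -
  interpret A: pt_functor G X Y A using A by (simp add: pt_mor_iff[OF G])
  interpret B: pt_functor G Y Z B using B by (simp add: pt_mor_iff[OF G])
  have \<alpha>: "\<alpha> = pointing G X Y A" and \<beta>: "\<beta> = pointing G Y Z B"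
    using A B by (simp_all add: pt_mor_iff[OF G])
  interpret AB: mon_fun_pair "fst X" "fst Y" "fst Z" A B ..
  have p: "pt_functor G X Z (cmp3 (fst X) (fst Y) (fst Z) B A)"
    by (simp add: pt_functor_iff[OF G] A.X B.Y AB.mon_fun_cmp3)
  interpret P: pt_functor G X Z "cmp3 (fst X) (fst Y) (fst Z) B A" by fact
  have a: "cmp3 (disc G) (fst Y) (fst Z) B (api3 G X Y A) = api3 G X Z (cmp3 (fst X) (fst Y) (fst Z) B A)"
    by (rule cmp3_assoc[OF A.piX.mon_fun_axioms A.A.mon_fun_axioms B.A.mon_fun_axioms])
  note w = icon_postwhisk[OF A.icon_pointing B.A.mon_fun_axioms]
  interpret Q: icon_pair "disc G" "fst Z" "pi3 G Z" "api3 G Y Z B" "api3 G X Z (cmp3 (fst X) (fst Y) (fst Z) B A)"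
      "pointing G Y Z B" "postwhisk (disc G) (fst Y) (fst Z) B (pi3 G Y) (pointing G X Y A)"
    by (intro icon_pair.intro B.icon_pointing w(1)[unfolded a])
  have "cmptrans (disc G) (fst Z) (pi3 G Z) (api3 G Y Z B) (api3 G X Z (cmp3 (fst X) (fst Y) (fst Z) B A))
        (postwhisk (disc G) (fst Y) (fst Z) B (pi3 G Y) \<alpha>) \<beta> = pointing G X Z (cmp3 (fst X) (fst Y) (fst Z) B A)"
    unfolding \<alpha> \<beta> by (rule P.pointing_eqI[OF Q.icon_cmptrans]) (simp add: w(2))
  then show "pt_cmp G (Y, Z, B, \<beta>) (X, Y, A, \<alpha>) \<in> pt_mor G"
    "unpoint1 (pt_cmp G (Y, Z, B, \<beta>) (X, Y, A, \<alpha>)) = (unpoint0 X, unpoint0 Z, cmp3 (fst X) (fst Y) (fst Z) B A)"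
    using p by (simp_all add: pt_cmp_def pt_mor_iff[OF G])
qed

text \<open>Every 2-cell in the perturbation equation is an identity, because all the modifications involved
  have identity components.\<close>

lemma perturbation_pt_identity:
  assumes S: "((X, Y, A, \<alpha>), (X, Y, B, \<beta>), H, m) \<in> pt_cel G"
  shows "perturbation (disc G) (fst Y) (pi3 G Y) (api3 G X Y B) \<beta> (pt_act G X Y A B H \<alpha>) m
         (cmpmod (disc G) (fst Y) (pi3 G Y) (api3 G X Y B)
           (modwhisk (disc G) (fst Y) (prewhisk (disc G) H (pi3 G X)) (prewhisk (disc G) H (pi3 G X))
             (modpre (disc G) (idmod (fst X) (fst Y) H) (pi3 G X)) \<alpha>)
           m)
         \<guillemotleft>Id1 (fst Y) (Unt (fst Y))\<guillemotright>\<^bsub>fst Y\<^esub>"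
proof -
  have c: "(X, Y, A, \<alpha>) \<in> pt_mor G" "(X, Y, B, \<beta>) \<in> pt_mor G" "icon (fst X) (fst Y) A B H" "m = pt_unitmod G Y"
    using S by (simp_all add: pt_cel_iff[OF G])
  interpret A: pt_functor G X Y A using c by (simp add: pt_mor_iff[OF G])
  interpret B: pt_functor G X Y B using c by (simp add: pt_mor_iff[OF G])
  interpret H: icon "fst X" "fst Y" A B H by (rule c)
  have \<alpha>: "\<alpha> = pointing G X Y A" and \<beta>: "\<beta> = pointing G X Y B"
    using c by (simp_all add: pt_mor_iff[OF G])
  show ?thesis
    unfolding \<alpha> \<beta> pt_act_pointing[OF A.pt_functor_axioms B.pt_functor_axioms H.icon_axioms] c(4)
    by (simp add: perturbation_def cell_def cmpmod_def modwhisk_def modpre_def pt_unitmod_def prewhisk_def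
        pointing_def H.idmod_eq A.Y.lab_one)
qed

text \<open>The prescribed components of \<open>p\<close> are identities, so its source and target coincide by
  \<open>modification_iff_eq\<close>, and \<open>p\<close> is the identity modification.\<close>

lemma pt_cel3_iff:
  "(((X, Y, A, \<alpha>), F', H, m), T, p, r) \<in> pt_cel3 G \<longleftrightarrow> ((X, Y, A, \<alpha>), F', H, m) \<in> pt_cel G
    \<and> T = ((X, Y, A, \<alpha>), F', H, m) \<and> p = idmod (fst X) (fst Y) H \<and> r = \<guillemotleft>Id1 (fst Y) (Unt (fst Y))\<guillemotright>\<^bsub>fst Y\<^esub>"
proof
  assume l: "(((X, Y, A, \<alpha>), F', H, m), T, p, r) \<in> pt_cel3 G"
  then obtain B \<beta> K n where F': "F' = (X, Y, B, \<beta>)" and T: "T = ((X, Y, A, \<alpha>), (X, Y, B, \<beta>), K, n)"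
    and S: "((X, Y, A, \<alpha>), (X, Y, B, \<beta>), H, m) \<in> pt_cel G" and S': "((X, Y, A, \<alpha>), (X, Y, B, \<beta>), K, n) \<in> pt_cel G"
    and p: "modification (fst X) (fst Y) A B H K p"
      "ms p = Id1 (fst Y) (p0 (snd Y) \<one>\<^bsub>G\<^esub>)" "\<forall>g \<in> carrier G. mc p (p0 (snd X) g) = \<guillemotleft>Id1 (fst Y) (p0 (snd Y) g)\<guillemotright>\<^bsub>fst Y\<^esub>"
    and r: "r = \<guillemotleft>Id1 (fst Y) (p0 (snd Y) \<one>\<^bsub>G\<^esub>)\<guillemotright>\<^bsub>fst Y\<^esub>"
    unfolding pt_cel3_def by blast
  have c: "(X, Y, A, \<alpha>) \<in> pt_mor G" "icon (fst X) (fst Y) A B H" "icon (fst X) (fst Y) A B K" "n = m"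
    using S S' by (simp_all add: pt_cel_iff[OF G])
  interpret A: pt_functor G X Y A using c by (simp add: pt_mor_iff[OF G])
  interpret H: icon "fst X" "fst Y" A B H by (rule c)
  have p': "mc p \<in> extensional (Obj (fst X))" using p by (simp add: modification_def)
  have ms: "ms p = Id1 (fst Y) (Unt (fst Y))" using p by (simp add: A.Y.lab_one)
  have mc: "mc p a = \<guillemotleft>Id1 (fst Y) (fo A a)\<guillemotright>\<^bsub>fst Y\<^esub>" if "a \<in> Obj (fst X)" for a
    using that p by (elim A.X.lab_cases) simp
  have "H = K" using modification_iff_eq[OF c(2,3) p' ms mc] p by simp
  moreover have "p = idmod (fst X) (fst Y) H"
  proof (rule modif.equality)
    show "mc p = mc (idmod (fst X) (fst Y) H)"
      by (rule extensionalityI[OF p']) (simp_all add: H.idmod_eq mc)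
  qed (simp_all add: H.idmod_eq ms)
  ultimately show "((X, Y, A, \<alpha>), F', H, m) \<in> pt_cel G
    \<and> T = ((X, Y, A, \<alpha>), F', H, m) \<and> p = idmod (fst X) (fst Y) H \<and> r = \<guillemotleft>Id1 (fst Y) (Unt (fst Y))\<guillemotright>\<^bsub>fst Y\<^esub>"
    using F' T S r c by (simp add: A.Y.lab_one)
next
  assume a: "((X, Y, A, \<alpha>), F', H, m) \<in> pt_cel G
    \<and> T = ((X, Y, A, \<alpha>), F', H, m) \<and> p = idmod (fst X) (fst Y) H \<and> r = \<guillemotleft>Id1 (fst Y) (Unt (fst Y))\<guillemotright>\<^bsub>fst Y\<^esub>"
  obtain X' Y' B \<beta> where F'0: "F' = (X', Y', B, \<beta>)" by (cases F')
  then have F': "F' = (X, Y, B, \<beta>)" using a by (simp add: pt_cel_iff[OF G])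
  then have S: "((X, Y, A, \<alpha>), (X, Y, B, \<beta>), H, m) \<in> pt_cel G" using a by simp
  have c: "(X, Y, A, \<alpha>) \<in> pt_mor G" "icon (fst X) (fst Y) A B H"
    using S by (simp_all add: pt_cel_iff[OF G])
  interpret A: pt_functor G X Y A using c by (simp add: pt_mor_iff[OF G])
  interpret H: icon "fst X" "fst Y" A B H by (rule c)
  have "modification (fst X) (fst Y) A B H H p" "ms p = Id1 (fst Y) (p0 (snd Y) \<one>\<^bsub>G\<^esub>)"
    "\<forall>g \<in> carrier G. mc p (p0 (snd X) g) = \<guillemotleft>Id1 (fst Y) (p0 (snd Y) g)\<guillemotright>\<^bsub>fst Y\<^esub>"
    "r = \<guillemotleft>Id1 (fst Y) (p0 (snd Y) \<one>\<^bsub>G\<^esub>)\<guillemotright>\<^bsub>fst Y\<^esub>"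
    using a H.modification_idmod by (simp_all add: A.Y.lab_one H.idmod_eq)
  moreover have "p = idmod (fst X) (fst Y) H" and "r = \<guillemotleft>Id1 (fst Y) (Unt (fst Y))\<guillemotright>\<^bsub>fst Y\<^esub>"
    using a by simp_all
  note perturbation_pt_identity[OF S, folded this]
  ultimately show "(((X, Y, A, \<alpha>), F', H, m), T, p, r) \<in> pt_cel3 G"
    using S a unfolding pt_cel3_def F' by blast
qed

lemma pt_cel4_iff:
  "((((X, Y, A, \<alpha>), F', H, m), T, p, r), Q, \<xi>) \<in> pt_cel4 G \<longleftrightarrow> (((X, Y, A, \<alpha>), F', H, m), T, p, r) \<in> pt_cel3 G
    \<and> Q = (((X, Y, A, \<alpha>), F', H, m), T, p, r) \<and> \<xi> = \<guillemotleft>Id1 (fst Y) (Unt (fst Y))\<guillemotright>\<^bsub>fst Y\<^esub>"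
proof -
  obtain X' Y' B \<beta> where F': "F' = (X', Y', B, \<beta>)" by (cases F')
  obtain S' T' q s where Q: "Q = (S', T', q, s)" by (cases Q)
  have "perturbation (fst X) (fst Y) A B H H p p \<guillemotleft>Id1 (fst Y) (Unt (fst Y))\<guillemotright>\<^bsub>fst Y\<^esub> \<and> p0 (snd Y) \<one>\<^bsub>G\<^esub> = Unt (fst Y)"
    if "(((X, Y, A, \<alpha>), F', H, m), T, p, r) \<in> pt_cel3 G"
  proof -
    have S: "((X, Y, A, \<alpha>), (X', Y', B, \<beta>), H, m) \<in> pt_cel G" and p: "p = idmod (fst X) (fst Y) H"
      using that by (simp_all add: pt_cel3_iff F')
    have c: "(X, Y, A, \<alpha>) \<in> pt_mor G" "icon (fst X) (fst Y) A B H"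
      using S by (simp_all add: pt_cel_iff[OF G])
    interpret A: pt_functor G X Y A using c by (simp add: pt_mor_iff[OF G])
    interpret H: icon "fst X" "fst Y" A B H by (rule c)
    show ?thesis
      by (simp add: p perturbation_def cell_def H.idmod_eq A.Y.lab_one)
  qed
  moreover have "((S, T, p, r), (S', T', q, s), \<xi>) \<in> pt_cel4 G \<longleftrightarrow>
      (S, T, p, r) \<in> pt_cel3 G \<and> (S', T', q, s) \<in> pt_cel3 G \<and> S' = S \<and> T' = T
      \<and> (case (S, T) of (((X, Y, A, \<alpha>), (_, _, B, \<beta>), H, m), (_, _, K, n)) \<Rightarrow>
           perturbation (fst X) (fst Y) A B H K p q \<xi>
         \<and> \<xi> = \<guillemotleft>Id1 (fst Y) (p0 (snd Y) \<one>\<^bsub>G\<^esub>)\<guillemotright>\<^bsub>fst Y\<^esub>)" for S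
    unfolding pt_cel4_def by blast
  ultimately show ?thesis
    unfolding Q F' by (auto simp: pt_cel3_iff)
qed

end

lemma Cat3pt_simps:
  "Obj (Cat3pt G) = pt_obj G" "Arr (Cat3pt G) = pt_mor G" "Cel (Cat3pt G) = pt_cel G"
  "Cel3 (Cat3pt G) = pt_cel3 G" "Cel4 (Cat3pt G) = pt_cel4 G"
  "Dom (Cat3pt G) (X, Y, A, \<alpha>) = X" "Cod (Cat3pt G) (X, Y, A, \<alpha>) = Y"
  "Src (Cat3pt G) (F, F', H, m) = F" "Tgt (Cat3pt G) (F, F', H, m) = F'"
  "Id1 (Cat3pt G) X = (X, X, idfun3 (fst X), idtrans (disc G) (fst X) (pi3 G X))"
  "Id2 (Cat3pt G) (X, Y, A, \<alpha>) = ((X, Y, A, \<alpha>), (X, Y, A, \<alpha>), idtrans (fst X) (fst Y) A, pt_unitmod G Y)"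
  "Cmp (Cat3pt G) = pt_cmp G"
  "VCmp (Cat3pt G) (F', (X1, Y1, L, \<gamma>), K, n) ((X, Y, A, \<alpha>), (X2, Y2, B, \<beta>), H, m) =
     ((X, Y, A, \<alpha>), (X, Y, L, \<gamma>), cmptrans (fst X) (fst Y) A B L K H, pt_unitmod G Y)"
  "HCmp (Cat3pt G) ((Y1, Z, A', \<alpha>'), (Y2, Z2, B', \<beta>'), K, n) ((X, Y, A, \<alpha>), (X3, Y3, B, \<beta>), H, m) =
     (pt_cmp G (Y1, Z, A', \<alpha>') (X, Y, A, \<alpha>), pt_cmp G (Y1, Z, B', \<beta>') (X, Y, B, \<beta>),
      htrans (fst X) (fst Y) (fst Z) A B A' B' K H, pt_unitmod G Z)"
  "Src3 (Cat3pt G) (S, T, p, r) = S" "Tgt3 (Cat3pt G) (S, T, p, r) = T"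
  "Id3 (Cat3pt G) ((X, Y, A, \<alpha>), F', H, m) =
     (((X, Y, A, \<alpha>), F', H, m), ((X, Y, A, \<alpha>), F', H, m), idmod (fst X) (fst Y) H, \<guillemotleft>ms m\<guillemotright>\<^bsub>fst Y\<^esub>)"
  "Src4 (Cat3pt G) (S4, T4, \<xi>) = S4" "Tgt4 (Cat3pt G) (S4, T4, \<xi>) = T4"
  "Id4 (Cat3pt G) (((X, Y, A, \<alpha>), F', H, m), T, p, r) =
     ((((X, Y, A, \<alpha>), F', H, m), T, p, r), (((X, Y, A, \<alpha>), F', H, m), T, p, r), \<guillemotleft>ms p\<guillemotright>\<^bsub>fst Y\<^esub>)"
  by (simp_all add: Cat3pt_def)

theorem corollary3p5:
  fixes G :: "('g, 'w) monoid_scheme"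
  assumes "group G"
  shows "isomorphic_to_2category
    (Cat3pt G :: (('g,'o,'m,'t) pt0, ('g,'o,'m,'t) pt1, ('g,'o,'m,'t) pt2, ('g,'o,'m,'t) pt3, ('g,'o,'m,'t) pt4) fourcat)
    (Cat3st G :: (('g,'o,'m,'t) st0, ('g,'o,'m,'t) st1, ('g,'o,'m,'t) st2) twocat)"
proof -
  let ?P = "Cat3pt G :: (('g,'o,'m,'t) pt0, ('g,'o,'m,'t) pt1, ('g,'o,'m,'t) pt2, ('g,'o,'m,'t) pt3, ('g,'o,'m,'t) pt4) fourcat"
  let ?S = "Cat3st G :: (('g,'o,'m,'t) st0, ('g,'o,'m,'t) st1, ('g,'o,'m,'t) st2) twocat"
  note G = assms
  note mor = pt_mor_iff_st[OF G] and cel = pt_cel_iff_st[OF G]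
  note simps = Cat3pt_simps[of G]
  have unit1: "ms m = Id1 (fst Y) (Unt (fst Y))" if "((X, Y, A, \<alpha>), F', H, m) \<in> pt_cel G"
    for X Y :: "('g,'o,'m,'t) pt0" and A \<alpha> F' H m
  proof -
    have "labelled G (fst Y) (p0 (snd Y))" "m = pt_unitmod G Y"
      using that by (cases F'; simp add: pt_cel_iff[OF G] pt_mor_iff[OF G] pt_functor_def)+
    then show ?thesis by (simp add: pt_unitmod_def labelled.lab_one)
  qed
  have unit2: "ms p = Id1 (fst Y) (Unt (fst Y))" if "(((X, Y, A, \<alpha>), F', H, m), T, p, r) \<in> pt_cel3 G"
    for X Y :: "('g,'o,'m,'t) pt0" and A \<alpha> F' H m T p r
    using that by (cases F') (auto simp: pt_cel3_iff[OF G] pt_cel_iff[OF G] icon.idmod_eq)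
  have st2: "strict_2category ?S" by (rule strict_2category_Cat3st[OF G])
  have dom: "\<forall>x \<in> Arr ?P. Dom ?P x \<in> Obj ?P \<and> Cod ?P x \<in> Obj ?P
      \<and> Dom ?S (unpoint1 x) = unpoint0 (Dom ?P x) \<and> Cod ?S (unpoint1 x) = unpoint0 (Cod ?P x)"
    by (auto simp: simps mor)
  have src: "\<forall>f \<in> Cel ?P. Src ?P f \<in> Arr ?P \<and> Tgt ?P f \<in> Arr ?P
      \<and> Src ?S (unpoint2 f) = unpoint1 (Src ?P f) \<and> Tgt ?S (unpoint2 f) = unpoint1 (Tgt ?P f)"
    by (auto simp: simps cel)
  have id1: "\<forall>a \<in> Obj ?P. Id1 ?P a \<in> Arr ?P \<and> unpoint1 (Id1 ?P a) = Id1 ?S (unpoint0 a)"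
    using pt_id1[OF G] by (auto simp: simps)
  have id2: "\<forall>x \<in> Arr ?P. Id2 ?P x \<in> Cel ?P \<and> unpoint2 (Id2 ?P x) = Id2 ?S (unpoint1 x)"
    by (auto simp: simps pt_cel_iff[OF G] pt_mor_iff[OF G] pt_functor_iff[OF G] mon_fun.icon_idtrans)
  have cmp: "\<forall>x \<in> Arr ?P. \<forall>y \<in> Arr ?P. Cod ?P x = Dom ?P y \<longrightarrow>
      y \<cdot>\<^bsub>?P\<^esub> x \<in> Arr ?P \<and> unpoint1 (y \<cdot>\<^bsub>?P\<^esub> x) = unpoint1 y \<cdot>\<^bsub>?S\<^esub> unpoint1 x"
    using pt_cmp_eq[OF G] by (auto simp: simps)
  have vcmp: "\<forall>f \<in> Cel ?P. \<forall>g \<in> Cel ?P. Tgt ?P f = Src ?P g \<longrightarrow>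
      g \<bullet>\<^bsub>?P\<^esub> f \<in> Cel ?P \<and> unpoint2 (g \<bullet>\<^bsub>?P\<^esub> f) = unpoint2 g \<bullet>\<^bsub>?S\<^esub> unpoint2 f"
    by (auto simp: simps pt_cel_iff[OF G] icon_pair.icon_cmptrans icon_pair_def)
  have hcmp: "g \<star>\<^bsub>?P\<^esub> f \<in> Cel ?P \<and> unpoint2 (g \<star>\<^bsub>?P\<^esub> f) = unpoint2 g \<star>\<^bsub>?S\<^esub> unpoint2 f"
    if fg: "f \<in> Cel ?P" "g \<in> Cel ?P" and m: "Cod ?P (Src ?P f) = Dom ?P (Src ?P g)" for f g
  proof -
    obtain X Y A \<alpha> B \<beta> H m where f: "f = ((X, Y, A, \<alpha>), (X, Y, B, \<beta>), H, m)"
      using fg(1) by (cases f) (auto simp: simps cel)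
    obtain Z A' \<alpha>' B' \<beta>' K n where g: "g = ((Y, Z, A', \<alpha>'), (Y, Z, B', \<beta>'), K, n)"
      using fg(2) m by (cases g) (auto simp: simps cel f)
    have c: "(X, Y, A, \<alpha>) \<in> pt_mor G" "(X, Y, B, \<beta>) \<in> pt_mor G" "icon (fst X) (fst Y) A B H"
      "(Y, Z, A', \<alpha>') \<in> pt_mor G" "(Y, Z, B', \<beta>') \<in> pt_mor G" "icon (fst Y) (fst Z) A' B' K"
      using fg by (simp_all add: f g simps pt_cel_iff[OF G])
    note 1 = pt_cmp_eq[OF G c(1,4)] and 2 = pt_cmp_eq[OF G c(2,5)] and 3 = icon_htrans(1)[OF c(3,6)]
    obtain \<gamma> where \<gamma>: "pt_cmp G (Y, Z, A', \<alpha>') (X, Y, A, \<alpha>) = (X, Z, cmp3 (fst X) (fst Y) (fst Z) A' A, \<gamma>)"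
      by (simp add: pt_cmp_def)
    obtain \<delta> where \<delta>: "pt_cmp G (Y, Z, B', \<beta>') (X, Y, B, \<beta>) = (X, Z, cmp3 (fst X) (fst Y) (fst Z) B' B, \<delta>)"
      by (simp add: pt_cmp_def)
    show ?thesis
      using 1 2 3 by (simp add: f g simps \<gamma> \<delta> pt_cel_iff[OF G])
  qed
  have id3: "bij_betw (Id3 ?P) (Cel ?P) (Cel3 ?P)"
    unfolding bij_betw_def
  proof
    show "inj_on (Id3 ?P) (Cel ?P)" by (auto simp: inj_on_def simps)
    show "Id3 ?P ` Cel ?P = Cel3 ?P"
    proof
      show "Id3 ?P ` Cel ?P \<subseteq> Cel3 ?P" by (auto simp: simps pt_cel3_iff[OF G] unit1)
      show "Cel3 ?P \<subseteq> Id3 ?P ` Cel ?P"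
      proof
        fix Q assume Q: "Q \<in> Cel3 ?P"
        then obtain X Y A \<alpha> F' H m T p r where q: "Q = (((X, Y, A, \<alpha>), F', H, m), T, p, r)"
          by (metis prod_cases3 surj_pair)
        have "Q = Id3 ?P ((X, Y, A, \<alpha>), F', H, m)" "((X, Y, A, \<alpha>), F', H, m) \<in> Cel ?P"
          using Q by (auto simp: q simps pt_cel3_iff[OF G] unit1)
        then show "Q \<in> Id3 ?P ` Cel ?P" by blast
      qed
    qed
  qed
  have id4: "bij_betw (Id4 ?P) (Cel3 ?P) (Cel4 ?P)"
    unfolding bij_betw_def
  proof
    show "inj_on (Id4 ?P) (Cel3 ?P)" by (auto simp: inj_on_def simps)
    show "Id4 ?P ` Cel3 ?P = Cel4 ?P"
    proof
      show "Id4 ?P ` Cel3 ?P \<subseteq> Cel4 ?P" by (auto simp: simps pt_cel4_iff[OF G] unit2)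
      show "Cel4 ?P \<subseteq> Id4 ?P ` Cel3 ?P"
      proof
        fix Q assume Q: "Q \<in> Cel4 ?P"
        then obtain X Y A \<alpha> F' H m T p r R \<xi> where q: "Q = ((((X, Y, A, \<alpha>), F', H, m), T, p, r), R, \<xi>)"
          by (metis prod_cases3 surj_pair)
        have "Q = Id4 ?P (((X, Y, A, \<alpha>), F', H, m), T, p, r)" "(((X, Y, A, \<alpha>), F', H, m), T, p, r) \<in> Cel3 ?P"
          using Q by (auto simp: q simps pt_cel4_iff[OF G] unit2)
        then show "Q \<in> Id4 ?P ` Cel3 ?P" by blast
      qed
    qed
  qed
  have st3: "\<forall>f \<in> Cel ?P. Src3 ?P (Id3 ?P f) = f \<and> Tgt3 ?P (Id3 ?P f) = f"
    and st4: "\<forall>p \<in> Cel3 ?P. Src4 ?P (Id4 ?P p) = p \<and> Tgt4 ?P (Id4 ?P p) = p"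
    by (auto simp: simps)
  show ?thesis
    unfolding isomorphic_to_2category_def
  proof (intro conjI exI)
    show "bij_betw unpoint0 (Obj ?P) (Obj ?S)" "bij_betw unpoint1 (Arr ?P) (Arr ?S)" "bij_betw unpoint2 (Cel ?P) (Cel ?S)"
      using bij_unpoint0[OF G] bij_unpoint1[OF G] bij_unpoint2[OF G] by (simp_all add: simps)
    show "\<forall>f \<in> Cel ?P. \<forall>g \<in> Cel ?P. Cod ?P (Src ?P f) = Dom ?P (Src ?P g) \<longrightarrow>
        g \<star>\<^bsub>?P\<^esub> f \<in> Cel ?P \<and> unpoint2 (g \<star>\<^bsub>?P\<^esub> f) = unpoint2 g \<star>\<^bsub>?S\<^esub> unpoint2 f"
      using hcmp by blast
  qed (fact st2 dom src id1 id2 cmp vcmp id3 st3 id4 st4)+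
qed

end
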